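(* Let $(\mathbb{K},|\cdot|)$ be either $\mathbb{R}$ with its usual absolute value, or an ultrametric field. Let $E$ and $F$ be (Hausdorff) topological $\mathbb{K}$-vector spaces and let $f\colon U\to F$ be a map defined on a non-empty open subset $U\subseteq E$. Assume $E$ is metrizable. Then for each $k\in\mathbb{N}_0$ the following are equivalent: (a) $f$ is of class $C^k_{\mathbb{K}}$; (b) for every smooth map $c\colon\mathbb{K}^{k+1}\to E$ with image in $U$, the composition $f\circ c\colon\mathbb{K}^{k+1}\to F$ is of class $C^k_{\mathbb{K}}$. In particular, $f$ is smooth if and only if $f\circ c$ is smooth for every $k\in\mathbb{N}$ and every smooth map $c\colon\mathbb{K}^k\to E$ with image in $U$.
   Context: An ultrametric field is a field $\mathbb{K}$ with a non-trivial absolute value $|\cdot|\colon\mathbb{K}\to[0,\infty[$ satisfying $|x+y|\le\max\{|x|,|y|\}$, with the induced topology. All topological vector spaces are Hausdorff; products carry the product topology. Differential calculus: for a topological $\mathbb{K}$-vector space $E$ and open $U\subseteq E$, set $U^{[1]}:=\{(x,v,t)\in U\times E\times\mathbb{K}: x+tv\in U\}$, an open subset of $E\times E\times\mathbb{K}$. A map $f\colon U\to F$ into a topological $\mathbb{K}$-vector space $F$ is of class $C^0$ if it is continuous, and of class $C^1$ if it is continuous and there is a continuous map $f^{[1]}\colon U^{[1]}\to F$ with $f(x+tv)-f(x)=t\,f^{[1]}(x,v,t)$ for all $(x,v,t)\in U^{[1]}$ (such $f^{[1]}$ is unique). Recursively, $U^{[k+1]}:=(U^{[k]})^{[1]}$,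 and $f$ is of class $C^{k+1}$ if it is $C^k$ and $f^{[k]}\colon U^{[k]}\to F$ is $C^1$, with $f^{[k+1]}:=(f^{[k]})^{[1]}$. The map $f$ is smooth ($C^\infty$) if it is $C^k$ for all $k\in\mathbb{N}_0$. $\mathbb{N}=\{1,2,\dots\}$. *)

theory Defs
  imports "HOL-Analysis.Analysis" "HOL-Library.Function_Algebras"
begin

definition abs_val :: "('k::field \<Rightarrow> real) \<Rightarrow> bool" where
  "abs_val av \<longleftrightarrow> (\<forall>x. av x \<ge> 0) \<and> (\<forall>x. av x = 0 \<longleftrightarrow> x = 0)
     \<and> (\<forall>x y. av (x * y) = av x * av y) \<and> (\<forall>x y. av (x + y) \<le> av x + av y)"

definition ultrametric_field :: "('k::field \<Rightarrow> real) \<Rightarrow> bool" where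
  "ultrametric_field av \<longleftrightarrow> abs_val av \<and> (\<exists>x. av x \<noteq> 0 \<and> av x \<noteq> 1)
     \<and> (\<forall>x y. av (x + y) \<le> max (av x) (av y))"

definition real_field :: "('k::field \<Rightarrow> real) \<Rightarrow> bool" where
  "real_field av \<longleftrightarrow> (\<exists>\<phi>::'k \<Rightarrow> real. bij \<phi> \<and> (\<forall>x y. \<phi> (x + y) = \<phi> x + \<phi> y)
     \<and> (\<forall>x y. \<phi> (x * y) = \<phi> x * \<phi> y) \<and> \<phi> 1 = 1 \<and> (\<forall>x. av x = \<bar>\<phi> x\<bar>))"

definition ktop :: "('k::field \<Rightarrow> real) \<Rightarrow> 'k topology" where
  "ktop av = topology (\<lambda>S. \<forall>x\<in>S. \<exists>e>0. \<forall>y. av (y - x) < e \<longrightarrow> y \<in> S)"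

definition tvs :: "('k::field \<Rightarrow> real) \<Rightarrow> ('k \<Rightarrow> 'a::ab_group_add \<Rightarrow> 'a) \<Rightarrow> 'a set \<Rightarrow> 'a topology \<Rightarrow> bool" where
  "tvs av sc V T \<longleftrightarrow> topspace T = V \<and> 0 \<in> V \<and> (\<forall>x\<in>V. \<forall>y\<in>V. x + y \<in> V)
     \<and> (\<forall>a. \<forall>x\<in>V. sc a x \<in> V)
     \<and> (\<forall>a. \<forall>x\<in>V. \<forall>y\<in>V. sc a (x + y) = sc a x + sc a y)
     \<and> (\<forall>a b. \<forall>x\<in>V. sc (a + b) x = sc a x + sc b x)
     \<and> (\<forall>a b. \<forall>x\<in>V. sc a (sc b x) = sc (a * b) x)
     \<and> (\<forall>x\<in>V. sc 1 x = x)
     \<and> continuous_map (prod_topology T T) T (\<lambda>(x, y). x + y)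
     \<and> continuous_map (prod_topology (ktop av) T) T (\<lambda>(a, x). sc a x)
     \<and> Hausdorff_space T"

text \<open>The space K^n, realised as the sequences vanishing from index n on, with the
  (subspace of the) product topology.\<close>
definition Kn :: "nat \<Rightarrow> (nat \<Rightarrow> 'k::field) set" where
  "Kn n = {x. \<forall>i\<ge>n. x i = 0}"

definition Kscale :: "'k::field \<Rightarrow> (nat \<Rightarrow> 'k) \<Rightarrow> (nat \<Rightarrow> 'k)" where
  "Kscale a x = (\<lambda>i. a * x i)"

definition Ktop :: "('k::field \<Rightarrow> real) \<Rightarrow> nat \<Rightarrow> (nat \<Rightarrow> 'k) topology" where
  "Ktop av n = subtopology (product_topology (\<lambda>_. ktop av) UNIV) (Kn n)"

section \<open>The iterated spaces E^[k] = E^[k-1] x E^[k-1] x K, encoded as trees\<close>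

datatype ('a, 'k) pt = Base 'a | Node "('a, 'k) pt" "('a, 'k) pt" 'k

fun ptadd :: "('a::plus, 'k::plus) pt \<Rightarrow> ('a, 'k) pt \<Rightarrow> ('a, 'k) pt" where
  "ptadd (Base x) (Base y) = Base (x + y)"
| "ptadd (Node a b s) (Node a' b' s') = Node (ptadd a a') (ptadd b b') (s + s')"
| "ptadd x y = x"

fun ptscale :: "('k \<Rightarrow> 'a \<Rightarrow> 'a) \<Rightarrow> 'k::times \<Rightarrow> ('a, 'k) pt \<Rightarrow> ('a, 'k) pt" where
  "ptscale sc c (Base x) = Base (sc c x)"
| "ptscale sc c (Node a b s) = Node (ptscale sc c a) (ptscale sc c b) (c * s)"

fun lvl :: "'a set \<Rightarrow> nat \<Rightarrow> ('a, 'k) pt set" where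
  "lvl V 0 = Base ` V"
| "lvl V (Suc n) = {Node a b s | a b s. a \<in> lvl V n \<and> b \<in> lvl V n}"

text \<open>Transport of a topology along an injective map.\<close>
definition img_top :: "('x \<Rightarrow> 'y) \<Rightarrow> 'x topology \<Rightarrow> 'y topology" where
  "img_top g X = topology (\<lambda>S. \<exists>W. openin X W \<and> S = g ` W)"

fun ptop :: "('k::field \<Rightarrow> real) \<Rightarrow> 'a topology \<Rightarrow> nat \<Rightarrow> ('a, 'k) pt topology" where
  "ptop av T 0 = img_top Base T"
| "ptop av T (Suc n) = img_top (\<lambda>(a, b, s). Node a b s)
      (prod_topology (ptop av T n) (prod_topology (ptop av T n) (ktop av)))"

definition ext :: "('k::field \<Rightarrow> 'a::ab_group_add \<Rightarrow> 'a) \<Rightarrow> 'a set \<Rightarrow> nat \<Rightarrow> ('a, 'k) pt set \<Rightarrow> ('a, 'k) pt set" where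
  "ext sc V n U = {Node x v t | x v t. x \<in> U \<and> v \<in> lvl V n \<and> ptadd x (ptscale sc t v) \<in> U}"

fun iterU :: "('k::field \<Rightarrow> 'a::ab_group_add \<Rightarrow> 'a) \<Rightarrow> 'a set \<Rightarrow> 'a set \<Rightarrow> nat \<Rightarrow> ('a, 'k) pt set" where
  "iterU sc V U 0 = Base ` U"
| "iterU sc V U (Suc n) = ext sc V n (iterU sc V U n)"

definition Ck :: "('k::field \<Rightarrow> real) \<Rightarrow> ('k \<Rightarrow> 'a::ab_group_add \<Rightarrow> 'a) \<Rightarrow> 'a set \<Rightarrow> 'a topology
    \<Rightarrow> ('k \<Rightarrow> 'c::ab_group_add \<Rightarrow> 'c) \<Rightarrow> 'c topology \<Rightarrow> 'a set \<Rightarrow> ('a \<Rightarrow> 'c) \<Rightarrow> nat \<Rightarrow> bool" where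
  "Ck av scD VD TD scC TC U f k \<longleftrightarrow>
    (\<exists>g :: nat \<Rightarrow> ('a, 'k) pt \<Rightarrow> 'c.
       (\<forall>x\<in>U. g 0 (Base x) = f x)
     \<and> continuous_map (subtopology (ptop av TD 0) (Base ` U)) TC (g 0)
     \<and> (\<forall>j<k. continuous_map (subtopology (ptop av TD (Suc j)) (iterU scD VD U (Suc j))) TC (g (Suc j))
           \<and> (\<forall>x v t. Node x v t \<in> iterU scD VD U (Suc j) \<longrightarrow>
                 g j (ptadd x (ptscale scD t v)) - g j x = scC t (g (Suc j) (Node x v t)))))"

definition smooth :: "('k::field \<Rightarrow> real) \<Rightarrow> ('k \<Rightarrow> 'a::ab_group_add \<Rightarrow> 'a) \<Rightarrow> 'a set \<Rightarrow> 'a topology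
    \<Rightarrow> ('k \<Rightarrow> 'c::ab_group_add \<Rightarrow> 'c) \<Rightarrow> 'c topology \<Rightarrow> 'a set \<Rightarrow> ('a \<Rightarrow> 'c) \<Rightarrow> bool" where
  "smooth av scD VD TD scC TC U f \<longleftrightarrow> (\<forall>k. Ck av scD VD TD scC TC U f k)"

end

theory Submission
  imports Defs
begin

text \<open>One direction is the chain rule. For the converse induct on \<open>k\<close>. If \<open>x\<^sub>i \<rightarrow> x\<close> in the metrizable space \<open>E\<close>,
  a sequence chosen to converge fast lies on a smooth curve \<open>x + (\<Sum>i. h\<^sub>i (x\<^sub>i - x))\<close>, where the \<open>h\<^sub>i\<close> are bump
  functions with disjoint supports clustering at \<open>0\<close>; this settles \<open>k = 0\<close>. In the induction step, \<open>f\<^bsup>[1]\<^esup>\<close>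
  along a smooth map \<open>c\<close> of \<open>k\<close> variables is the difference quotient of \<open>f \<circ> g\<close> for a smooth map \<open>g\<close>
  of \<open>k + 1\<close> variables, which need not take all its values in \<open>U\<close>; one composes \<open>g\<close> with smooth
  maps that are the identity near a given point and have small image, and uses that
  being \<open>C\<^sup>k\<close> is a local property. The bump functions are indicator functions of balls in the
  ultrametric case and are built from \<open>exp (- 1 / x)\<close> in the real case, where the
  ordinary derivatives yield the difference quotients through
  \<open>f (x + t v) - f x = t v \<integral> f' (x + s t v) ds\<close>.\<close>

section \<open>Trees and their topology\<close>

text \<open>The supports of the bumps shrink to \<open>0\<close>, so their difference quotients have
  no common bound. The remedy is diagonal: the \<open>i\<close>-th point is so close to the limit
  that its difference from the limit, multiplied by any value of the first \<open>i\<close> iterated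
  difference quotients of the \<open>i\<close>-th bump on the ball of radius \<open>i\<close>, stays
  in the \<open>i\<close>-th of a shrinking sequence of neighbourhoods of \<open>0\<close>. For a
  given order and a given bounded set this controls all but finitely many terms. The induction
  passes from \<open>f\<close> to its difference quotient map, which lives on trees one level up, so
  the statement is proved for all levels at once. Trees of all shapes share one type without a
  common zero, which is why codomains carry only \<open>+\<close> and differences are written as
  sums. The number \<open>k + 1\<close> arises as one parameter for continuity and one for the
  direction in each order of differentiation.\<close>

instantiation pt :: (plus, plus) plus
begin
definition plus_pt :: "('a, 'b) pt \<Rightarrow> ('a, 'b) pt \<Rightarrow> ('a, 'b) pt" where
  "plus_pt = ptadd"
instance ..
end

lemma ptadd_eq_plus: "ptadd = (+)"
  by (simp add: plus_pt_def)

lemma plus_pt_simps [simp]: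
  "Base x + Base y = Base (x + y)"
  "Node a b s + Node a' b' s' = Node (a + a') (b + b') (s + s')"
  by (simp_all add: plus_pt_def)

primrec unBase :: "('a, 'k) pt \<Rightarrow> 'a" where "unBase (Base x) = x"
primrec pfst :: "('a, 'k) pt \<Rightarrow> ('a, 'k) pt" where "pfst (Node a b s) = a"
primrec psnd :: "('a, 'k) pt \<Rightarrow> ('a, 'k) pt" where "psnd (Node a b s) = b"
primrec ptrd :: "('a, 'k) pt \<Rightarrow> 'k" where "ptrd (Node a b s) = s"

lemma lvl_0_iff: "p \<in> lvl V 0 \<longleftrightarrow> (\<exists>x\<in>V. p = Base x)"
  by auto

lemma lvl_Suc_iff: "p \<in> lvl V (Suc m) \<longleftrightarrow> (\<exists>a\<in>lvl V m. \<exists>b\<in>lvl V m. \<exists>s. p = Node a b s)"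
  by auto

lemma lvl_SucE:
  assumes "p \<in> lvl V (Suc m)"
  obtains a b s where "p = Node a b s" "a \<in> lvl V m" "b \<in> lvl V m"
  using assms by auto

lemma Node_lvl [simp]: "Node a b s \<in> lvl V (Suc m) \<longleftrightarrow> a \<in> lvl V m \<and> b \<in> lvl V m"
  by auto

lemma Base_lvl [simp]: "Base x \<in> lvl V 0 \<longleftrightarrow> x \<in> V"
  by auto

lemma Base_unBase: "p \<in> lvl V 0 \<Longrightarrow> Base (unBase p) = p"
  by auto

lemma Node_sel: "p \<in> lvl V (Suc m) \<Longrightarrow> Node (pfst p) (psnd p) (ptrd p) = p"
  by auto

declare lvl.simps [simp del]

lemma ext_iff: "Node x v t \<in> ext sc V m U \<longleftrightarrow> x \<in> U \<and> v \<in> lvl V m \<and> x + ptscale sc t v \<in> U"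
  by (simp add: ext_def ptadd_eq_plus)

lemma extE:
  assumes "p \<in> ext sc V m U"
  obtains x v t where "p = Node x v t" "x \<in> U" "v \<in> lvl V m" "x + ptscale sc t v \<in> U"
  using assms by (auto simp: ext_def ptadd_eq_plus)

lemma ext_mono: "U \<subseteq> U' \<Longrightarrow> ext sc V m U \<subseteq> ext sc V m U'"
  by (auto simp: ext_def)

lemma ext_subset_lvl: "U \<subseteq> lvl V m \<Longrightarrow> ext sc V m U \<subseteq> lvl V (Suc m)"
  by (auto simp: ext_def)

section \<open>Pointwise continuity and transport of a topology along an injection\<close>

lemma continuous_map_at_iff:
  "continuous_map X Y f \<longleftrightarrow>
     (\<forall>x\<in>topspace X. f x \<in> topspace Y \<and>
        (\<forall>V. openin Y V \<and> f x \<in> V \<longrightarrow> (\<exists>W. openin X W \<and> x \<in> W \<and> (\<forall>y\<in>W. f y \<in> V))))"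
  by (auto simp: continuous_map_eq_topcontinuous_at topcontinuous_at_def)

lemma continuous_map_nhd:
  assumes "continuous_map X Y f" "x \<in> topspace X" "openin Y V" "f x \<in> V"
  obtains W where "openin X W" "x \<in> W" "\<And>y. y \<in> W \<Longrightarrow> f y \<in> V"
  using openin_continuous_map_preimage[OF assms(1,3)] assms(2,4)
  by (auto intro: that[of "{x \<in> topspace X. f x \<in> V}"])

lemma continuous_map_local:
  assumes "\<And>x. x \<in> topspace X \<inter> U \<Longrightarrow> \<exists>W. openin X W \<and> x \<in> W \<and> continuous_map (subtopology X (U \<inter> W)) Y f"
  shows "continuous_map (subtopology X U) Y f"
  unfolding continuous_map_at_iff
proof (intro ballI conjI allI impI)
  fix x assume x: "x \<in> topspace (subtopology X U)"
  then obtain W where W: "openin X W" "x \<in> W" "continuous_map (subtopology X (U \<inter> W)) Y f"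
    using assms[of x] by auto
  have x': "x \<in> topspace (subtopology X (U \<inter> W))" using x W by auto
  show "f x \<in> topspace Y" using continuous_map_image_subset_topspace[OF W(3)] x' by blast
  fix V assume V: "openin Y V \<and> f x \<in> V"
  obtain N where N: "openin (subtopology X (U \<inter> W)) N" "x \<in> N" "\<And>y. y \<in> N \<Longrightarrow> f y \<in> V"
    using continuous_map_nhd[OF W(3) x'] V by metis
  then obtain N' where N': "openin X N'" "N = N' \<inter> (U \<inter> W)" by (auto simp: openin_subtopology)
  have "openin (subtopology X U) (N' \<inter> W \<inter> U)"
    using N' W by (auto simp: openin_subtopology)
  moreover have "N' \<inter> W \<inter> U = N" using N'(2) by blast
  ultimately have "openin (subtopology X U) N" by simp
  then show "\<exists>W. openin (subtopology X U) W \<and> x \<in> W \<and> (\<forall>y\<in>W. f y \<in> V)"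
    using N(2,3) by blast
qed

lemma istopology_img_top: "inj g \<Longrightarrow> istopology (\<lambda>S. \<exists>W. openin X W \<and> S = g ` W)"
proof -
  assume g: "inj g"
  have "\<exists>W. openin X W \<and> g ` A \<inter> g ` B = g ` W" if "openin X A" "openin X B" for A B
    using that g by (metis image_Int openin_Int)
  moreover have "\<exists>W. openin X W \<and> \<Union>\<K> = g ` W" if *: "\<forall>K\<in>\<K>. \<exists>W. openin X W \<and> K = g ` W" for \<K>
  proof -
    obtain w where "\<forall>K\<in>\<K>. openin X (w K) \<and> K = g ` w K" using bchoice[OF *] by blast
    then have "openin X (\<Union>(w ` \<K>))" "\<Union>\<K> = g ` \<Union>(w ` \<K>)" by (auto simp: image_Union)
    then show ?thesis by blast
  qed
  ultimately show ?thesis unfolding istopology_def by blast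
qed

lemma openin_img_top: "inj g \<Longrightarrow> openin (img_top g X) S \<longleftrightarrow> (\<exists>W. openin X W \<and> S = g ` W)"
  unfolding img_top_def by (subst topology_inverse'[OF istopology_img_top]) auto

lemma topspace_img_top: "inj g \<Longrightarrow> topspace (img_top g X) = g ` topspace X"
  by (auto simp: topspace_def[of "img_top g X"] openin_img_top image_iff dest: openin_subset)

lemma continuous_map_into_img_top:
  assumes g: "inj g"
  shows "continuous_map Z (img_top g X) (\<lambda>z. g (h z)) \<longleftrightarrow> continuous_map Z X h"
  using inj_image_mem_iff[OF g] by (auto simp: continuous_map_def openin_img_top[OF g] topspace_img_top[OF g] Pi_iff)

lemma continuous_map_from_img_top:
  assumes g: "inj g"
  shows "continuous_map (img_top g X) Y f \<longleftrightarrow> continuous_map X Y (\<lambda>x. f (g x))"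
proof -
  have "{x \<in> g ` topspace X. f x \<in> U} = g ` {x \<in> topspace X. f (g x) \<in> U}" for U by auto
  then show ?thesis
    by (simp add: continuous_map_def openin_img_top[OF g] topspace_img_top[OF g] inj_image_eq_iff[OF g] Pi_iff)
qed

lemma inj_Base: "inj Base" and inj_Node: "inj (\<lambda>(a, b, s). Node a b s)"
  by (auto simp: inj_def)

section \<open>Absolute values and the topology they induce\<close>

locale valued =
  fixes av :: "'k::field \<Rightarrow> real"
  assumes av_abs_val: "abs_val av"
    and nontrivial: "\<exists>x. av x \<noteq> 0 \<and> av x \<noteq> 1"
begin

lemma av_nonneg [simp]: "av x \<ge> 0"
  and av_eq_0 [simp]: "av x = 0 \<longleftrightarrow> x = 0"
  and av_mult: "av (x * y) = av x * av y"
  and av_triangle: "av (x + y) \<le> av x + av y"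
  using av_abs_val by (auto simp: abs_val_def)

lemma av_0 [simp]: "av 0 = 0" by simp

lemma av_pos [simp]: "0 < av x \<longleftrightarrow> x \<noteq> 0"
  using av_nonneg[of x] av_eq_0[of x] by linarith

lemma av_1 [simp]: "av 1 = 1"
  using av_mult[of 1 1] av_eq_0[of 1] by simp

lemma av_minus [simp]: "av (- x) = av x"
proof -
  have "av (-1) * av (-1) = 1" using av_mult[of "-1" "-1"] by simp
  then have "av (-1) = 1" using av_nonneg[of "-1"]
    by (metis abs_of_nonneg abs_mult_self_eq real_sqrt_abs2 real_sqrt_one)
  then show ?thesis using av_mult[of "-1" x] by simp
qed

lemma av_minus_commute: "av (x - y) = av (y - x)"
  using av_minus[of "x - y"] by simp

lemma av_triangle_sub: "av (x - z) \<le> av (x - y) + av (y - z)"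
  using av_triangle[of "x - y" "y - z"] by simp

lemma av_inverse: "av (inverse x) = inverse (av x)"
  by (cases "x = 0") (use av_mult[of x "inverse x"] in \<open>auto simp: field_simps\<close>)

lemma av_divide: "av (x / y) = av x / av y"
  by (simp add: divide_inverse av_mult av_inverse)

lemma av_power: "av (x ^ n) = av x ^ n"
  by (induction n) (auto simp: av_mult)

text \<open>Either the witness of nontriviality or its inverse works. Despite the name, no
  discreteness of the values is claimed; what matters is that the powers tend to
  \<open>0\<close>.\<close>

lemma ex_uniformizer: "\<exists>p. 0 < av p \<and> av p < 1"
proof -
  obtain x where x: "av x \<noteq> 0" "av x \<noteq> 1" using nontrivial by blast
  then consider "av x < 1" | "av x > 1" by linarith
  then show ?thesis
  proof cases
    case 2
    then show ?thesis by (intro exI[of _ "inverse x"]) (use x 2 in \<open>auto simp: av_inverse inverse_less_1_iff simp del: inverse_eq_divide\<close>)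
  qed (use x in auto)
qed

lemma ex_small: "e > 0 \<Longrightarrow> \<exists>x. x \<noteq> 0 \<and> av x < e"
proof -
  assume e: "e > 0"
  obtain p where p: "0 < av p" "av p < 1" using ex_uniformizer by blast
  obtain n where "av p ^ n < e" using real_arch_pow_inv[OF e p(2)] by blast
  then show ?thesis using p by (intro exI[of _ "p ^ n"]) (auto simp: av_power)
qed

lemma ex_large: "\<exists>x. x \<noteq> 0 \<and> R < av x"
proof -
  obtain x where x: "x \<noteq> 0" "av x < inverse (max R 1)" using ex_small[of "inverse (max R 1)"] by (meson inverse_positive_iff_positive less_max_iff_disj zero_less_one)
  have p: "0 < av x" using x by simp
  have "max R 1 < inverse (av x)"
    using less_imp_inverse_less[OF x(2) p] by simp
  then show ?thesis by (intro exI[of _ "inverse x"]) (use x in \<open>auto simp: av_inverse\<close>)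
qed

lemma openin_ktop: "openin (ktop av) S \<longleftrightarrow> (\<forall>x\<in>S. \<exists>e>0. \<forall>y. av (y - x) < e \<longrightarrow> y \<in> S)"
proof -
  have "istopology (\<lambda>S. \<forall>x\<in>S. \<exists>e>0. \<forall>y. av (y - x) < e \<longrightarrow> y \<in> S)"
    unfolding istopology_def
  proof (intro conjI allI impI ballI)
    fix S T x
    assume S: "\<forall>x\<in>S. \<exists>e>0. \<forall>y. av (y - x) < e \<longrightarrow> y \<in> S" and T: "\<forall>x\<in>T. \<exists>e>0. \<forall>y. av (y - x) < e \<longrightarrow> y \<in> T"
      and x: "x \<in> S \<inter> T"
    then obtain e e' where "e > 0" "\<forall>y. av (y - x) < e \<longrightarrow> y \<in> S" "e' > 0" "\<forall>y. av (y - x) < e' \<longrightarrow> y \<in> T"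
      by blast
    then show "\<exists>e>0. \<forall>y. av (y - x) < e \<longrightarrow> y \<in> S \<inter> T"
      by (intro exI[of _ "min e e'"]) auto
  next
    fix \<K> x
    assume K: "\<forall>K\<in>\<K>. \<forall>x\<in>K. \<exists>e>0. \<forall>y. av (y - x) < e \<longrightarrow> y \<in> K" and "x \<in> \<Union>\<K>"
    then obtain K where "K \<in> \<K>" "x \<in> K" by blast
    moreover from this K obtain e where "e > 0" "\<forall>y. av (y - x) < e \<longrightarrow> y \<in> K" by blast
    ultimately show "\<exists>e>0. \<forall>y. av (y - x) < e \<longrightarrow> y \<in> \<Union>\<K>" by blast
  qed
  then show ?thesis unfolding ktop_def by (simp add: topology_inverse')
qed

lemma topspace_ktop [simp]: "topspace (ktop av) = UNIV"
proof -
  have "openin (ktop av) UNIV" by (auto simp: openin_ktop intro: exI[of _ 1])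
  then show ?thesis using openin_subset by blast
qed

lemma ktop_metric: "Metric_space UNIV (\<lambda>x y. av (x - y))"
  by unfold_locales (auto simp: av_minus_commute av_triangle_sub)

lemma ktop_eq_mtopology: "ktop av = Metric_space.mtopology UNIV (\<lambda>x y. av (x - y))"
  unfolding topology_eq
  by (auto simp: openin_ktop Metric_space.openin_mtopology[OF ktop_metric]
      Metric_space.mball_def[OF ktop_metric] subset_eq av_minus_commute)

lemma openin_ball: "openin (ktop av) {y. av (y - x) < e}"
  unfolding openin_ktop
proof
  fix z assume "z \<in> {y. av (y - x) < e}"
  then show "\<exists>d>0. \<forall>y. av (y - z) < d \<longrightarrow> y \<in> {y. av (y - x) < e}"
    by (intro exI[of _ "e - av (z - x)"]) (auto intro: le_less_trans[OF av_triangle_sub[of _ x z]])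
qed

lemma openin_outside_cball: "openin (ktop av) {y. av (y - x) > e}"
  unfolding openin_ktop
proof
  fix z assume z: "z \<in> {y. av (y - x) > e}"
  have "av (y - x) > e" if "av (y - z) < av (z - x) - e" for y
    using av_triangle_sub[of z x y] that by (simp add: av_minus_commute)
  then show "\<exists>d>0. \<forall>y. av (y - z) < d \<longrightarrow> y \<in> {y. av (y - x) > e}"
    by (intro exI[of _ "av (z - x) - e"]) (use z in auto)
qed

lemma continuous_map_into_ktop:
  "continuous_map X (ktop av) f \<longleftrightarrow>
     (\<forall>x\<in>topspace X. \<forall>e>0. \<exists>W. openin X W \<and> x \<in> W \<and> (\<forall>y\<in>W. av (f y - f x) < e))" (is "_ = ?R")
proof
  assume f: "continuous_map X (ktop av) f"
  show ?R
  proof (intro ballI allI impI)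
    fix x and e :: real assume x: "x \<in> topspace X" "e > 0"
    obtain W where "openin X W" "x \<in> W" "\<And>y. y \<in> W \<Longrightarrow> f y \<in> {y. av (y - f x) < e}"
      by (rule continuous_map_nhd[OF f x(1) openin_ball[of "f x" e]]) (use x in auto)
    then show "\<exists>W. openin X W \<and> x \<in> W \<and> (\<forall>y\<in>W. av (f y - f x) < e)" by auto
  qed
next
  assume R: ?R
  show "continuous_map X (ktop av) f"
    unfolding continuous_map_at_iff
  proof (intro ballI conjI allI impI)
    fix x V assume x: "x \<in> topspace X" and "openin (ktop av) V \<and> f x \<in> V"
    then obtain e where e: "e > 0" "\<forall>y. av (y - f x) < e \<longrightarrow> y \<in> V" by (auto simp: openin_ktop)
    obtain W where "openin X W" "x \<in> W" "\<forall>y\<in>W. av (f y - f x) < e"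
      using R[rule_format, OF x e(1)] by (elim exE conjE)
    then show "\<exists>W. openin X W \<and> x \<in> W \<and> (\<forall>y\<in>W. f y \<in> V)" using e by blast
  qed simp
qed

lemma Hausdorff_ktop: "Hausdorff_space (ktop av)"
  unfolding ktop_eq_mtopology by (rule Metric_space.Hausdorff_space_mtopology[OF ktop_metric])

lemma first_countable_ktop: "first_countable (ktop av)"
  unfolding ktop_eq_mtopology
  by (intro metrizable_imp_first_countable Metric_space.metrizable_space_mtopology ktop_metric)

lemma continuous_ktop_add: "continuous_map (prod_topology (ktop av) (ktop av)) (ktop av) (\<lambda>(x, y). x + y)"
  unfolding continuous_map_into_ktop
proof clarsimp
  fix a b and e :: real assume e: "e > 0"
  let ?W = "{y. av (y - a) < e/2} \<times> {y. av (y - b) < e/2}"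
  have "av (x + y - (a + b)) < e" if "av (x - a) < e/2" "av (y - b) < e/2" for x y
    using av_triangle[of "x - a" "y - b"] that by (simp add: algebra_simps)
  then show "\<exists>W. openin (prod_topology (ktop av) (ktop av)) W \<and> (a, b) \<in> W \<and>
      (\<forall>y\<in>W. av ((case y of (x, y) \<Rightarrow> x + y) - (a + b)) < e)"
    by (intro exI[of _ ?W]) (use e in \<open>auto simp: openin_prod_Times_iff openin_ball simp del: less_divide_eq_numeral1\<close>)
qed

lemma continuous_ktop_mult: "continuous_map (prod_topology (ktop av) (ktop av)) (ktop av) (\<lambda>(x, y). x * y)"
  unfolding continuous_map_into_ktop
proof clarsimp
  fix a b and e :: real assume e: "e > 0"
  \<comment> \<open>The three terms of the expansion of \<open>x * y - a * b\<close> below are at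
    most \<open>d * d\<close>, \<open>d * av b\<close> and \<open>av a * d\<close>;
    \<open>d \<le> 1\<close> reduces the first to \<open>d\<close>, and the factor 2 leaves room for
    a strict inequality.\<close>
  define d where "d = min 1 (e / (2 * (1 + av a + av b)))"
  have pos: "1 + av a + av b > 0" using av_nonneg[of a] av_nonneg[of b] by linarith
  have d: "d > 0" "d \<le> 1" using e pos by (auto simp: d_def)
  have d2: "d * (1 + av a + av b) \<le> e / 2"
  proof -
    have "d \<le> e / (2 * (1 + av a + av b))" by (simp add: d_def)
    then have "d * (1 + av a + av b) \<le> e / (2 * (1 + av a + av b)) * (1 + av a + av b)"
      using pos by (intro mult_right_mono) auto
    also have "\<dots> = e / 2" using pos by (simp add: field_simps)
    finally show ?thesis .
  qed
  let ?W = "{y. av (y - a) < d} \<times> {y. av (y - b) < d}"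
  have "av (x * y - a * b) < e" if x: "av (x - a) < d" and y: "av (y - b) < d" for x y
  proof -
    have "x * y - a * b = (x - a) * (y - b) + ((x - a) * b + a * (y - b))" by (simp add: algebra_simps)
    then have "av (x * y - a * b) \<le> av (x - a) * av (y - b) + (av (x - a) * av b + av a * av (y - b))"
      by (metis (no_types, lifting) add_left_mono av_mult av_triangle order_trans)
    also have "\<dots> \<le> d * 1 + (d * av b + av a * d)"
      using x y d by (intro add_mono mult_mono) auto
    also have "\<dots> = d * (1 + av a + av b)" by (simp add: algebra_simps)
    finally show ?thesis using d2 e by linarith
  qed
  then show "\<exists>W. openin (prod_topology (ktop av) (ktop av)) W \<and> (a, b) \<in> W \<and>
      (\<forall>y\<in>W. av ((case y of (x, y) \<Rightarrow> x * y) - (a * b)) < e)"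
    by (intro exI[of _ ?W]) (use d in \<open>auto simp: openin_prod_Times_iff openin_ball\<close>)
qed

lemma continuous_ktop_inverse: "continuous_map (subtopology (ktop av) (- {0})) (ktop av) inverse"
  unfolding continuous_map_into_ktop
proof clarsimp
  fix a :: 'k and e :: real assume a: "a \<noteq> 0" and e: "e > 0"
  \<comment> \<open>The first entry keeps \<open>av y\<close> above \<open>av a / 2\<close>; the
    second is what \<open>av (y - a) / (av y * av a)\<close> then needs to stay below
    \<open>e\<close>.\<close>
  define d where "d = min (av a / 2) (e * av a * av a / 2)"
  have d: "d > 0" using a e by (auto simp: d_def)
  have "av (inverse y - inverse a) < e" if "y \<noteq> 0" "av (y - a) < d" for y
  proof -
    have "av (y - a) < av a / 2" using that by (simp add: d_def)
    then have y2: "av y > av a / 2" using av_triangle[of "a - y" y] by (simp add: av_minus_commute)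
    have "inverse y - inverse a = (a - y) / (y * a)" using a that by (simp add: field_simps)
    then have "av (inverse y - inverse a) = av (y - a) / (av y * av a)"
      by (simp add: av_divide av_mult av_minus_commute)
    also have "\<dots> < e * av a * av a / 2 / (av y * av a)"
      using that a by (intro divide_strict_right_mono) (auto simp: d_def)
    also have "\<dots> \<le> e * av a * av a / 2 / (av a / 2 * av a)"
      using y2 a e that(1) by (intro divide_left_mono mult_right_mono mult_pos_pos) auto
    also have "\<dots> = e" using a by simp
    finally show ?thesis .
  qed
  then show "\<exists>W. openin (subtopology (ktop av) (- {0})) W \<and> a \<in> W \<and> (\<forall>y\<in>W. av (inverse y - inverse a) < e)"
    by (intro exI[of _ "{y. av (y - a) < d} \<inter> - {0}"])
       (use a d in \<open>auto simp: openin_subtopology intro!: exI[of _ "{y. av (y - a) < d}"] openin_ball\<close>)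
qed

lemma tvs_field: "tvs av (*) UNIV (ktop av)"
  unfolding tvs_def
  using continuous_ktop_add continuous_ktop_mult Hausdorff_ktop by (simp add: algebra_simps)

text \<open>The axioms of a topological module relative to the carrier \<open>topspace T\<close>,
  for a type that has only \<open>+\<close>. The zero of a tree space depends on the level, so
  neutrality is expressed by \<open>x + sc 0 y = x\<close>.\<close>

definition tmod :: "('k \<Rightarrow> 'a::plus \<Rightarrow> 'a) \<Rightarrow> 'a topology \<Rightarrow> bool" where
  "tmod sc T \<longleftrightarrow> (\<forall>x\<in>topspace T. \<forall>y\<in>topspace T. x + y \<in> topspace T \<and> x + y = y + x \<and> x + sc 0 y = x)
     \<and> (\<forall>x\<in>topspace T. \<forall>y\<in>topspace T. \<forall>z\<in>topspace T. x + y + z = x + (y + z))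
     \<and> (\<forall>a. \<forall>x\<in>topspace T. \<forall>y\<in>topspace T. sc a x \<in> topspace T \<and> sc a (x + y) = sc a x + sc a y)
     \<and> (\<forall>a b. \<forall>x\<in>topspace T. sc (a + b) x = sc a x + sc b x \<and> sc a (sc b x) = sc (a * b) x \<and> sc 1 x = x)
     \<and> continuous_map (prod_topology T T) T (\<lambda>(x, y). x + y)
     \<and> continuous_map (prod_topology (ktop av) T) T (\<lambda>(a, x). sc a x)"

lemma tmodD:
  assumes "tmod sc T"
  shows "x \<in> topspace T \<Longrightarrow> y \<in> topspace T \<Longrightarrow> x + y \<in> topspace T"
    and "x \<in> topspace T \<Longrightarrow> y \<in> topspace T \<Longrightarrow> x + y = y + x"
    and "x \<in> topspace T \<Longrightarrow> y \<in> topspace T \<Longrightarrow> x + sc 0 y = x"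
    and "x \<in> topspace T \<Longrightarrow> y \<in> topspace T \<Longrightarrow> z \<in> topspace T \<Longrightarrow> x + y + z = x + (y + z)"
    and "x \<in> topspace T \<Longrightarrow> sc a x \<in> topspace T"
    and "x \<in> topspace T \<Longrightarrow> y \<in> topspace T \<Longrightarrow> sc a (x + y) = sc a x + sc a y"
    and "x \<in> topspace T \<Longrightarrow> sc (a + b) x = sc a x + sc b x"
    and "x \<in> topspace T \<Longrightarrow> sc a (sc b x) = sc (a * b) x"
    and "x \<in> topspace T \<Longrightarrow> sc 1 x = x"
  using assms unfolding tmod_def by blast+

lemma tmod_continuous_add:
  assumes "tmod sc T" "continuous_map X T f" "continuous_map X T g"
  shows "continuous_map X T (\<lambda>x. f x + g x)"
  using continuous_map_compose[OF continuous_map_pairedI[OF assms(2,3)], of T "\<lambda>(x, y). x + y"] assms(1)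
  by (simp add: tmod_def o_def)

lemma tmod_continuous_scale:
  assumes "tmod sc T" "continuous_map X (ktop av) a" "continuous_map X T f"
  shows "continuous_map X T (\<lambda>x. sc (a x) (f x))"
  using continuous_map_compose[OF continuous_map_pairedI[OF assms(2,3)], of T "\<lambda>(x, y). sc x y"] assms(1)
  by (simp add: tmod_def o_def)

lemma tvs_scale_zero:
  assumes "tvs av sc V T" "y \<in> V"
  shows "sc 0 y = 0"
proof -
  have "sc (0 + 0) y = sc 0 y + sc 0 y" using assms unfolding tvs_def by blast
  then show ?thesis by simp
qed

lemma tmod_tvs: "tvs av sc V T \<Longrightarrow> tmod sc T"
  using tvs_scale_zero[of sc V T] unfolding tmod_def tvs_def by (simp add: algebra_simps)

lemma tmod_field: "tmod (*) (ktop av)"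
  by (rule tmod_tvs[OF tvs_field])

section \<open>The product topology on trees of a fixed level\<close>

lemma topspace_ptop [simp]: "topspace (ptop av T m) = lvl (topspace T) m"
  by (induction m) (auto simp: topspace_img_top inj_Base inj_Node lvl.simps image_iff)

declare ptop.simps [simp del]

lemma lvl_whole: "subtopology (ptop av (ktop av) m) (lvl UNIV m) = ptop av (ktop av) m"
  using subtopology_topspace[of "ptop av (ktop av) m"] by simp

lemma continuous_Base:
  "continuous_map Z (ptop av T 0) (\<lambda>z. Base (h z)) \<longleftrightarrow> continuous_map Z T h"
  by (simp add: continuous_map_into_img_top inj_Base ptop.simps)

lemma continuous_from_ptop_0:
  "continuous_map (ptop av T 0) Y f \<longleftrightarrow> continuous_map T Y (\<lambda>x. f (Base x))"
  by (simp add: continuous_map_from_img_top inj_Base ptop.simps)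

lemma continuous_unBase: "continuous_map (ptop av T 0) T unBase"
  unfolding continuous_from_ptop_0 by simp

lemma continuous_Node:
  "continuous_map Z (ptop av T (Suc m)) (\<lambda>z. Node (a z) (b z) (s z)) \<longleftrightarrow>
     continuous_map Z (ptop av T m) a \<and> continuous_map Z (ptop av T m) b \<and> continuous_map Z (ktop av) s"
  using continuous_map_into_img_top[OF inj_Node, of Z "prod_topology (ptop av T m) (prod_topology (ptop av T m) (ktop av))"
      "\<lambda>z. (a z, b z, s z)"]
  by (simp add: continuous_map_pairwise o_def ptop.simps)

lemma continuous_pfst: "continuous_map (ptop av T (Suc m)) (ptop av T m) pfst"
  unfolding ptop.simps continuous_map_from_img_top[OF inj_Node]
  by (simp add: split_beta' continuous_map_fst)

lemma continuous_psnd: "continuous_map (ptop av T (Suc m)) (ptop av T m) psnd"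
  unfolding ptop.simps continuous_map_from_img_top[OF inj_Node]
  using continuous_map_compose[OF continuous_map_snd continuous_map_fst]
  by (simp add: split_beta' o_def)

lemma continuous_ptrd: "continuous_map (ptop av T (Suc m)) (ktop av) ptrd"
  unfolding ptop.simps continuous_map_from_img_top[OF inj_Node]
  using continuous_map_compose[OF continuous_map_snd continuous_map_snd]
  by (simp add: split_beta' o_def)

lemma tmod_pt_Suc:
  assumes T: "tmod sc T" and P: "tmod (ptscale sc) (ptop av T m)"
  shows "tmod (ptscale sc) (ptop av T (Suc m))"
  unfolding tmod_def
proof (intro conjI ballI allI)
  let ?P = "ptop av T m" and ?Q = "ptop av T (Suc m)"
  note PD = tmodD[OF P, simplified] 
  note fst = continuous_map_compose[OF continuous_map_fst, unfolded o_def]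
  note snd = continuous_map_compose[OF continuous_map_snd, unfolded o_def]
  have "continuous_map (prod_topology ?Q ?Q) ?Q (\<lambda>z. Node (pfst (fst z) + pfst (snd z))
      (psnd (fst z) + psnd (snd z)) (ptrd (fst z) + ptrd (snd z)))"
    unfolding continuous_Node
    by (intro conjI tmod_continuous_add[OF P] tmod_continuous_add[OF tmod_field]
       fst snd continuous_pfst continuous_psnd continuous_ptrd)
  then show "continuous_map (prod_topology ?Q ?Q) ?Q (\<lambda>(x, y). x + y)"
    by (rule continuous_map_eq) (auto simp: lvl_Suc_iff)
  have "continuous_map (prod_topology (ktop av) ?Q) ?Q (\<lambda>z. Node (ptscale sc (fst z) (pfst (snd z)))
      (ptscale sc (fst z) (psnd (snd z))) (fst z * ptrd (snd z)))"
    unfolding continuous_Node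
    by (intro conjI tmod_continuous_scale[OF P] tmod_continuous_scale[OF tmod_field]
       continuous_map_fst snd continuous_pfst continuous_psnd continuous_ptrd)
  then show "continuous_map (prod_topology (ktop av) ?Q) ?Q (\<lambda>(a, x). ptscale sc a x)"
    by (rule continuous_map_eq) (auto simp: lvl_Suc_iff)
qed (use tmodD[OF P] in \<open>auto simp: algebra_simps elim!: lvl_SucE\<close>)

lemma tmod_pt_0:
  assumes T: "tmod sc T"
  shows "tmod (ptscale sc) (ptop av T 0)"
  unfolding tmod_def
proof (intro conjI ballI allI)
  let ?Q = "ptop av T 0"
  note fst = continuous_map_compose[OF continuous_map_fst, unfolded o_def]
  note snd = continuous_map_compose[OF continuous_map_snd, unfolded o_def]
  have "continuous_map (prod_topology ?Q ?Q) ?Q (\<lambda>z. Base (unBase (fst z) + unBase (snd z)))"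
    unfolding continuous_Base by (intro tmod_continuous_add[OF T] fst snd continuous_unBase)
  then show "continuous_map (prod_topology ?Q ?Q) ?Q (\<lambda>(x, y). x + y)"
    by (rule continuous_map_eq) (auto simp: lvl_0_iff)
  have "continuous_map (prod_topology (ktop av) ?Q) ?Q (\<lambda>z. Base (sc (fst z) (unBase (snd z))))"
    unfolding continuous_Base
    by (intro tmod_continuous_scale[OF T] continuous_map_fst snd continuous_unBase)
  then show "continuous_map (prod_topology (ktop av) ?Q) ?Q (\<lambda>(a, x). ptscale sc a x)"
    by (rule continuous_map_eq) (auto simp: lvl_0_iff)
qed (use tmodD[OF T] in \<open>auto simp: lvl_0_iff\<close>)

lemma tmod_pt: "tmod sc T \<Longrightarrow> tmod (ptscale sc) (ptop av T m)"
  by (induction m) (auto intro: tmod_pt_0 tmod_pt_Suc)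

text \<open>The far end point of the segment coded by a tree. The set \<open>ext\<close> consists of
  the trees for which both \<open>pfst\<close> and \<open>shift\<close> land in \<open>U\<close>,
  which makes it open for open \<open>U\<close>.\<close>

definition shift :: "('k \<Rightarrow> 'a::plus \<Rightarrow> 'a) \<Rightarrow> ('a, 'k) pt \<Rightarrow> ('a, 'k) pt" where
  "shift sc p = pfst p + ptscale sc (ptrd p) (psnd p)"

lemma shift_Node [simp]: "shift sc (Node x v t) = x + ptscale sc t v"
  by (simp add: shift_def)

lemma continuous_shift:
  "tmod sc T \<Longrightarrow> continuous_map (ptop av T (Suc m)) (ptop av T m) (shift sc)"
  unfolding shift_def
  by (intro tmod_continuous_add[OF tmod_pt] tmod_continuous_scale[OF tmod_pt] continuous_pfst continuous_psnd continuous_ptrd)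

lemma ext_eq_preimage:
  "U \<subseteq> lvl V m \<Longrightarrow> ext sc V m U = {p \<in> lvl V (Suc m). pfst p \<in> U} \<inter> {p \<in> lvl V (Suc m). shift sc p \<in> U}"
  by (auto simp: ext_iff elim!: extE lvl_SucE)

lemma openin_ext:
  assumes T: "tmod sc T" and U: "openin (ptop av T m) U"
  shows "openin (ptop av T (Suc m)) (ext sc (topspace T) m U)"
proof -
  have "U \<subseteq> lvl (topspace T) m" using openin_subset[OF U] by simp
  then show ?thesis
    using openin_continuous_map_preimage[OF continuous_pfst U] openin_continuous_map_preimage[OF continuous_shift[OF T] U]
    by (simp add: ext_eq_preimage openin_Int)
qed

end

section \<open>Maps of class $C^k$ between trees\<close>

context valued
begin

text \<open>\<open>U\<close> is a set of trees of level \<open>m\<close>, and \<open>f1\<close> is \<open>f\<^bsup>[1]\<^esup>\<close> on \<open>U\<^bsup>[1]\<^esup>\<close>. In contrast to \<^const>\<open>Ck\<close>, the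
  recursion is from the inside: \<open>f\<close> is \<open>C\<^bsup>k+1\<^esup>\<close> iff it is \<open>C\<^sup>1\<close> and \<open>f\<^bsup>[1]\<^esup>\<close> is \<open>C\<^sup>k\<close>. This makes the chain rule
  an induction over \<open>k\<close> for all levels at once. The addition in the codomain is an arbitrary
  \<open>+\<close>, so that maps into trees are covered.\<close>
fun ck_map :: "('k \<Rightarrow> 'a::ab_group_add \<Rightarrow> 'a) \<Rightarrow> 'a topology \<Rightarrow> ('k \<Rightarrow> 'c::plus \<Rightarrow> 'c) \<Rightarrow> 'c topology
    \<Rightarrow> nat \<Rightarrow> nat \<Rightarrow> ('a, 'k) pt set \<Rightarrow> (('a, 'k) pt \<Rightarrow> 'c) \<Rightarrow> bool" where
  "ck_map sc T sc' T' m 0 U f \<longleftrightarrow>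
     U \<subseteq> lvl (topspace T) m \<and> continuous_map (subtopology (ptop av T m) U) T' f"
| "ck_map sc T sc' T' m (Suc k) U f \<longleftrightarrow>
     U \<subseteq> lvl (topspace T) m \<and> continuous_map (subtopology (ptop av T m) U) T' f
     \<and> (\<exists>f1. ck_map sc T sc' T' (Suc m) k (ext sc (topspace T) m U) f1
          \<and> (\<forall>x v t. Node x v t \<in> ext sc (topspace T) m U \<longrightarrow>
                 f (x + ptscale sc t v) = f x + sc' t (f1 (Node x v t))))"

lemma ck_subset: "ck_map sc T sc' T' m k U f \<Longrightarrow> U \<subseteq> lvl (topspace T) m"
  by (cases k) auto

lemma ck_continuous: "ck_map sc T sc' T' m k U f \<Longrightarrow> continuous_map (subtopology (ptop av T m) U) T' f"
  by (cases k) auto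

lemma ck_value: "ck_map sc T sc' T' m k U f \<Longrightarrow> p \<in> U \<Longrightarrow> f p \<in> topspace T'"
  using continuous_map_image_subset_topspace[OF ck_continuous] ck_subset by fastforce

lemma ck_SucE:
  assumes "ck_map sc T sc' T' m (Suc k) U f"
  obtains g where "ck_map sc T sc' T' (Suc m) k (ext sc (topspace T) m U) g"
    "\<And>x v t. Node x v t \<in> ext sc (topspace T) m U \<Longrightarrow> f (x + ptscale sc t v) = f x + sc' t (g (Node x v t))"
  using assms by auto

lemma ck_SucI:
  assumes "ck_map sc T sc' T' m 0 U f"
    and "ck_map sc T sc' T' (Suc m) k (ext sc (topspace T) m U) g"
    and "\<And>x v t. Node x v t \<in> ext sc (topspace T) m U \<Longrightarrow> f (x + ptscale sc t v) = f x + sc' t (g (Node x v t))"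
  shows "ck_map sc T sc' T' m (Suc k) U f"
  using assms by auto

lemma ck_Suc_imp: "ck_map sc T sc' T' m (Suc k) U f \<Longrightarrow> ck_map sc T sc' T' m k U f"
proof (induction k arbitrary: m U f)
  case (Suc k)
  obtain f1 where f1: "ck_map sc T sc' T' (Suc m) (Suc k) (ext sc (topspace T) m U) f1"
    "\<And>x v t. Node x v t \<in> ext sc (topspace T) m U \<Longrightarrow> f (x + ptscale sc t v) = f x + sc' t (f1 (Node x v t))"
    by (rule ck_SucE[OF Suc.prems]) blast
  show ?case
    by (rule ck_SucI[where g = f1]) (use Suc.prems Suc.IH[OF f1(1)] f1(2) in auto)
qed auto

lemma ck_mono: "ck_map sc T sc' T' m k U f \<Longrightarrow> j \<le> k \<Longrightarrow> ck_map sc T sc' T' m j U f"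
  by (induction k) (auto simp: le_Suc_eq simp del: ck_map.simps dest: ck_Suc_imp)

lemma ck_0: "ck_map sc T sc' T' m k U f \<Longrightarrow> ck_map sc T sc' T' m 0 U f"
  by (erule ck_mono) simp

declare ck_map.simps(2) [simp del]

lemma ck_cong:
  assumes "ck_map sc T sc' T' m k U f" "\<And>x. x \<in> U \<Longrightarrow> f x = g x"
  shows "ck_map sc T sc' T' m k U g"
proof -
  have 0: "ck_map sc T sc' T' m 0 U g"
    using ck_subset[OF assms(1)] continuous_map_eq[OF ck_continuous[OF assms(1)]] assms(2) by auto
  show ?thesis
  proof (cases k)
    case (Suc j)
    then obtain f1 where f1: "ck_map sc T sc' T' (Suc m) j (ext sc (topspace T) m U) f1"
      "\<And>x v t. Node x v t \<in> ext sc (topspace T) m U \<Longrightarrow> f (x + ptscale sc t v) = f x + sc' t (f1 (Node x v t))"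
      using ck_SucE assms(1) by metis
    show ?thesis unfolding Suc
      by (rule ck_SucI[OF 0 f1(1)]) (use f1(2) assms(2) in \<open>auto simp: ext_iff\<close>)
  qed (use 0 in simp)
qed

lemma ck_restrict:
  assumes "ck_map sc T sc' T' m k U f" "U' \<subseteq> U"
  shows "ck_map sc T sc' T' m k U' f"
  using assms
proof (induction k arbitrary: m U U' f)
  case 0
  then show ?case using continuous_map_from_subtopology_mono by auto
next
  case (Suc k)
  obtain f1 where f1: "ck_map sc T sc' T' (Suc m) k (ext sc (topspace T) m U) f1"
    "\<And>x v t. Node x v t \<in> ext sc (topspace T) m U \<Longrightarrow> f (x + ptscale sc t v) = f x + sc' t (f1 (Node x v t))"
    by (rule ck_SucE[OF Suc.prems(1)]) blast
  have "ck_map sc T sc' T' m 0 U' f"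
    using ck_0[OF Suc.prems(1)] Suc.prems(2) continuous_map_from_subtopology_mono by auto
  then show ?case
    by (rule ck_SucI[OF _ Suc.IH[OF f1(1) ext_mono[OF Suc.prems(2)]]])
      (use f1(2) ext_mono[OF Suc.prems(2)] in blast)
qed

text \<open>A linear outer map commutes with taking difference quotients, so no chain rule is needed
  here.\<close>

lemma ck_post:
  assumes "ck_map sc T sc' T' m k U f" and L: "continuous_map T' T'' L"
    and lin: "\<And>x y t. x \<in> topspace T' \<Longrightarrow> y \<in> topspace T' \<Longrightarrow> L (x + sc' t y) = L x + sc'' t (L y)"
  shows "ck_map sc T sc'' T'' m k U (\<lambda>p. L (f p))"
  using assms(1)
proof (induction k arbitrary: m U f)
  case 0
  then show ?case using continuous_map_compose[OF _ L, unfolded o_def] by auto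
next
  case (Suc k)
  obtain f1 where f1: "ck_map sc T sc' T' (Suc m) k (ext sc (topspace T) m U) f1"
    "\<And>x v t. Node x v t \<in> ext sc (topspace T) m U \<Longrightarrow> f (x + ptscale sc t v) = f x + sc' t (f1 (Node x v t))"
    by (rule ck_SucE[OF Suc.prems]) blast
  have 0: "ck_map sc T sc'' T'' m 0 U (\<lambda>p. L (f p))"
    using ck_0[OF Suc.prems] continuous_map_compose[OF _ L, unfolded o_def] by auto
  show ?case
  proof (rule ck_SucI[OF 0 Suc.IH[OF f1(1)]])
    fix x v t assume *: "Node x v t \<in> ext sc (topspace T) m U"
    then have "x \<in> U" by (simp add: ext_iff)
    then show "L (f (x + ptscale sc t v)) = L (f x) + sc'' t (L (f1 (Node x v t)))"
      unfolding f1(2)[OF *] using lin ck_value[OF Suc.prems] ck_value[OF f1(1) *] by blast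
  qed
qed

text \<open>Linearity in the one identity that difference quotients use, which avoids mentioning a
  zero. The difference quotient of such an \<open>L\<close> at \<open>Node x v t\<close> is
  \<open>L v\<close>, again linear in the tree; hence these maps are of every class.\<close>

definition lin :: "('k \<Rightarrow> 'a::ab_group_add \<Rightarrow> 'a) \<Rightarrow> 'a topology \<Rightarrow> ('k \<Rightarrow> 'c::plus \<Rightarrow> 'c) \<Rightarrow> 'c topology
    \<Rightarrow> nat \<Rightarrow> (('a, 'k) pt \<Rightarrow> 'c) \<Rightarrow> bool" where
  "lin sc T sc' T' m L \<longleftrightarrow> continuous_map (ptop av T m) T' L
     \<and> (\<forall>x\<in>lvl (topspace T) m. \<forall>v\<in>lvl (topspace T) m. \<forall>t. L (x + ptscale sc t v) = L x + sc' t (L v))"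

lemma lin_pfst: "lin sc T (ptscale sc) (ptop av T m) (Suc m) pfst"
  and lin_psnd: "lin sc T (ptscale sc) (ptop av T m) (Suc m) psnd"
  and lin_ptrd: "lin sc T (*) (ktop av) (Suc m) ptrd"
  and lin_unBase: "lin sc T sc T 0 unBase"
  by (auto simp: lin_def continuous_pfst continuous_psnd continuous_ptrd continuous_unBase lvl_0_iff elim!: lvl_SucE)

lemma lin_value: "lin sc T sc' T' m L \<Longrightarrow> p \<in> lvl (topspace T) m \<Longrightarrow> L p \<in> topspace T'"
  unfolding lin_def using continuous_map_image_subset_topspace by fastforce

lemma lin_comp:
  assumes "lin sc T (ptscale scE) (ptop av TE n) m L" "lin scE TE sc' T' n L'"
  shows "lin sc T sc' T' m (\<lambda>p. L' (L p))"
  using assms lin_value[OF assms(1)] continuous_map_compose[of "ptop av T m" "ptop av TE n" L T' L']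
  by (simp add: lin_def o_def)

lemma lin_Node:
  assumes "lin sc T (ptscale scE) (ptop av TE n) m a" "lin sc T (ptscale scE) (ptop av TE n) m b"
    "lin sc T (*) (ktop av) m s"
  shows "lin sc T (ptscale scE) (ptop av TE (Suc n)) m (\<lambda>p. Node (a p) (b p) (s p))"
  using assms by (simp add: lin_def continuous_Node)

lemma ck_lin:
  assumes "lin sc T sc' T' m L" "U \<subseteq> lvl (topspace T) m"
  shows "ck_map sc T sc' T' m k U L"
  using assms
proof (induction k arbitrary: m L U)
  case 0
  then show ?case by (auto simp: lin_def continuous_map_from_subtopology)
next
  case (Suc k)
  have 0: "ck_map sc T sc' T' m 0 U L"
    using Suc.prems by (auto simp: lin_def continuous_map_from_subtopology)
  show ?case
    by (rule ck_SucI[OF 0 Suc.IH[OF lin_comp[OF lin_psnd Suc.prems(1)] ext_subset_lvl[OF Suc.prems(2)]]])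
      (use Suc.prems in \<open>auto simp: ext_iff lin_def subset_eq\<close>)
qed

text \<open>The difference quotient of a constant is the zero of the codomain, available only as
  \<open>sc' 0 c\<close>; the induction therefore runs over all constants at once.\<close>

lemma ck_const:
  assumes "tmod sc' T'" "c \<in> topspace T'" "U \<subseteq> lvl (topspace T) m"
  shows "ck_map sc T sc' T' m k U (\<lambda>_. c)"
  using assms(2,3)
proof (induction k arbitrary: m c U)
  case (Suc k)
  have 0: "ck_map sc T sc' T' m 0 U (\<lambda>_. c)" using Suc.prems by simp
  show ?case
    by (rule ck_SucI[OF 0 Suc.IH[OF tmodD(5)[OF assms(1) Suc.prems(1), of 0] ext_subset_lvl[OF Suc.prems(2)]]])
      (simp add: tmodD[OF assms(1)] Suc.prems)
qed simp

text \<open>The case of \<open>ck_chain\<close> with a linear inner map. It comes first because the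
  chain rule itself needs the composition of \<open>g\<close> with \<open>pfst\<close>.\<close>

lemma ck_comp_lin:
  assumes "ck_map scE TE sc' T' n k W f" "lin sc T (ptscale scE) (ptop av TE n) m L"
    "U \<subseteq> lvl (topspace T) m" "L ` U \<subseteq> W"
  shows "ck_map sc T sc' T' m k U (\<lambda>p. f (L p))"
  using assms
proof (induction k arbitrary: m n f L U W)
  case 0
  have "continuous_map (subtopology (ptop av T m) U) (subtopology (ptop av TE n) W) L"
    using 0(2-) by (auto simp: continuous_map_in_subtopology lin_def continuous_map_from_subtopology)
  then show ?case using 0 continuous_map_compose[of _ _ L T' f] by (auto simp: o_def)
next
  case (Suc k)
  obtain f1 where f1: "ck_map scE TE sc' T' (Suc n) k (ext scE (topspace TE) n W) f1"
    "\<And>x v t. Node x v t \<in> ext scE (topspace TE) n W \<Longrightarrow> f (x + ptscale scE t v) = f x + sc' t (f1 (Node x v t))"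
    by (rule ck_SucE[OF Suc.prems(1)]) blast
  have "continuous_map (subtopology (ptop av T m) U) (subtopology (ptop av TE n) W) L"
    using Suc.prems(2-) by (auto simp: continuous_map_in_subtopology lin_def continuous_map_from_subtopology)
  then have 0: "ck_map sc T sc' T' m 0 U (\<lambda>p. f (L p))"
    using ck_continuous[OF Suc.prems(1)] Suc.prems(3) continuous_map_compose[of _ _ L T' f] by (auto simp: o_def)
  define L1 where "L1 = (\<lambda>P. Node (L (pfst P)) (L (psnd P)) (ptrd P :: 'k))"
  have L1: "lin sc T (ptscale scE) (ptop av TE (Suc n)) (Suc m) L1"
    unfolding L1_def by (intro lin_Node lin_comp[OF lin_pfst Suc.prems(2)] lin_comp[OF lin_psnd Suc.prems(2)] lin_ptrd)
  have L: "L (x + ptscale sc t v) = L x + ptscale scE t (L v)" "L v \<in> lvl (topspace TE) n"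
    if "x \<in> U" "v \<in> lvl (topspace T) m" for x v t
    using Suc.prems(2,3) lin_value[OF Suc.prems(2)] that by (auto simp: lin_def)
  have ext: "Node (L x) (L v) t \<in> ext scE (topspace TE) n W" if "Node x v t \<in> ext sc (topspace T) m U" for x v t
    using that L(1)[of x v t] L(2)[of x v] Suc.prems(4) by (auto simp: ext_iff image_subset_iff)
  have im: "L1 ` ext sc (topspace T) m U \<subseteq> ext scE (topspace TE) n W"
  proof
    fix y assume "y \<in> L1 ` ext sc (topspace T) m U"
    then obtain p where p: "p \<in> ext sc (topspace T) m U" "y = L1 p" by blast
    obtain x v t where "p = Node x v t" using p(1) by (rule extE)
    then show "y \<in> ext scE (topspace TE) n W" using ext p by (auto simp: L1_def)
  qed
  show ?case
  proof (rule ck_SucI[OF 0 Suc.IH[OF f1(1) L1 ext_subset_lvl[OF Suc.prems(3)] im]])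
    fix x v t assume *: "Node x v t \<in> ext sc (topspace T) m U"
    then have "x \<in> U" "v \<in> lvl (topspace T) m" by (auto simp: ext_iff)
    then show "f (L (x + ptscale sc t v)) = f (L x) + sc' t (f1 (L1 (Node x v t)))"
      using f1(2)[OF ext[OF *]] L by (simp add: L1_def)
  qed
qed

lemma ck_pfst:
  assumes "ck_map sc T sc' T' m k U f"
  shows "ck_map sc T sc' T' (Suc m) k (ext sc (topspace T) m U) (\<lambda>p. f (pfst p))"
  by (rule ck_comp_lin[OF assms lin_pfst ext_subset_lvl[OF ck_subset[OF assms]]]) (auto elim!: extE)

lemma ck_Node:
  assumes "ck_map sc T (ptscale scE) (ptop av TE n) m k U a" "ck_map sc T (ptscale scE) (ptop av TE n) m k U b"
    "ck_map sc T (*) (ktop av) m k U s"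
  shows "ck_map sc T (ptscale scE) (ptop av TE (Suc n)) m k U (\<lambda>p. Node (a p) (b p) (s p))"
  using assms
proof (induction k arbitrary: m U a b s)
  case 0
  then show ?case by (auto simp: continuous_Node)
next
  case (Suc k)
  let ?V = "ext sc (topspace T) m U"
  obtain a1 where a1: "ck_map sc T (ptscale scE) (ptop av TE n) (Suc m) k ?V a1"
    "\<And>x v t. Node x v t \<in> ?V \<Longrightarrow> a (x + ptscale sc t v) = a x + ptscale scE t (a1 (Node x v t))"
    by (rule ck_SucE[OF Suc.prems(1)]) blast
  obtain b1 where b1: "ck_map sc T (ptscale scE) (ptop av TE n) (Suc m) k ?V b1"
    "\<And>x v t. Node x v t \<in> ?V \<Longrightarrow> b (x + ptscale sc t v) = b x + ptscale scE t (b1 (Node x v t))"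
    by (rule ck_SucE[OF Suc.prems(2)]) blast
  obtain s1 where s1: "ck_map sc T (*) (ktop av) (Suc m) k ?V s1"
    "\<And>x v t. Node x v t \<in> ?V \<Longrightarrow> s (x + ptscale sc t v) = s x + t * s1 (Node x v t)"
    by (rule ck_SucE[OF Suc.prems(3)]) blast
  have 0: "ck_map sc T (ptscale scE) (ptop av TE (Suc n)) m 0 U (\<lambda>p. Node (a p) (b p) (s p))"
    using Suc.prems[THEN ck_0] by (simp add: continuous_Node)
  show ?case
    by (rule ck_SucI[OF 0 Suc.IH[OF a1(1) b1(1) s1(1)]]) (simp add: a1(2) b1(2) s1(2))
qed

lemma ck_Base:
  assumes "ck_map sc T sc' T' m k U f"
  shows "ck_map sc T (ptscale sc') (ptop av T' 0) m k U (\<lambda>p. Base (f p))"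
  by (rule ck_post[OF assms]) (simp_all add: continuous_Base)

text \<open>The difference quotient of the composition at \<open>Node x v t\<close> is
  \<open>f1\<close> at \<open>Node (g x) (g1 (Node x v t)) t\<close>. This is again a composition,
  one class lower but one level higher on both sides, so the induction has to range over all
  levels.\<close>

lemma ck_chain:
  assumes "ck_map scE TE sc' T' n k W f" "ck_map sc T (ptscale scE) (ptop av TE n) m k U g" "g ` U \<subseteq> W"
  shows "ck_map sc T sc' T' m k U (\<lambda>p. f (g p))"
  using assms
proof (induction k arbitrary: m n f g U W)
  case 0
  have "continuous_map (subtopology (ptop av T m) U) (subtopology (ptop av TE n) W) g"
    using 0(2-) by (auto simp: continuous_map_in_subtopology)
  then show ?case using 0 continuous_map_compose[of _ _ g T' f] by (auto simp: o_def)
next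
  case (Suc k)
  obtain f1 where f1: "ck_map scE TE sc' T' (Suc n) k (ext scE (topspace TE) n W) f1"
    "\<And>x v t. Node x v t \<in> ext scE (topspace TE) n W \<Longrightarrow> f (x + ptscale scE t v) = f x + sc' t (f1 (Node x v t))"
    by (rule ck_SucE[OF Suc.prems(1)]) blast
  let ?V = "ext sc (topspace T) m U"
  obtain g1 where g1: "ck_map sc T (ptscale scE) (ptop av TE n) (Suc m) k ?V g1"
    "\<And>x v t. Node x v t \<in> ?V \<Longrightarrow> g (x + ptscale sc t v) = g x + ptscale scE t (g1 (Node x v t))"
    by (rule ck_SucE[OF Suc.prems(2)]) blast
  have "continuous_map (subtopology (ptop av T m) U) (subtopology (ptop av TE n) W) g"
    using ck_continuous[OF Suc.prems(2)] ck_subset[OF Suc.prems(2)] Suc.prems(3) by (auto simp: continuous_map_in_subtopology)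
  then have 0: "ck_map sc T sc' T' m 0 U (\<lambda>p. f (g p))"
    using ck_continuous[OF Suc.prems(1)] ck_subset[OF Suc.prems(2)] continuous_map_compose[of _ _ g T' f] by (auto simp: o_def)
  define h where "h = (\<lambda>P. Node (g (pfst P)) (g1 P) (ptrd P :: 'k))"
  have sub: "?V \<subseteq> lvl (topspace T) (Suc m)"
    using ck_subset[OF Suc.prems(2)] by (rule ext_subset_lvl)
  have h: "ck_map sc T (ptscale scE) (ptop av TE (Suc n)) (Suc m) k ?V h"
    unfolding h_def by (intro ck_Node ck_pfst ck_Suc_imp[OF Suc.prems(2)] g1(1) ck_lin[OF lin_ptrd sub])
  have ext: "h (Node x v t) \<in> ext scE (topspace TE) n W" if "Node x v t \<in> ?V" for x v t
    using that Suc.prems(3) g1(2)[OF that] ck_value[OF g1(1) that] by (auto simp: ext_iff image_subset_iff h_def)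
  have im: "h ` ?V \<subseteq> ext scE (topspace TE) n W"
  proof
    fix y assume "y \<in> h ` ?V"
    then obtain p where p: "p \<in> ?V" "y = h p" by blast
    obtain x v t where "p = Node x v t" using p(1) by (rule extE)
    then show "y \<in> ext scE (topspace TE) n W" using ext p by blast
  qed
  show ?case
  proof (rule ck_SucI[OF 0 Suc.IH[OF f1(1) h im]])
    fix x v t assume *: "Node x v t \<in> ?V"
    show "f (g (x + ptscale sc t v)) = f (g x) + sc' t (f1 (h (Node x v t)))"
      using f1(2)[OF ext[OF *, unfolded h_def pfst.simps ptrd.simps]] g1(2)[OF *] by (simp add: h_def)
  qed
qed

lemma ck_add:
  assumes M: "tmod sc' T'" and "ck_map sc T sc' T' m k U f" "ck_map sc T sc' T' m k U g"
  shows "ck_map sc T sc' T' m k U (\<lambda>p. f p + g p)"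
  using assms(2,3)
proof (induction k arbitrary: m U f g)
  case 0
  then show ?case by (auto intro: tmod_continuous_add[OF M])
next
  case (Suc k)
  let ?V = "ext sc (topspace T) m U"
  obtain f1 where f1: "ck_map sc T sc' T' (Suc m) k ?V f1"
    "\<And>x v t. Node x v t \<in> ?V \<Longrightarrow> f (x + ptscale sc t v) = f x + sc' t (f1 (Node x v t))"
    by (rule ck_SucE[OF Suc.prems(1)]) blast
  obtain g1 where g1: "ck_map sc T sc' T' (Suc m) k ?V g1"
    "\<And>x v t. Node x v t \<in> ?V \<Longrightarrow> g (x + ptscale sc t v) = g x + sc' t (g1 (Node x v t))"
    by (rule ck_SucE[OF Suc.prems(2)]) blast
  have 0: "ck_map sc T sc' T' m 0 U (\<lambda>p. f p + g p)"
    using Suc.prems[THEN ck_0] by (auto intro: tmod_continuous_add[OF M])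
  show ?case
  proof (rule ck_SucI[OF 0 Suc.IH[OF f1(1) g1(1)]])
    fix x v t assume *: "Node x v t \<in> ?V"
    have x: "x \<in> U" using * by (simp add: ext_iff)
    note [simp] = ck_value[OF Suc.prems(1) x] ck_value[OF Suc.prems(2) x] ck_value[OF f1(1) *] ck_value[OF g1(1) *]
    note MD = tmodD[OF M]
    define a b c d where "a = f x" and "b = sc' t (f1 (Node x v t))" and "c = g x" and "d = sc' t (g1 (Node x v t))"
    have in_T: "a \<in> topspace T'" "b \<in> topspace T'" "c \<in> topspace T'" "d \<in> topspace T'"
      by (simp_all add: a_def b_def c_def d_def MD(5))
    \<comment> \<open>Reordered by hand, since the codomain is only of class \<open>plus\<close> and
      commutativity holds on the carrier alone.\<close>
    have "a + b + (c + d) = a + (b + (c + d))" using in_T MD(1,4) by simp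
    also have "b + (c + d) = c + (b + d)" using in_T MD(1,2,4) by metis
    also have "a + (c + (b + d)) = a + c + (b + d)" using in_T MD(1,4) by simp
    finally show "f (x + ptscale sc t v) + g (x + ptscale sc t v) = f x + g x + sc' t (f1 (Node x v t) + g1 (Node x v t))"
      unfolding f1(2)[OF *] g1(2)[OF *] a_def b_def c_def d_def by (simp add: MD(6))
  qed
qed

text \<open>Leibniz rule for difference quotients: multiplied by \<open>t\<close>, the summands of
  \<open>h\<close> are the increment of \<open>a\<close> applied to \<open>g\<close>,
  \<open>a\<close> applied to the increment of \<open>g\<close>, and the product of both increments.
  The last keeps a factor \<open>ptrd P\<close> and disappears at \<open>t = 0\<close>.\<close>

lemma ck_scale:
  assumes M: "tmod sc' T'" and "ck_map sc T (*) (ktop av) m k U a" "ck_map sc T sc' T' m k U g"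
  shows "ck_map sc T sc' T' m k U (\<lambda>p. sc' (a p) (g p))"
  using assms(2,3)
proof (induction k arbitrary: m U a g)
  case 0
  then show ?case by (auto intro: tmod_continuous_scale[OF M])
next
  case (Suc k)
  let ?V = "ext sc (topspace T) m U"
  obtain a1 where a1: "ck_map sc T (*) (ktop av) (Suc m) k ?V a1"
    "\<And>x v t. Node x v t \<in> ?V \<Longrightarrow> a (x + ptscale sc t v) = a x + t * a1 (Node x v t)"
    by (rule ck_SucE[OF Suc.prems(1)]) blast
  obtain g1 where g1: "ck_map sc T sc' T' (Suc m) k ?V g1"
    "\<And>x v t. Node x v t \<in> ?V \<Longrightarrow> g (x + ptscale sc t v) = g x + sc' t (g1 (Node x v t))"
    by (rule ck_SucE[OF Suc.prems(2)]) blast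
  have sub: "?V \<subseteq> lvl (topspace T) (Suc m)"
    using ck_subset[OF Suc.prems(2)] by (rule ext_subset_lvl)
  have 0: "ck_map sc T sc' T' m 0 U (\<lambda>p. sc' (a p) (g p))"
    using Suc.prems[THEN ck_0] by (auto intro: tmod_continuous_scale[OF M])
  define h where "h = (\<lambda>P. sc' (a1 P) (g (pfst P)) + (sc' (a (pfst P)) (g1 P) + sc' (ptrd P) (sc' (a1 P) (g1 P))))"
  have h: "ck_map sc T sc' T' (Suc m) k ?V h"
    unfolding h_def
    by (intro ck_add[OF M] Suc.IH a1(1) g1(1) ck_pfst Suc.prems[THEN ck_Suc_imp] ck_lin[OF lin_ptrd sub])
  show ?case
  proof (rule ck_SucI[OF 0 h])
    fix x v t assume *: "Node x v t \<in> ?V"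
    have x: "x \<in> U" using * by (simp add: ext_iff)
    note MD = tmodD[OF M]
    note [simp] = ck_value[OF Suc.prems(2) x] ck_value[OF g1(1) *] MD(1,5)
    let ?A = "a1 (Node x v t)" and ?G = "g1 (Node x v t)"
    have "sc' (a x + t * ?A) (g x + sc' t ?G) = sc' (a x) (g x) + sc' (t * ?A) (g x) + (sc' (a x) (sc' t ?G) + sc' (t * ?A) (sc' t ?G))"
      by (simp only: MD(6,7) ck_value[OF Suc.prems(2) x] ck_value[OF g1(1) *] MD(1,5))
    also have "\<dots> = sc' (a x) (g x) + (sc' (t * ?A) (g x) + (sc' (a x * t) ?G + sc' (t * ?A * t) ?G))"
      by (simp add: MD(8) MD(4))
    also have "\<dots> = sc' (a x) (g x) + sc' t (h (Node x v t))"
      by (simp add: h_def MD(6,8) mult_ac)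
    finally show "sc' (a (x + ptscale sc t v)) (g (x + ptscale sc t v)) = sc' (a x) (g x) + sc' t (h (Node x v t))"
      unfolding a1(2)[OF *] g1(2)[OF *] .
  qed
qed

lemmas ck_mult = ck_scale[OF tmod_field]

text \<open>The increment of \<open>inverse a\<close> is \<open>- t * a1\<close> divided by the
  values of \<open>a\<close> at the two end points. The far value is written
  \<open>a x + t * a1\<close>, so both denominators are nonvanishing maps of one class less, and the
  induction hypothesis inverts them.\<close>

lemma ck_inverse:
  assumes "ck_map sc T (*) (ktop av) m k U a" "\<And>p. p \<in> U \<Longrightarrow> a p \<noteq> 0"
  shows "ck_map sc T (*) (ktop av) m k U (\<lambda>p. inverse (a p))"
  using assms
proof (induction k arbitrary: m U a)
  case 0
  have "continuous_map (subtopology (ptop av T m) U) (subtopology (ktop av) (- {0})) a"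
    using 0 by (auto simp: continuous_map_in_subtopology)
  then show ?case using 0 continuous_map_compose[OF _ continuous_ktop_inverse] by (auto simp: o_def)
next
  case (Suc k)
  let ?V = "ext sc (topspace T) m U"
  obtain a1 where a1: "ck_map sc T (*) (ktop av) (Suc m) k ?V a1"
    "\<And>x v t. Node x v t \<in> ?V \<Longrightarrow> a (x + ptscale sc t v) = a x + t * a1 (Node x v t)"
    by (rule ck_SucE[OF Suc.prems(1)]) blast
  have sub: "?V \<subseteq> lvl (topspace T) (Suc m)"
    using ck_subset[OF Suc.prems(1)] by (rule ext_subset_lvl)
  have "continuous_map (subtopology (ptop av T m) U) (subtopology (ktop av) (- {0})) a"
    using Suc.prems(2) ck_continuous[OF Suc.prems(1)] by (auto simp: continuous_map_in_subtopology)
  then have 0: "ck_map sc T (*) (ktop av) m 0 U (\<lambda>p. inverse (a p))"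
    using ck_subset[OF Suc.prems(1)] continuous_map_compose[OF _ continuous_ktop_inverse] by (auto simp: o_def)
  have nz: "a x \<noteq> 0" "a x + t * a1 (Node x v t) \<noteq> 0" if "Node x v t \<in> ?V" for x v t
    using that a1(2)[OF that] Suc.prems(2)[of x] Suc.prems(2)[of "x + ptscale sc t v"] by (auto simp: ext_iff)
  define h where "h = (\<lambda>P. (- 1) * (a1 P * (inverse (a (pfst P)) * inverse (a (pfst P) + ptrd P * a1 P))))"
  have nz': "a (pfst p) \<noteq> 0" "a (pfst p) + ptrd p * a1 p \<noteq> 0" if "p \<in> ?V" for p
  proof -
    obtain x v t where "p = Node x v t" using \<open>p \<in> ?V\<close> by (rule extE)
    then show "a (pfst p) \<noteq> 0" "a (pfst p) + ptrd p * a1 p \<noteq> 0" using nz that by auto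
  qed
  have c: "ck_map sc T (*) (ktop av) (Suc m) k ?V (\<lambda>p. a (pfst p))"
    by (rule ck_pfst[OF ck_Suc_imp[OF Suc.prems(1)]])
  have h: "ck_map sc T (*) (ktop av) (Suc m) k ?V h"
    unfolding h_def
    by (intro ck_mult ck_const[OF tmod_field] a1(1) Suc.IH ck_add[OF tmod_field] c ck_lin[OF lin_ptrd sub] sub nz') auto
  show ?case
  proof (rule ck_SucI[OF 0 h])
    fix x v t assume *: "Node x v t \<in> ?V"
    show "inverse (a (x + ptscale sc t v)) = inverse (a x) + t * h (Node x v t)"
    proof -
      have "inverse C = inverse A - (C - A) * (inverse A * inverse C)" if "A \<noteq> 0" "C \<noteq> 0" for A C :: 'k
        using that by (simp add: field_simps)
      from this[OF nz[OF *]] show ?thesis unfolding a1(2)[OF *] h_def by (simp add: mult_ac)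
    qed
  qed
qed

lemma ck_shift:
  assumes "tmod sc T" "V \<subseteq> lvl (topspace T) (Suc m)"
  shows "ck_map sc T (ptscale sc) (ptop av T m) (Suc m) k V (shift sc)"
  unfolding shift_def
  by (intro ck_add ck_scale tmod_pt assms ck_lin[OF lin_pfst] ck_lin[OF lin_psnd] ck_lin[OF lin_ptrd])

end

section \<open>Canonical difference quotients and locality\<close>

context valued
begin

definition dquot_lim :: "('k \<Rightarrow> 'c::ab_group_add \<Rightarrow> 'c) \<Rightarrow> 'c topology \<Rightarrow> ('k \<Rightarrow> 'c) \<Rightarrow> 'c" where
  "dquot_lim sc' T' \<phi> = (THE y. \<forall>W. openin T' W \<and> y \<in> W \<longrightarrow>
     (\<exists>e>0. \<forall>r. r \<noteq> 0 \<and> av r < e \<longrightarrow> sc' (inverse r) (\<phi> r - \<phi> 0) \<in> W))"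

text \<open>\<open>f\<^bsup>[1]\<^esup>\<close> in terms of \<open>f\<close> alone; at \<open>t = 0\<close> it is the directional derivative, which is unspecified if
  the limit does not exist. The value at \<open>Node x v t\<close> depends only on the function
  \<open>r \<mapsto> f (x + r v)\<close>, which is what allows one to read it off a composition of \<open>f\<close>
  with a map whose image contains this line.\<close>
fun dquot :: "('k \<Rightarrow> 'a::ab_group_add \<Rightarrow> 'a) \<Rightarrow> ('k \<Rightarrow> 'c::ab_group_add \<Rightarrow> 'c) \<Rightarrow> 'c topology
    \<Rightarrow> (('a, 'k) pt \<Rightarrow> 'c) \<Rightarrow> ('a, 'k) pt \<Rightarrow> 'c" where
  "dquot sc sc' T' f (Node x v t) =
     (let \<phi> = (\<lambda>r. f (x + ptscale sc r v)) in
      if t = 0 then dquot_lim sc' T' \<phi> else sc' (inverse t) (\<phi> t - \<phi> 0))"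
| "dquot sc sc' T' f (Base x) = 0"

lemma tvs_topspace: "tvs av sc V T \<Longrightarrow> topspace T = V"
  by (simp add: tvs_def)

text \<open>Two limits would be separated by disjoint open sets that share a difference quotient;
  one exists because there are nonzero scalars of arbitrarily small absolute value.\<close>

lemma dquot_lim_eq:
  assumes "Hausdorff_space T'" "topspace T' = UNIV"
    and "\<And>W. openin T' W \<Longrightarrow> y \<in> W \<Longrightarrow>
     \<exists>e>0. \<forall>r. r \<noteq> 0 \<and> av r < e \<longrightarrow> sc' (inverse r) (\<phi> r - \<phi> 0) \<in> W"
  shows "dquot_lim sc' T' \<phi> = y"
  unfolding dquot_lim_def
proof (rule the_equality)
  fix z assume z: "\<forall>W. openin T' W \<and> z \<in> W \<longrightarrow>
     (\<exists>e>0. \<forall>r. r \<noteq> 0 \<and> av r < e \<longrightarrow> sc' (inverse r) (\<phi> r - \<phi> 0) \<in> W)"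
  show "z = y"
  proof (rule ccontr)
    assume "z \<noteq> y"
    then obtain A B where AB: "openin T' A" "openin T' B" "z \<in> A" "y \<in> B" "disjnt A B"
      using assms(1)[unfolded Hausdorff_space_def, rule_format, of z y] assms(2) by auto
    obtain e where e: "e > 0" "\<And>r. r \<noteq> 0 \<and> av r < e \<Longrightarrow> sc' (inverse r) (\<phi> r - \<phi> 0) \<in> A"
      using z[rule_format, of A] AB(1,3) by auto
    obtain d where d: "d > 0" "\<And>r. r \<noteq> 0 \<and> av r < d \<Longrightarrow> sc' (inverse r) (\<phi> r - \<phi> 0) \<in> B"
      using assms(3)[OF AB(2,4)] by auto
    obtain r where "r \<noteq> 0" "av r < min e d" using ex_small[of "min e d"] e(1) d(1) by auto
    then show False using e(2)[of r] d(2)[of r] AB(5) by (auto simp: disjnt_iff)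
  qed
qed (use assms(3) in blast)

lemma tvs_scale_inverse:
  assumes "tvs av sc' UNIV T'" "t \<noteq> 0"
  shows "sc' (inverse t) (sc' t y) = y" "sc' t (sc' (inverse t) y) = y"
  using tmodD[OF tmod_tvs[OF assms(1)]] tvs_topspace[OF assms(1)] assms(2) by auto

lemma pt_add_zero:
  assumes "tmod sc T" "x \<in> lvl (topspace T) m" "v \<in> lvl (topspace T) m"
  shows "x + ptscale sc 0 v = x"
  using tmodD(3)[OF tmod_pt[OF assms(1), of m]] assms by simp

text \<open>For \<open>t \<noteq> 0\<close> the value is forced algebraically. At
  \<open>t = 0\<close> it is the limit of \<open>f1 (Node x v r)\<close> for \<open>r\<close>
  tending to \<open>0\<close>, by continuity of \<open>f1\<close>; openness of \<open>U\<close> puts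
  these trees into the domain for all small \<open>r\<close>.\<close>

lemma dquot_unique:
  assumes F: "tvs av sc' UNIV T'" and M: "tmod sc T" and U: "openin (ptop av T m) U"
    and f1: "ck_map sc T sc' T' (Suc m) 0 (ext sc (topspace T) m U) f1"
    and dq: "\<And>x v t. Node x v t \<in> ext sc (topspace T) m U \<Longrightarrow> f (x + ptscale sc t v) = f x + sc' t (f1 (Node x v t))"
    and p: "p \<in> ext sc (topspace T) m U"
  shows "dquot sc sc' T' f p = f1 p"
proof -
  obtain x v t where xvt: "p = Node x v t" "x \<in> U" "v \<in> lvl (topspace T) m"
    using p by (auto elim!: extE)
  have Ul: "U \<subseteq> lvl (topspace T) m" using openin_subset[OF U] by simp
  then have x0: "x + ptscale sc 0 v = x" using pt_add_zero[OF M] xvt by blast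
  have quot: "sc' (inverse r) (f (x + ptscale sc r v) - f (x + ptscale sc 0 v)) = f1 (Node x v r)"
    if "r \<noteq> 0" "Node x v r \<in> ext sc (topspace T) m U" for r
    using dq[OF that(2)] tvs_scale_inverse[OF F that(1)] x0 by simp
  show ?thesis
  proof (cases "t = 0")
    case False
    then show ?thesis using quot[OF False] p xvt by (simp add: Let_def)
  next
    case True
    define R where "R = {r. Node x v r \<in> ext sc (topspace T) m U}"
    have c: "continuous_map (ktop av) (ptop av T (Suc m)) (\<lambda>r. Node x v r)"
      using Ul xvt by (auto simp: continuous_Node)
    have R: "openin (ktop av) R"
      using openin_continuous_map_preimage[OF c openin_ext[OF M U]] by (simp add: R_def)
    have "continuous_map (subtopology (ktop av) R) (subtopology (ptop av T (Suc m)) (ext sc (topspace T) m U)) (\<lambda>r. Node x v r)"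
      using c by (auto simp: continuous_map_in_subtopology continuous_map_from_subtopology R_def)
    then have c1: "continuous_map (subtopology (ktop av) R) T' (\<lambda>r. f1 (Node x v r))"
      using continuous_map_compose[OF _ ck_continuous[OF f1]] by (simp add: o_def)
    have "dquot_lim sc' T' (\<lambda>r. f (x + ptscale sc r v)) = f1 (Node x v 0)"
    proof (rule dquot_lim_eq)
      fix W assume W: "openin T' W" "f1 (Node x v 0) \<in> W"
      have "openin (subtopology (ktop av) R) {r \<in> R. f1 (Node x v r) \<in> W}"
        using openin_continuous_map_preimage[OF c1 W(1)] by simp
      then have "openin (ktop av) {r \<in> R. f1 (Node x v r) \<in> W}"
        using R openin_trans_full by blast
      moreover have "0 \<in> {r \<in> R. f1 (Node x v r) \<in> W}" using W p xvt True by (simp add: R_def)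
      ultimately obtain e where "e > 0" "\<forall>r. av (r - 0) < e \<longrightarrow> r \<in> {r \<in> R. f1 (Node x v r) \<in> W}"
        unfolding openin_ktop by blast
      then show "\<exists>e>0. \<forall>r. r \<noteq> 0 \<and> av r < e \<longrightarrow>
          sc' (inverse r) (f (x + ptscale sc r v) - f (x + ptscale sc 0 v)) \<in> W"
        by (intro exI[of _ e]) (auto simp: quot R_def)
    qed (use F in \<open>auto simp: tvs_def\<close>)
    then show ?thesis using xvt True by (simp add: Let_def)
  qed
qed

lemma ck_dquot:
  assumes F: "tvs av sc' UNIV T'" and M: "tmod sc T" and U: "openin (ptop av T m) U"
    and f: "ck_map sc T sc' T' m (Suc k) U f"
  shows "ck_map sc T sc' T' (Suc m) k (ext sc (topspace T) m U) (dquot sc sc' T' f)"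
proof -
  obtain f1 where f1: "ck_map sc T sc' T' (Suc m) k (ext sc (topspace T) m U) f1"
    "\<And>x v t. Node x v t \<in> ext sc (topspace T) m U \<Longrightarrow> f (x + ptscale sc t v) = f x + sc' t (f1 (Node x v t))"
    by (rule ck_SucE[OF f]) blast
  show ?thesis
    by (rule ck_cong[OF f1(1)], rule dquot_unique[OF F M U ck_0[OF f1(1)] f1(2), symmetric])
qed

text \<open>Holds for every \<open>f\<close>, differentiable or not: at \<open>t = 0\<close> the
  possibly arbitrary value of \<open>dquot\<close> is multiplied by \<open>0\<close>.\<close>

lemma dquot_quotient:
  assumes F: "tvs av sc' UNIV T'" and M: "tmod sc T" and U: "U \<subseteq> lvl (topspace T) m"
    and p: "Node x v t \<in> ext sc (topspace T) m U"
  shows "f (x + ptscale sc t v) = f x + sc' t (dquot sc sc' T' f (Node x v t))"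
proof -
  have x0: "x + ptscale sc 0 v = x" using pt_add_zero[OF M] U p by (auto simp: ext_iff)
  show ?thesis
  proof (cases "t = 0")
    case True
    then show ?thesis using x0 tvs_scale_zero[OF F] by simp
  next
    case False
    then show ?thesis using x0 tvs_scale_inverse(2)[OF F False] by (simp add: Let_def)
  qed
qed

lemma pt_add_diff:
  assumes M: "tmod sc T" and x: "x \<in> lvl (topspace T) m" and y: "y \<in> lvl (topspace T) m"
  shows "x + ptscale sc 1 (y + ptscale sc (-1) x) = y"
proof -
  note MD = tmodD[OF tmod_pt[OF M, of m], simplified]
  have [simp]: "ptscale sc a x \<in> lvl (topspace T) m" for a using MD(5) x by blast
  have "x + ptscale sc 1 (y + ptscale sc (-1) x) = x + (y + ptscale sc (-1) x)"
    using MD(1,9) x y by simp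
  also have "\<dots> = y + (x + ptscale sc (-1) x)" using MD(1,2,4) x y
    by (metis \<open>\<And>a. ptscale sc a x \<in> lvl (topspace T) m\<close>)
  also have "x + ptscale sc (-1) x = ptscale sc (1 + (-1)) x" using MD(7,9) x by metis
  also have "y + \<dots> = y" using MD(3) x y by simp
  finally show ?thesis .
qed

text \<open>Continuity of \<open>f\<close> comes for free from \<open>f y = f x + f\<^bsup>[1]\<^esup> (x, y - x, 1)\<close>.\<close>
lemma ck_Suc_of_dquot:
  assumes F: "tvs av sc' UNIV T'" and M: "tmod sc T" and U: "U \<subseteq> lvl (topspace T) m"
    and dquot: "ck_map sc T sc' T' (Suc m) k (ext sc (topspace T) m U) (dquot sc sc' T' f)"
  shows "ck_map sc T sc' T' m (Suc k) U f"
proof (rule ck_SucI[OF _ dquot dquot_quotient[OF F M U]])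
  show "ck_map sc T sc' T' m 0 U f"
  proof (cases "U = {}")
    case True
    then show ?thesis by simp
  next
    case False
    then obtain x where x: "x \<in> U" by blast
    let ?P = "ptop av T m"
    have x': "x \<in> lvl (topspace T) m" using x U by blast
    note MP = tmod_pt[OF M, of m]
    have x'': "ptscale sc (-1) x \<in> lvl (topspace T) m" using tmodD(5)[OF MP] x' by simp
    define h where "h = (\<lambda>y. Node x (y + ptscale sc (-1) x) (1::'k))"
    have h: "h y \<in> ext sc (topspace T) m U" if "y \<in> U" for y
      using that x pt_add_diff[OF M x'] tmodD(1)[OF MP] x'' U by (auto simp: h_def ext_iff)
    have "continuous_map (subtopology ?P U) (ptop av T (Suc m)) h"
      using x' x'' unfolding h_def continuous_Node
      by (auto intro!: tmod_continuous_add[OF MP] continuous_map_from_subtopology)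
    then have "continuous_map (subtopology ?P U) (subtopology (ptop av T (Suc m)) (ext sc (topspace T) m U)) h"
      using h by (auto simp: continuous_map_in_subtopology)
    then have "continuous_map (subtopology ?P U) T' (\<lambda>y. dquot sc sc' T' f (h y))"
      using continuous_map_compose[OF _ ck_continuous[OF dquot]] by (simp add: o_def)
    then have c: "continuous_map (subtopology ?P U) T' (\<lambda>y. f x + sc' 1 (dquot sc sc' T' f (h y)))"
      by (intro tmod_continuous_add[OF tmod_tvs[OF F]] tmod_continuous_scale[OF tmod_tvs[OF F]])
         (use F in \<open>auto simp: tvs_def\<close>)
    have "f x + sc' 1 (dquot sc sc' T' f (h y)) = f y" if "y \<in> U" for y
      using dquot_quotient[OF F M U h[OF that, unfolded h_def], of f] pt_add_diff[OF M x', of y] that U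
      by (auto simp: h_def)
    then have "continuous_map (subtopology ?P U) T' f"
      using c by (elim continuous_map_eq) auto
    then show ?thesis using U by simp
  qed
qed

lemma tvs_diff:
  assumes "tvs av sc' UNIV T'"
  shows "a + sc' (-1) b = a - b"
proof -
  have "sc' (-1 + 1) b = sc' (-1) b + sc' 1 b" using assms unfolding tvs_def by blast
  then show ?thesis using tvs_scale_zero[OF assms] tmodD(9)[OF tmod_tvs[OF assms]] tvs_topspace[OF assms]
    by (simp add: eq_neg_iff_add_eq_0 diff_conv_add_uminus del: add_uminus_conv_diff)
qed

text \<open>Near a tree with \<open>t = 0\<close> both end points lie in one good set
  \<open>W\<close>. For \<open>t \<noteq> 0\<close> they may lie in different good sets
  \<open>W\<close> and \<open>Y\<close>, but there the difference quotient is an explicit expression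
  in \<open>1 / t\<close> and the values of \<open>f\<close> at the end points, hence of class
  \<open>C^k\<close>.\<close>

lemma ck_local:
  assumes F: "tvs av sc' UNIV T'" and M: "tmod sc T" and U: "openin (ptop av T m) U"
    and loc: "\<And>p. p \<in> U \<Longrightarrow> \<exists>W. openin (ptop av T m) W \<and> p \<in> W \<and> W \<subseteq> U \<and> ck_map sc T sc' T' m k W f"
  shows "ck_map sc T sc' T' m k U f"
  using U loc
proof (induction k arbitrary: m U f)
  case 0
  have "continuous_map (subtopology (ptop av T m) U) T' f"
  proof (rule continuous_map_local)
    fix x assume "x \<in> topspace (ptop av T m) \<inter> U"
    then obtain W where W: "openin (ptop av T m) W" "x \<in> W" "W \<subseteq> U" "ck_map sc T sc' T' m 0 W f"
      using "0.prems"(2)[of x] by blast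
    moreover have "U \<inter> W = W" using W by blast
    ultimately show "\<exists>W. openin (ptop av T m) W \<and> x \<in> W \<and> continuous_map (subtopology (ptop av T m) (U \<inter> W)) T' f"
      using ck_continuous[OF W(4)] by (intro exI[of _ W]) simp
  qed
  then show ?case using openin_subset[OF "0.prems"(1)] by simp
next
  case (Suc k)
  have Ul: "U \<subseteq> lvl (topspace T) m" using openin_subset[OF Suc.prems(1)] by simp
  let ?V = "ext sc (topspace T) m U"
  have "ck_map sc T sc' T' (Suc m) k ?V (dquot sc sc' T' f)"
  proof (rule Suc.IH[OF openin_ext[OF M Suc.prems(1)]])
    fix p assume p: "p \<in> ?V"
    obtain x v t where xvt: "p = Node x v t" "x \<in> U" "v \<in> lvl (topspace T) m" "x + ptscale sc t v \<in> U"
      using p by (rule extE)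
    obtain W where W: "openin (ptop av T m) W" "x \<in> W" "W \<subseteq> U" "ck_map sc T sc' T' m (Suc k) W f"
      using Suc.prems(2)[OF xvt(2)] by blast
    show "\<exists>W. openin (ptop av T (Suc m)) W \<and> p \<in> W \<and> W \<subseteq> ?V \<and> ck_map sc T sc' T' (Suc m) k W (dquot sc sc' T' f)"
    proof (cases "t = 0")
      case True
      then show ?thesis
        using xvt W pt_add_zero[OF M, of x m v] Ul
        by (intro exI[of _ "ext sc (topspace T) m W"] conjI openin_ext[OF M] ck_dquot[OF F M] ext_mono)
           (auto simp: ext_iff)
    next
      case False
      obtain Y where Y: "openin (ptop av T m) Y" "x + ptscale sc t v \<in> Y" "Y \<subseteq> U" "ck_map sc T sc' T' m (Suc k) Y f"
        using Suc.prems(2)[OF xvt(4)] by blast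
      have tr: "openin (ptop av T (Suc m)) {q \<in> lvl (topspace T) (Suc m). ptrd q \<noteq> 0}"
      proof -
        have "openin (ktop av) (- {0})"
          using openin_outside_cball[of 0 0] by (simp add: Collect_neg_eq[symmetric] Compl_eq)
        from openin_continuous_map_preimage[OF continuous_ptrd this] show ?thesis by simp
      qed
      define N where "N = {q \<in> lvl (topspace T) (Suc m). pfst q \<in> W} \<inter> {q \<in> lvl (topspace T) (Suc m). shift sc q \<in> Y}
          \<inter> {q \<in> lvl (topspace T) (Suc m). ptrd q \<noteq> 0}"
      have N: "openin (ptop av T (Suc m)) N"
        unfolding N_def
        using openin_continuous_map_preimage[OF continuous_pfst W(1)] openin_continuous_map_preimage[OF continuous_shift[OF M] Y(1)] tr
        by (simp add: openin_Int)
      have Nl: "N \<subseteq> lvl (topspace T) (Suc m)" by (auto simp: N_def)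
      have NV: "N \<subseteq> ?V" using W(3) Y(3) by (auto simp: N_def ext_eq_preimage[OF Ul])
      have "ck_map sc T sc' T' (Suc m) k N (\<lambda>q. sc' (inverse (ptrd q)) (f (shift sc q) + sc' (-1) (f (pfst q))))"
        using tmod_tvs[OF F] tvs_topspace[OF F]
        by (intro ck_scale ck_inverse ck_add ck_const tmod_field ck_lin[OF lin_ptrd] Nl
            ck_chain[OF ck_Suc_imp[OF Y(4)] ck_shift[OF M]] ck_comp_lin[OF ck_Suc_imp[OF W(4)] lin_pfst])
           (auto simp: N_def)
      moreover have "sc' (inverse (ptrd q)) (f (shift sc q) + sc' (-1) (f (pfst q))) = dquot sc sc' T' f q" if q: "q \<in> N" for q
      proof -
        obtain a b s where q': "q = Node a b s" using subsetD[OF Nl q] by (auto simp: lvl_Suc_iff)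
        moreover have "a + ptscale sc 0 b = a" "s \<noteq> 0" using q q' pt_add_zero[OF M] by (auto simp: N_def)
        ultimately show ?thesis by (simp add: tvs_diff[OF F] Let_def)
      qed
      ultimately have "ck_map sc T sc' T' (Suc m) k N (dquot sc sc' T' f)" by (rule ck_cong)
      moreover have "p \<in> N" using xvt W Y False Ul by (auto simp: N_def)
      ultimately show ?thesis using N NV by blast
    qed
  qed
  then show ?case by (rule ck_Suc_of_dquot[OF F M Ul])
qed

section \<open>Agreement of the recursion from the inside with the one in \<open>Ck\<close>\<close>

fun ext_iter :: "('k \<Rightarrow> 'a::ab_group_add \<Rightarrow> 'a) \<Rightarrow> 'a set \<Rightarrow> nat \<Rightarrow> ('a, 'k) pt set \<Rightarrow> nat \<Rightarrow> ('a, 'k) pt set" where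
  "ext_iter sc V m U 0 = U"
| "ext_iter sc V m U (Suc n) = ext sc V (m + n) (ext_iter sc V m U n)"

lemma ext_iter_Suc_left: "ext_iter sc V m U (Suc n) = ext_iter sc V (Suc m) (ext sc V m U) n"
  by (induction n) simp_all

lemma iterU_eq_ext_iter: "iterU sc V U n = ext_iter sc V 0 (Base ` U) n"
  by (induction n) simp_all

text \<open>The nested witnesses in \<open>ck_map\<close> are collected into one sequence, with
  \<open>g j\<close> as the \<open>j\<close>-th iterated difference quotient;
  \<open>ck_of_seq\<close> goes back.\<close>

lemma ck_imp_seq:
  assumes "ck_map sc T sc' T' m k U f"
  shows "\<exists>g. g 0 = f \<and> (\<forall>j\<le>k. continuous_map (subtopology (ptop av T (m + j)) (ext_iter sc (topspace T) m U j)) T' (g j))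
      \<and> (\<forall>j<k. \<forall>x v t. Node x v t \<in> ext_iter sc (topspace T) m U (Suc j) \<longrightarrow>
            g j (x + ptscale sc t v) = g j x + sc' t (g (Suc j) (Node x v t)))"
  using assms
proof (induction k arbitrary: m U f)
  case 0
  then show ?case by (intro exI[of _ "\<lambda>_. f"]) auto
next
  case (Suc k)
  let ?V = "ext sc (topspace T) m U"
  obtain f1 where f1: "ck_map sc T sc' T' (Suc m) k ?V f1"
    "\<And>x v t. Node x v t \<in> ?V \<Longrightarrow> f (x + ptscale sc t v) = f x + sc' t (f1 (Node x v t))"
    by (rule ck_SucE[OF Suc.prems]) blast
  obtain g where g: "g 0 = f1"
    "\<And>j. j \<le> k \<Longrightarrow> continuous_map (subtopology (ptop av T (Suc m + j)) (ext_iter sc (topspace T) (Suc m) ?V j)) T' (g j)"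
    "\<And>j x v t. j < k \<Longrightarrow> Node x v t \<in> ext_iter sc (topspace T) (Suc m) ?V (Suc j) \<Longrightarrow>
            g j (x + ptscale sc t v) = g j x + sc' t (g (Suc j) (Node x v t))"
    using Suc.IH[OF f1(1)] by metis
  define G where "G = case_nat f g"
  show ?case
  proof (intro exI[of _ G] conjI allI impI)
    fix j assume "j \<le> Suc k"
    then show "continuous_map (subtopology (ptop av T (m + j)) (ext_iter sc (topspace T) m U j)) T' (G j)"
      using g(2)[of "j - 1"] ck_continuous[OF Suc.prems]
      by (cases j) (simp_all add: G_def ext_iter_Suc_left del: ext_iter.simps(2))
  next
    fix j x v t assume j: "j < Suc k" and n: "Node x v t \<in> ext_iter sc (topspace T) m U (Suc j)"
    show "G j (x + ptscale sc t v) = G j x + sc' t (G (Suc j) (Node x v t))"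
    proof (cases j)
      case 0
      then show ?thesis using f1(2) n g(1) by (simp add: G_def)
    next
      case (Suc i)
      then have "Node x v t \<in> ext_iter sc (topspace T) (Suc m) ?V (Suc i)"
        using n by (simp only: ext_iter_Suc_left[of sc "topspace T" m U])
      then show ?thesis using g(3)[of i] j Suc by (simp add: G_def)
    qed
  qed (simp add: G_def)
qed

lemma ck_of_seq:
  assumes "U \<subseteq> lvl (topspace T) m"
    and "\<And>x. x \<in> U \<Longrightarrow> g 0 x = f x"
    and "\<And>j. j \<le> k \<Longrightarrow> continuous_map (subtopology (ptop av T (m + j)) (ext_iter sc (topspace T) m U j)) T' (g j)"
    and "\<And>j x v t. j < k \<Longrightarrow> Node x v t \<in> ext_iter sc (topspace T) m U (Suc j) \<Longrightarrow>
            g j (x + ptscale sc t v) = g j x + sc' t (g (Suc j) (Node x v t))"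
  shows "ck_map sc T sc' T' m k U f"
  using assms
proof (induction k arbitrary: m U f g)
  case 0
  then have "ck_map sc T sc' T' m 0 U (g 0)" by (metis ck_map.simps(1) ext_iter.simps(1) add_0_right le_zero_eq)
  then show ?case using 0(2) by (rule ck_cong)
next
  case (Suc k)
  let ?V = "ext sc (topspace T) m U"
  have "ck_map sc T sc' T' m 0 U (g 0)" using Suc.prems(1) Suc.prems(3)[of 0] by simp
  then have 0: "ck_map sc T sc' T' m 0 U f" using Suc.prems(2) by (rule ck_cong)
  have 1: "ck_map sc T sc' T' (Suc m) k ?V (g 1)"
  proof (rule Suc.IH[of ?V "Suc m" "\<lambda>j. g (Suc j)" "g 1"])
    fix j assume "j \<le> k"
    then show "continuous_map (subtopology (ptop av T (Suc m + j)) (ext_iter sc (topspace T) (Suc m) ?V j)) T' (g (Suc j))"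
      using Suc.prems(3)[of "Suc j"] by (simp add: ext_iter_Suc_left del: ext_iter.simps(2))
  next
    fix j x v t assume "j < k" "Node x v t \<in> ext_iter sc (topspace T) (Suc m) ?V (Suc j)"
    then show "g (Suc j) (x + ptscale sc t v) = g (Suc j) x + sc' t (g (Suc (Suc j)) (Node x v t))"
      using Suc.prems(4)[of "Suc j"] by (simp only: ext_iter_Suc_left[of sc "topspace T" m U])
  qed (use ext_subset_lvl[OF Suc.prems(1)] in auto)
  show ?case
  proof (rule ck_SucI[OF 0 1])
    fix x v t assume *: "Node x v t \<in> ?V"
    then show "f (x + ptscale sc t v) = f x + sc' t (g 1 (Node x v t))"
      using Suc.prems(4)[of 0 x v t] Suc.prems(2) by (simp add: ext_iff)
  qed
qed

lemma Ck_iff_ck_map: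
  fixes f :: "'a::ab_group_add \<Rightarrow> 'c::ab_group_add"
  assumes U: "U \<subseteq> topspace T"
  shows "Ck av sc (topspace T) T sc' T' U f k \<longleftrightarrow> ck_map sc T sc' T' 0 k (Base ` U) (\<lambda>p. f (unBase p))"
proof
  assume "Ck av sc (topspace T) T sc' T' U f k"
  then obtain g where g: "\<forall>x\<in>U. g 0 (Base x) = f x" "continuous_map (subtopology (ptop av T 0) (Base ` U)) T' (g 0)"
    "\<forall>j<k. continuous_map (subtopology (ptop av T (Suc j)) (iterU sc (topspace T) U (Suc j))) T' (g (Suc j))
           \<and> (\<forall>x v t. Node x v t \<in> iterU sc (topspace T) U (Suc j) \<longrightarrow>
                 g j (ptadd x (ptscale sc t v)) - g j x = sc' t (g (Suc j) (Node x v t)))"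
    unfolding Ck_def by blast
  show "ck_map sc T sc' T' 0 k (Base ` U) (\<lambda>p. f (unBase p))"
  proof (rule ck_of_seq[where g = g])
    fix j assume "j \<le> k"
    then show "continuous_map (subtopology (ptop av T (0 + j)) (ext_iter sc (topspace T) 0 (Base ` U) j)) T' (g j)"
      using g(2,3) by (cases j) (simp_all add: iterU_eq_ext_iter flip: add_0 del: ext_iter.simps(2) iterU.simps(2))
  next
    fix j x v t assume "j < k" "Node x v t \<in> ext_iter sc (topspace T) 0 (Base ` U) (Suc j)"
    then have "g j (x + ptscale sc t v) - g j x = sc' t (g (Suc j) (Node x v t))"
      using g(3) unfolding iterU_eq_ext_iter ptadd_eq_plus by blast
    then show "g j (x + ptscale sc t v) = g j x + sc' t (g (Suc j) (Node x v t))" by (simp add: algebra_simps)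
  qed (use U g(1) in auto)
next
  assume "ck_map sc T sc' T' 0 k (Base ` U) (\<lambda>p. f (unBase p))"
  from ck_imp_seq[OF this] obtain g where g: "g 0 = (\<lambda>p. f (unBase p))"
    "\<And>j. j \<le> k \<Longrightarrow> continuous_map (subtopology (ptop av T (0 + j)) (ext_iter sc (topspace T) 0 (Base ` U) j)) T' (g j)"
    "\<And>j x v t. j < k \<Longrightarrow> Node x v t \<in> ext_iter sc (topspace T) 0 (Base ` U) (Suc j) \<Longrightarrow>
            g j (x + ptscale sc t v) = g j x + sc' t (g (Suc j) (Node x v t))" by metis
  show "Ck av sc (topspace T) T sc' T' U f k"
    unfolding Ck_def iterU_eq_ext_iter ptadd_eq_plus
  proof (intro exI[of _ g] conjI allI impI ballI)
    show "continuous_map (subtopology (ptop av T 0) (Base ` U)) T' (g 0)" using g(2)[of 0] by simp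
    fix j assume "j < k"
    then show "continuous_map (subtopology (ptop av T (Suc j)) (ext_iter sc (topspace T) 0 (Base ` U) (Suc j))) T' (g (Suc j))"
      using g(2)[of "Suc j"] by (simp del: ext_iter.simps(2))
  qed (use g(1,3) in \<open>auto simp: algebra_simps simp del: ext_iter.simps(2)\<close>)
qed

lemma ext_lvl:
  assumes "tmod sc T"
  shows "ext sc (topspace T) m (lvl (topspace T) m) = lvl (topspace T) (Suc m)"
  using tmodD(1,5)[OF tmod_pt[OF assms, of m]] by (auto simp: ext_iff elim!: extE lvl_SucE)

lemma ext_iter_lvl: "tmod sc T \<Longrightarrow> ext_iter sc (topspace T) m (lvl (topspace T) m) n = lvl (topspace T) (m + n)"
  by (induction n) (simp_all add: ext_lvl)

lemma openin_lvl: "openin (ptop av T m) (lvl (topspace T) m)"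
  using openin_topspace[of "ptop av T m"] by simp

lemma ck_dquot_iter:
  assumes F: "tvs av sc' UNIV T'" and M: "tmod sc T"
    and f: "\<And>k. ck_map sc T sc' T' 0 k (lvl (topspace T) 0) f"
  shows "ck_map sc T sc' T' j k (lvl (topspace T) j) ((dquot sc sc' T' ^^ j) f)"
proof (induction j arbitrary: k)
  case 0
  then show ?case using f by simp
next
  case (Suc j)
  show ?case using ck_dquot[OF F M openin_lvl Suc[of "Suc k"]] by (simp add: ext_lvl[OF M])
qed

end

section \<open>Bump functions over ultrametric fields\<close>

context valued
begin

primrec pt_norm :: "('k, 'k) pt \<Rightarrow> real" where
  "pt_norm (Base x) = av x"
| "pt_norm (Node a b s) = max (max (pt_norm a) (pt_norm b)) (av s)"

abbreviation "ck_field \<equiv> ck_map (*) (ktop av) (*) (ktop av)"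
abbreviation "dquot_field \<equiv> dquot (*) (*) (ktop av)"

text \<open>The value \<open>1\<close> on a whole neighbourhood and the bound \<open>1\<close> serve
  the localizing maps, which must be the identity near a point and stay in a box. The bounds on
  iterated difference quotients serve the choice of fast sequences.\<close>

definition bump :: "'k \<Rightarrow> real \<Rightarrow> (('k, 'k) pt \<Rightarrow> 'k) \<Rightarrow> bool" where
  "bump a e h \<longleftrightarrow> (\<forall>k. ck_field 0 k (lvl UNIV 0) h)
     \<and> (\<forall>t. e \<le> av (t - a) \<longrightarrow> h (Base t) = 0) \<and> (\<forall>t. av (h (Base t)) \<le> 1)
     \<and> (\<exists>d>0. \<forall>t. av (t - a) < d \<longrightarrow> h (Base t) = 1)
     \<and> (\<forall>j R. \<exists>M. \<forall>p\<in>lvl UNIV j. pt_norm p \<le> R \<longrightarrow> av ((dquot_field ^^ j) h p) \<le> M)"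

definition cut_one :: "real \<Rightarrow> 'k \<Rightarrow> 'k" where
  "cut_one d u = (if av u < d then 1 else 0)"

text \<open>Inversion cut off near \<open>0\<close>, so that it is bounded by \<open>1 / d\<close>.
  It will divide by increments of absolute value at least \<open>d\<close>.\<close>

definition cut_inverse :: "real \<Rightarrow> 'k \<Rightarrow> 'k" where
  "cut_inverse d u = (if av u < d then 0 else inverse u)"

text \<open>A class of functions that is closed under difference quotients, contains the indicator
  functions of balls, and consists of functions bounded on bounded sets. The boundedness
  has to be carried along because the field need not be locally compact.\<close>
inductive alg :: "real \<Rightarrow> nat \<Rightarrow> (('k, 'k) pt \<Rightarrow> 'k) \<Rightarrow> bool" for d where
  alg_lin: "lin (*) (ktop av) (*) (ktop av) m L \<Longrightarrow> (\<And>p. p \<in> lvl UNIV m \<Longrightarrow> av (L p) \<le> pt_norm p) \<Longrightarrow> alg d m L"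
| alg_const: "alg d m (\<lambda>_. c)"
| alg_add: "alg d m G \<Longrightarrow> alg d m H \<Longrightarrow> alg d m (\<lambda>p. G p + H p)"
| alg_mult: "alg d m G \<Longrightarrow> alg d m H \<Longrightarrow> alg d m (\<lambda>p. G p * H p)"
| alg_cut_one: "alg d m G \<Longrightarrow> alg d m (\<lambda>p. cut_one d (G p))"
| alg_cut_inverse: "alg d m G \<Longrightarrow> alg d m (\<lambda>p. cut_inverse d (G p))"

lemma alg_pfst: "alg d m G \<Longrightarrow> alg d (Suc m) (\<lambda>p. G (pfst p))"
proof (induction rule: alg.induct)
  case (alg_lin m L)
  have "av (L (pfst p)) \<le> pt_norm p" if "p \<in> lvl UNIV (Suc m)" for p
    using that alg_lin(2)[of "pfst p"] by (auto elim!: lvl_SucE)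
  then show ?case by (intro alg.alg_lin lin_comp[OF lin_pfst alg_lin(1)])
qed (auto intro: alg.intros)

lemma alg_ptrd: "alg d (Suc m) ptrd"
  by (intro alg.alg_lin lin_ptrd) (auto elim!: lvl_SucE)

lemma lvl_field_add: "x \<in> lvl UNIV m \<Longrightarrow> v \<in> lvl UNIV m \<Longrightarrow> x + ptscale (*) (t::'k) v \<in> lvl UNIV m"
  using tmodD(1,5)[OF tmod_pt[OF tmod_field, of m]] by simp

end

locale ultrametric = valued av for av :: "'k::field \<Rightarrow> real" +
  assumes ultra: "av (x + y) \<le> max (av x) (av y)"
begin

text \<open>By the strong triangle inequality, a move of size less than \<open>d\<close> never
  crosses the boundary of the ball of radius \<open>d\<close>. This is why indicator functions of
  balls are smooth.\<close>

lemma av_add_cong: "av w < d \<Longrightarrow> av (u + w) < d \<longleftrightarrow> av u < d"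
  using ultra[of u w] ultra[of "u + w" "- w"] by auto

lemma cut_one_add: "av w < d \<Longrightarrow> cut_one d (u + w) = cut_one d u"
  by (simp add: cut_one_def av_add_cong)

lemma continuous_cut_one: "d > 0 \<Longrightarrow> continuous_map (ktop av) (ktop av) (cut_one d)"
  unfolding continuous_map_into_ktop
proof (intro ballI allI impI)
  fix x and e :: real assume "d > 0" "e > 0"
  then show "\<exists>W. openin (ktop av) W \<and> x \<in> W \<and> (\<forall>y\<in>W. av (cut_one d y - cut_one d x) < e)"
    using cut_one_add[of _ d x] by (intro exI[of _ "{y. av (y - x) < d}"] conjI openin_ball)
      (auto, metis add_diff_cancel_left' av_0 cut_one_add diff_add_cancel diff_self add.commute)
qed

lemma cut_inverse_diff:
  assumes d: "d > 0" and w: "av (y - x) < d"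
  shows "av (cut_inverse d y - cut_inverse d x) \<le> av (y - x) / (d * d)"
proof (cases "av x < d")
  case True
  then have "av y < d" using av_add_cong[OF w, of x] by simp
  then show ?thesis using True d by (simp add: cut_inverse_def)
next
  case False
  then have y: "\<not> av y < d" using av_add_cong[OF w, of x] by simp
  have nz: "x \<noteq> 0" "y \<noteq> 0" using False y d by auto
  have "inverse y - inverse x = (x - y) / (y * x)" using nz by (simp add: field_simps)
  then have "av (cut_inverse d y - cut_inverse d x) = av (y - x) / (av y * av x)"
    using False y by (simp add: cut_inverse_def av_divide av_mult av_minus_commute)
  also have "\<dots> \<le> av (y - x) / (d * d)"
    using False y d by (intro divide_left_mono mult_mono mult_pos_pos) (auto simp: nz)
  finally show ?thesis .
qed

lemma continuous_cut_inverse: "d > 0 \<Longrightarrow> continuous_map (ktop av) (ktop av) (cut_inverse d)"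
  unfolding continuous_map_into_ktop
proof (intro ballI allI impI)
  fix x and e :: real assume d: "d > 0" and e: "e > 0"
  have "av (cut_inverse d y - cut_inverse d x) < e" if "av (y - x) < min d (e * (d * d))" for y
  proof -
    have "av (cut_inverse d y - cut_inverse d x) \<le> av (y - x) / (d * d)" using that d by (intro cut_inverse_diff) auto
    also have "\<dots> < e" using that d by (simp add: divide_less_eq)
    finally show ?thesis .
  qed
  then show "\<exists>W. openin (ktop av) W \<and> x \<in> W \<and> (\<forall>y\<in>W. av (cut_inverse d y - cut_inverse d x) < e)"
    using d e by (intro exI[of _ "{y. av (y - x) < min d (e * (d * d))}"] conjI openin_ball) auto
qed

lemma alg_continuous: "d > 0 \<Longrightarrow> alg d m G \<Longrightarrow> continuous_map (ptop av (ktop av) m) (ktop av) G"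
proof (rotate_tac, induction rule: alg.induct)
  case (alg_cut_one m G)
  then show ?case using continuous_map_compose[of _ _ G _ "cut_one d"] continuous_cut_one by (auto simp: o_def)
next
  case (alg_cut_inverse m G)
  then show ?case using continuous_map_compose[of _ _ G _ "cut_inverse d"] continuous_cut_inverse by (auto simp: o_def)
qed (auto simp: lin_def intro: tmod_continuous_add[OF tmod_field] tmod_continuous_scale[OF tmod_field])

lemma alg_bounded:
  assumes "alg d m G" "d > 0"
  shows "\<exists>M. \<forall>p\<in>lvl UNIV m. pt_norm p \<le> R \<longrightarrow> av (G p) \<le> M"
  using assms(1)
proof (induction rule: alg.induct)
  case (alg_lin m L)
  then show ?case by (intro exI[of _ R]) force
next
  case (alg_add m G H)
  then obtain M N where "\<forall>p\<in>lvl UNIV m. pt_norm p \<le> R \<longrightarrow> av (G p) \<le> M" "\<forall>p\<in>lvl UNIV m. pt_norm p \<le> R \<longrightarrow> av (H p) \<le> N"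
    by blast
  then show ?case
    by (intro exI[of _ "M + N"]) (auto intro!: order_trans[OF av_triangle] add_mono)
next
  case (alg_mult m G H)
  then obtain M N where "\<forall>p\<in>lvl UNIV m. pt_norm p \<le> R \<longrightarrow> av (G p) \<le> M" "\<forall>p\<in>lvl UNIV m. pt_norm p \<le> R \<longrightarrow> av (H p) \<le> N"
    by blast
  then show ?case
    by (intro exI[of _ "\<bar>M\<bar> * N"]) (auto simp: av_mult intro!: mult_mono)
next
  case (alg_cut_one m G)
  then show ?case by (intro exI[of _ 1]) (auto simp: cut_one_def)
next
  case (alg_cut_inverse m G)
  have "inverse (av u) \<le> inverse d" if "\<not> av u < d" for u
    using that assms(2) by (intro le_imp_inverse_le) auto
  then show ?case using assms(2) by (intro exI[of _ "inverse d"]) (auto simp: cut_inverse_def av_inverse)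
qed auto

text \<open>An increment \<open>t * g\<close> below \<open>d\<close> leaves \<open>cut_one\<close>
  unchanged, and \<open>cut_inverse d (t * g)\<close> is then \<open>0\<close>; otherwise
  \<open>cut_inverse d (t * g)\<close> is a true inverse and the increment cancels. So one formula
  from the class covers all \<open>t\<close>, including \<open>0\<close>.\<close>

lemma cut_one_step: "d > 0 \<Longrightarrow> cut_one d (u + t * g) = cut_one d u + t * (g * ((cut_one d (u + t * g) + (-1) * cut_one d u) * cut_inverse d (t * g)))"
proof (cases "av (t * g) < d")
  case True
  then show ?thesis by (simp add: cut_one_add)
next
  case False
  assume "d > 0"
  then have "t * g \<noteq> 0" using False by auto
  then have "t * g * cut_inverse d (t * g) = 1" using right_inverse[of "t * g"] False by (simp add: cut_inverse_def del: right_inverse mult_eq_0_iff inverse_mult_distrib)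
  then have "t * (g * (X * cut_inverse d (t * g))) = X" for X by (metis mult.assoc mult.commute mult_1)
  then have "t * (g * ((cut_one d (u + t * g) + (-1) * cut_one d u) * cut_inverse d (t * g))) = cut_one d (u + t * g) + (-1) * cut_one d u" .
  then show ?thesis by (simp only:) simp
qed

text \<open>\<open>mix u w\<close> is \<open>1\<close> if exactly one of \<open>u\<close> and
  \<open>w\<close> lies in the ball and \<open>0\<close> otherwise. The first summand is the usual
  difference quotient of inversion and survives only if both lie outside. If they lie on different
  sides, the increment has absolute value at least \<open>d\<close>, and the second summand divides
  by it.\<close>

lemma cut_inverse_step:
  assumes d: "d > 0"
  defines "mix u w \<equiv> cut_one d u * (1 + (-1) * cut_one d w) + (1 + (-1) * cut_one d u) * cut_one d w"
  shows "cut_inverse d (u + t * g) = cut_inverse d u + t * (g * ((-1) * (cut_inverse d u * cut_inverse d (u + t * g))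
     + mix u (u + t * g) * (cut_inverse d (t * g) * (cut_inverse d (u + t * g) + (-1) * cut_inverse d u))))"
proof -
  define w where "w = u + t * g"
  have tg: "t * g = w - u" by (simp add: w_def)
  consider "av u < d" "av w < d" | "\<not> av u < d" "\<not> av w < d" | "av u < d \<longleftrightarrow> \<not> av w < d" by blast
  then show ?thesis
  proof cases
    case 1
    then show ?thesis unfolding w_def[symmetric] by (simp add: cut_inverse_def cut_one_def mix_def)
  next
    case 2
    then have nz: "u \<noteq> 0" "w \<noteq> 0" using d by auto
    have "inverse w = inverse u + (w - u) * (- (inverse u * inverse w))" using nz by (simp add: field_simps)
    then have "inverse w = inverse u + t * (g * (- (inverse u * inverse w)))" unfolding tg[symmetric] by (simp add: mult_ac)
    then show ?thesis using 2 unfolding w_def[symmetric] by (simp add: cut_inverse_def cut_one_def mix_def)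
  next
    case 3
    have nlt: "\<not> av (t * g) < d" using 3 av_add_cong[of "t * g" d u] by (auto simp: w_def)
    then have "t * g \<noteq> 0" using d by auto
    then have 1: "t * g * cut_inverse d (t * g) = 1" using right_inverse[of "t * g"] nlt by (simp add: cut_inverse_def del: right_inverse mult_eq_0_iff inverse_mult_distrib)
    then have 2: "t * (g * (cut_inverse d (t * g) * X)) = X" for X by (metis mult.assoc mult_1)
    have "mix u w = 1" "cut_inverse d u * cut_inverse d w = 0" using 3 by (auto simp: mix_def cut_one_def cut_inverse_def)
    then show ?thesis unfolding w_def[symmetric]
      by (simp only: mult_zero_right add_0 mult_1 2) simp
  qed
qed

lemma alg_deriv:
  assumes "alg d m G" "d > 0"
  shows "\<exists>G1. alg d (Suc m) G1 \<and> (\<forall>x\<in>lvl UNIV m. \<forall>v\<in>lvl UNIV m. \<forall>t. G (x + ptscale (*) t v) = G x + t * G1 (Node x v t))"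
  using assms(1)
proof (induction rule: alg.induct)
  case (alg_lin m L)
  have "av (L (psnd p)) \<le> pt_norm p" if "p \<in> lvl UNIV (Suc m)" for p
    using that alg_lin(2)[of "psnd p"] by (auto elim!: lvl_SucE)
  then have "alg d (Suc m) (\<lambda>p. L (psnd p))" by (intro alg.alg_lin lin_comp[OF lin_psnd alg_lin(1)])
  then show ?case using alg_lin(1) by (intro exI[of _ "\<lambda>p. L (psnd p)"]) (auto simp: lin_def)
next
  case (alg_const m c)
  then show ?case by (intro exI[of _ "\<lambda>_. 0"]) (auto intro: alg.alg_const)
next
  case (alg_add m G H)
  then obtain G1 H1 where "alg d (Suc m) G1" "alg d (Suc m) H1"
    and "\<forall>x\<in>lvl UNIV m. \<forall>v\<in>lvl UNIV m. \<forall>t. G (x + ptscale (*) t v) = G x + t * G1 (Node x v t)"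
    and "\<forall>x\<in>lvl UNIV m. \<forall>v\<in>lvl UNIV m. \<forall>t. H (x + ptscale (*) t v) = H x + t * H1 (Node x v t)" by blast
  then show ?case
    by (intro exI[of _ "\<lambda>p. G1 p + H1 p"]) (auto intro: alg.alg_add simp: algebra_simps)
next
  case (alg_mult m G H)
  then obtain G1 H1 where "alg d (Suc m) G1" "alg d (Suc m) H1"
    and "\<forall>x\<in>lvl UNIV m. \<forall>v\<in>lvl UNIV m. \<forall>t. G (x + ptscale (*) t v) = G x + t * G1 (Node x v t)"
    and "\<forall>x\<in>lvl UNIV m. \<forall>v\<in>lvl UNIV m. \<forall>t. H (x + ptscale (*) t v) = H x + t * H1 (Node x v t)" by blast
  then show ?case using alg_mult(1,2)
    by (intro exI[of _ "\<lambda>p. G1 p * H (pfst p) + (G (pfst p) * H1 p + ptrd p * (G1 p * H1 p))"] conjI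
       alg.alg_add alg.alg_mult alg_pfst alg_ptrd) (auto simp: algebra_simps)
next
  case (alg_cut_one m G)
  then obtain G1 where G1: "alg d (Suc m) G1"
    and *: "\<forall>x\<in>lvl UNIV m. \<forall>v\<in>lvl UNIV m. \<forall>t. G (x + ptscale (*) t v) = G x + t * G1 (Node x v t)" by blast
  define H where "H = (\<lambda>p. G1 p * ((cut_one d (G (pfst p) + ptrd p * G1 p) + (-1) * cut_one d (G (pfst p))) * cut_inverse d (ptrd p * G1 p)))"
  have "alg d (Suc m) H"
    unfolding H_def using G1 alg_cut_one(1)
    by (intro alg.alg_add alg.alg_mult alg_pfst alg_ptrd alg.alg_const alg.alg_cut_one alg.alg_cut_inverse)
  moreover have "cut_one d (G (x + ptscale (*) t v)) = cut_one d (G x) + t * H (Node x v t)"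
    if "x \<in> lvl UNIV m" "v \<in> lvl UNIV m" for x v t
    using * that cut_one_step[OF assms(2), of "G x" t "G1 (Node x v t)"] by (simp add: H_def)
  ultimately show ?case by blast
next
  case (alg_cut_inverse m G)
  then obtain G1 where G1: "alg d (Suc m) G1"
    and *: "\<forall>x\<in>lvl UNIV m. \<forall>v\<in>lvl UNIV m. \<forall>t. G (x + ptscale (*) t v) = G x + t * G1 (Node x v t)" by blast
  define w where "w = (\<lambda>p. G (pfst p) + ptrd p * G1 p)"
  have w: "alg d (Suc m) w" unfolding w_def using G1 alg_cut_inverse(1)
    by (intro alg.alg_add alg.alg_mult alg_pfst alg_ptrd)
  define H where "H = (\<lambda>p. G1 p * ((-1) * (cut_inverse d (G (pfst p)) * cut_inverse d (w p))
     + (cut_one d (G (pfst p)) * (1 + (-1) * cut_one d (w p)) + (1 + (-1) * cut_one d (G (pfst p))) * cut_one d (w p))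
        * (cut_inverse d (ptrd p * G1 p) * (cut_inverse d (w p) + (-1) * cut_inverse d (G (pfst p))))))"
  have "alg d (Suc m) H"
    unfolding H_def using G1 alg_cut_inverse(1) w
    by (intro alg.alg_add alg.alg_mult alg_pfst alg_ptrd alg.alg_const alg.alg_cut_one alg.alg_cut_inverse)
  moreover have "cut_inverse d (G (x + ptscale (*) t v)) = cut_inverse d (G x) + t * H (Node x v t)"
    if "x \<in> lvl UNIV m" "v \<in> lvl UNIV m" for x v t
    using * that cut_inverse_step[OF assms(2), of "G x" t "G1 (Node x v t)"] by (simp add: H_def w_def)
  ultimately show ?case by blast
qed

lemma alg_ck:
  assumes "alg d m G" "d > 0"
  shows "ck_field m k (lvl UNIV m) G"
  using assms(1)
proof (induction k arbitrary: m G)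
  case 0
  then show ?case using alg_continuous[OF assms(2)] by (auto simp: continuous_map_from_subtopology)
next
  case (Suc k)
  obtain G1 where G1: "alg d (Suc m) G1"
    and *: "\<forall>x\<in>lvl UNIV m. \<forall>v\<in>lvl UNIV m. \<forall>t. G (x + ptscale (*) t v) = G x + t * G1 (Node x v t)"
    using alg_deriv[OF Suc.prems assms(2)] by blast
  have 0: "ck_field m 0 (lvl UNIV m) G"
    using alg_continuous[OF assms(2) Suc.prems] by (auto simp: continuous_map_from_subtopology)
  have e: "ext (*) (topspace (ktop av)) m (lvl UNIV m) = lvl UNIV (Suc m)"
    using ext_lvl[OF tmod_field, of m] by simp
  show ?case
    by (rule ck_SucI[OF 0, where g = G1]) (use Suc.IH[OF G1] * e in auto)
qed

text \<open>Transfers bounds: by uniqueness the canonical iterated quotients coincide with members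
  of the class, to which \<open>alg_bounded\<close> applies.\<close>

lemma alg_D:
  assumes "alg d 0 h" "d > 0"
  shows "\<exists>G. alg d j G \<and> (\<forall>p\<in>lvl UNIV j. (dquot_field ^^ j) h p = G p)"
proof (induction j)
  case (Suc j)
  then obtain G where G: "alg d j G" "\<forall>p\<in>lvl UNIV j. (dquot_field ^^ j) h p = G p" by blast
  obtain G1 where G1: "alg d (Suc j) G1"
    and *: "\<forall>x\<in>lvl UNIV j. \<forall>v\<in>lvl UNIV j. \<forall>t. G (x + ptscale (*) t v) = G x + t * G1 (Node x v t)"
    using alg_deriv[OF G(1) assms(2)] by blast
  have e: "ext (*) (topspace (ktop av)) j (lvl UNIV j) = lvl UNIV (Suc j)"
    using ext_lvl[OF tmod_field, of j] by simp
  have o: "openin (ptop av (ktop av) j) (lvl UNIV j)" using openin_lvl[of "ktop av" j] by simp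
  have "dquot_field ((dquot_field ^^ j) h) p = G1 p" if "p \<in> lvl UNIV (Suc j)" for p
    by (rule dquot_unique[OF tvs_field tmod_field o])
       (use alg_ck[OF G1 assms(2), of 0] e that * G(2) lvl_field_add in auto)
  then show ?case using G1 by auto
qed (use assms in auto)

lemma bump_exists:
  assumes "e > 0"
  shows "\<exists>h. bump a e h"
proof -
  define h :: "('k, 'k) pt \<Rightarrow> 'k" where "h = (\<lambda>p. cut_one e (unBase p + (- a)))"
  have "lin (*) (ktop av) (*) (ktop av) 0 unBase" by (rule lin_unBase)
  then have "alg e 0 unBase" by (rule alg_lin) (auto simp: lvl_0_iff)
  then have h: "alg e 0 h" unfolding h_def by (intro alg_cut_one alg_add alg_const)
  have "\<exists>M. \<forall>p\<in>lvl UNIV j. pt_norm p \<le> R \<longrightarrow> av ((dquot_field ^^ j) h p) \<le> M" for j R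
    using alg_D[OF h assms, of j] alg_bounded[OF _ assms, of j] by metis
  then have "bump a e h"
    unfolding bump_def using alg_ck[OF h assms] assms
    by (auto simp: h_def cut_one_def intro!: exI[of _ e])
  then show ?thesis by blast
qed

end

section \<open>Bump functions over the reals\<close>

lemma poly_exp_tendsto_0:
  fixes p :: "real poly"
  shows "((\<lambda>y. poly p y * exp (- y)) \<longlongrightarrow> 0) at_top"
proof -
  have "((\<lambda>y. \<Sum>i\<le>degree p. coeff p i * (y ^ i / exp y)) \<longlongrightarrow> (\<Sum>i\<le>degree p. coeff p i * 0)) at_top"
    by (intro tendsto_intros tendsto_power_div_exp_0)
  then show ?thesis
    by (simp add: poly_altdef exp_minus field_simps sum_distrib_left sum_divide_distrib)
qed

text \<open>With \<open>y = 1 / x\<close>, differentiating \<open>p(y) * exp (- y)\<close> with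
  respect to \<open>x\<close> gives \<open>y^2 * (p - p')(y) * exp (- y)\<close>.\<close>

primrec flat_poly :: "nat \<Rightarrow> real poly" where
  "flat_poly 0 = 1"
| "flat_poly (Suc n) = [:0, 0, 1:] * (flat_poly n - pderiv (flat_poly n))"

text \<open>The \<open>n\<close>-th derivative of the flat function \<open>exp (- 1 / x)\<close> (extended by \<open>0\<close> to \<open>x \<le> 0\<close>).\<close>
definition flat :: "nat \<Rightarrow> real \<Rightarrow> real" where
  "flat n x = (if x > 0 then poly (flat_poly n) (1 / x) * exp (- (1 / x)) else 0)"

lemma flat_deriv: "(flat n has_real_derivative flat (Suc n) x) (at x)"
proof -
  consider "x > 0" | "x < 0" | "x = 0" by linarith
  then show ?thesis
  proof cases
    case 1
    have "((\<lambda>x. poly (flat_poly n) (1 / x) * exp (- (1 / x))) has_real_derivative flat (Suc n) x) (at x)"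
      using 1 by (auto intro!: derivative_eq_intros simp: flat_def algebra_simps power2_eq_square divide_simps)
    then show ?thesis
      by (rule has_field_derivative_transform_within_open[where S = "{0<..}"]) (use 1 in \<open>auto simp: flat_def\<close>)
  next
    case 2
    have "((\<lambda>x. 0) has_real_derivative flat (Suc n) x) (at x)" using 2 by (simp add: flat_def)
    then show ?thesis
      by (rule has_field_derivative_transform_within_open[where S = "{..<0}"]) (use 2 in \<open>auto simp: flat_def\<close>)
  next
    case 3
    have r: "((\<lambda>h. flat n h / h) \<longlongrightarrow> 0) (at_right 0)"
    proof -
      \<comment> \<open>Division by \<open>h\<close> is a further factor \<open>1 / h\<close>, hence
        the polynomial \<open>[:0, 1:]\<close>; the exponential still dominates.\<close>
      have "((\<lambda>h. poly ([:0, 1:] * flat_poly n) (inverse h) * exp (- inverse h)) \<longlongrightarrow> 0) (at_right 0)"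
        by (rule filterlim_compose[OF poly_exp_tendsto_0 filterlim_inverse_at_top_right])
      then show ?thesis
        by (rule Lim_transform_eventually)
           (auto simp: eventually_at_right_field flat_def field_simps intro!: exI[of _ 1])
    qed
    have l: "((\<lambda>h. flat n h / h) \<longlongrightarrow> 0) (at_left 0)"
      by (rule Lim_transform_eventually[OF tendsto_const[of 0]])
         (auto simp: eventually_at_left_field flat_def intro!: exI[of _ "-1"])
    have "((\<lambda>h. flat n h / h) \<longlongrightarrow> 0) (at 0)" using l r by (rule filterlim_split_at)
    then show ?thesis using 3 by (simp add: DERIV_def flat_def)
  qed
qed

text \<open>The field is only isomorphic to the reals: derivatives and integrals are formed on the
  real side and carried back by the inverse of \<open>\<phi>\<close>.\<close>

locale real_valued = valued av for av :: "'k::field \<Rightarrow> real" +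
  fixes \<phi> :: "'k \<Rightarrow> real"
  assumes bij_phi: "bij \<phi>" and phi_add: "\<phi> (x + y) = \<phi> x + \<phi> y" and phi_mult: "\<phi> (x * y) = \<phi> x * \<phi> y"
    and phi_1: "\<phi> 1 = 1" and av_phi: "av x = \<bar>\<phi> x\<bar>"
begin

definition \<psi> :: "real \<Rightarrow> 'k" where "\<psi> = inv \<phi>"

lemma phi_psi [simp]: "\<phi> (\<psi> r) = r" and psi_phi [simp]: "\<psi> (\<phi> x) = x"
  using bij_phi by (simp_all add: \<psi>_def bij_is_surj surj_f_inv_f bij_is_inj)

lemma phi_eq: "\<phi> x = \<phi> y \<longleftrightarrow> x = y"
  using bij_phi by (simp add: bij_is_inj inj_eq)

lemma phi_0 [simp]: "\<phi> 0 = 0" using phi_add[of 0 0] by simp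

lemma phi_minus: "\<phi> (- x) = - \<phi> x" using phi_add[of x "- x"] by simp

lemma phi_diff: "\<phi> (x - y) = \<phi> x - \<phi> y" using phi_add[of x "- y"] by (simp add: phi_minus)

lemma phi_inverse: "\<phi> (inverse x) = inverse (\<phi> x)"
proof (cases "x = 0")
  case False
  then have "\<phi> x * \<phi> (inverse x) = 1" using phi_mult[of x "inverse x"] phi_1 by simp
  then show ?thesis by (metis inverse_unique)
qed simp

lemma psi_add: "\<psi> (r + s) = \<psi> r + \<psi> s" and psi_mult: "\<psi> (r * s) = \<psi> r * \<psi> s"
  by (simp_all add: phi_eq[symmetric] phi_add phi_mult)

lemma continuous_phi: "continuous_map (ktop av) euclideanreal \<phi>"
  unfolding continuous_map_at_iff
proof (intro ballI conjI allI impI)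
  fix x and V :: "real set" assume "openin euclideanreal V \<and> \<phi> x \<in> V"
  then obtain e where e: "e > 0" "\<And>y. \<bar>y - \<phi> x\<bar> < e \<Longrightarrow> y \<in> V"
    by (auto simp: open_dist dist_real_def)
  then show "\<exists>W. openin (ktop av) W \<and> x \<in> W \<and> (\<forall>y\<in>W. \<phi> y \<in> V)"
    by (intro exI[of _ "{y. av (y - x) < e}"] conjI openin_ball) (auto simp: av_phi phi_diff)
qed simp

lemma continuous_psi: "continuous_map euclideanreal (ktop av) \<psi>"
  unfolding continuous_map_into_ktop
proof (intro ballI allI impI)
  fix x e :: real assume "e > 0"
  then show "\<exists>W. openin euclideanreal W \<and> x \<in> W \<and> (\<forall>y\<in>W. av (\<psi> y - \<psi> x) < e)"
    by (intro exI[of _ "ball x e"]) (auto simp: av_phi phi_diff dist_real_def)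
qed

text \<open>Compactness of balls makes the bounds demanded of bumps automatic here, in contrast to
  the ultrametric case.\<close>

lemma compactin_ball: "compactin (ptop av (ktop av) m) {p \<in> lvl UNIV m. pt_norm p \<le> R}"
proof (induction m)
  case 0
  have "compactin (ptop av (ktop av) 0) ((\<lambda>r. Base (\<psi> r)) ` {-R..R})"
    by (rule image_compactin[of euclideanreal]) (simp_all add: continuous_Base continuous_psi)
  moreover have "(\<lambda>r. Base (\<psi> r)) ` {-R..R} = {p \<in> lvl UNIV 0. pt_norm p \<le> R}"
  proof -
    have "Base x \<in> (\<lambda>r. Base (\<psi> r)) ` {-R..R}" if "\<bar>\<phi> x\<bar> \<le> R" for x
      using that by (intro image_eqI[of _ _ "\<phi> x"]) auto
    then show ?thesis by (auto simp: lvl_0_iff av_phi)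
  qed
  ultimately show ?case by simp
next
  case (Suc m)
  let ?B = "{p \<in> lvl UNIV m. pt_norm p \<le> R}" and ?P = "ptop av (ktop av) m"
  have "compactin (ktop av) (\<psi> ` {-R..R})"
    by (rule image_compactin[of euclideanreal]) (simp_all add: continuous_psi)
  moreover have "\<psi> ` {-R..R} = {x. av x \<le> R}"
  proof -
    have "x \<in> \<psi> ` {-R..R}" if "\<bar>\<phi> x\<bar> \<le> R" for x
      using that by (intro image_eqI[of _ _ "\<phi> x"]) auto
    then show ?thesis by (auto simp: av_phi)
  qed
  ultimately have "compactin (prod_topology ?P (prod_topology ?P (ktop av))) (?B \<times> (?B \<times> {x. av x \<le> R}))"
    using Suc by (simp add: compactin_Times)
  moreover have "continuous_map (prod_topology ?P (prod_topology ?P (ktop av))) (ptop av (ktop av) (Suc m))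
      (\<lambda>z. Node (fst z) (fst (snd z)) (snd (snd z)))"
    unfolding continuous_Node
    using continuous_map_compose[OF continuous_map_snd continuous_map_fst]
      continuous_map_compose[OF continuous_map_snd continuous_map_snd] continuous_map_fst
    by (auto simp: o_def)
  ultimately have "compactin (ptop av (ktop av) (Suc m)) ((\<lambda>z. Node (fst z) (fst (snd z)) (snd (snd z))) ` (?B \<times> (?B \<times> {x. av x \<le> R})))"
    by (rule image_compactin)
  moreover have "(\<lambda>z. Node (fst z) (fst (snd z)) (snd (snd z))) ` (?B \<times> (?B \<times> {x. av x \<le> R})) = {p \<in> lvl UNIV (Suc m). pt_norm p \<le> R}"
    by (auto simp: image_iff lvl_Suc_iff)
  ultimately show ?case by simp
qed

lemma bounded_on_ball:
  assumes "ck_field m k (lvl UNIV m) G"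
  shows "\<exists>M. \<forall>p\<in>lvl UNIV m. pt_norm p \<le> R \<longrightarrow> av (G p) \<le> M"
proof -
  have "continuous_map (ptop av (ktop av) m) euclideanreal (\<lambda>p. \<phi> (G p))"
    using continuous_map_compose[OF ck_continuous[OF assms] continuous_phi] by (simp add: o_def lvl_whole)
  from image_compactin[OF compactin_ball this]
  have "bounded ((\<lambda>p. \<phi> (G p)) ` {p \<in> lvl UNIV m. pt_norm p \<le> R})" by (auto intro: compact_imp_bounded)
  then obtain M where "\<And>y. y \<in> (\<lambda>p. \<phi> (G p)) ` {p \<in> lvl UNIV m. pt_norm p \<le> R} \<Longrightarrow> norm y \<le> M"
    by (auto simp: bounded_iff)
  then show ?thesis by (intro exI[of _ M]) (auto simp: av_phi)
qed

text \<open>The third component of a node serves as the parameter; the second one is a dummy.\<close>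
definition unit_integral :: "(('k, 'k) pt \<Rightarrow> 'k) \<Rightarrow> ('k, 'k) pt \<Rightarrow> 'k" where
  "unit_integral G p = \<psi> (integral {0..1} (\<lambda>s. \<phi> (G (Node p p (\<psi> s)))))"

lemma unit_integral_integrand_continuous:
  assumes G: "continuous_map (ptop av (ktop av) (Suc m)) (ktop av) G" and p: "p \<in> lvl UNIV m" "q \<in> lvl UNIV m"
  shows "continuous_on S (\<lambda>s. \<phi> (G (Node p q (\<psi> s))))"
proof -
  have "continuous_map euclideanreal (ptop av (ktop av) (Suc m)) (\<lambda>s. Node p q (\<psi> s))"
    using p by (simp add: continuous_Node continuous_psi)
  from continuous_map_compose[OF continuous_map_compose[OF this G] continuous_phi]
  have "continuous_on UNIV (\<lambda>s. \<phi> (G (Node p q (\<psi> s))))" by (simp add: o_def)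
  then show ?thesis by (rule continuous_on_subset) simp
qed

text \<open>The integrand is close to its value for \<open>p0\<close> on an open set containing
  \<open>{p0}\<close> times the compact unit interval. By the tube lemma one neighbourhood of
  \<open>p0\<close> serves all parameters \<open>s\<close>, and the integrals are then equally
  close.\<close>

lemma unit_integral_continuous:
  assumes G: "continuous_map (ptop av (ktop av) (Suc m)) (ktop av) G"
  shows "continuous_map (ptop av (ktop av) m) (ktop av) (unit_integral G)"
  unfolding continuous_map_into_ktop
proof (intro ballI allI impI)
  let ?P = "ptop av (ktop av) m" and ?I = "top_of_set {0..1::real}"
  fix p0 and e :: real assume p0': "p0 \<in> topspace ?P" and e: "e > 0"
  then have p0: "p0 \<in> lvl UNIV m" by simp
  have c2: "continuous_map (prod_topology ?P ?I) (ktop av) (\<lambda>z. \<psi> (snd z))"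
    using continuous_map_compose[OF continuous_map_snd continuous_map_from_subtopology[OF continuous_psi]]
    by (simp add: o_def)
  have cG: "continuous_map (prod_topology ?P ?I) (ktop av) (\<lambda>z. G (Node (fst z) (fst z) (\<psi> (snd z))))"
    using continuous_map_compose[of _ "ptop av (ktop av) (Suc m)" "\<lambda>z. Node (fst z) (fst z) (\<psi> (snd z))" _ G] G c2
      continuous_map_fst[of ?P ?I] by (auto simp: o_def continuous_Node)
  have cG0: "continuous_map (prod_topology ?P ?I) (ktop av) (\<lambda>z. G (Node p0 p0 (\<psi> (snd z))))"
    using continuous_map_compose[of _ "ptop av (ktop av) (Suc m)" "\<lambda>z. Node p0 p0 (\<psi> (snd z))" _ G] G c2 p0
    by (auto simp: o_def continuous_Node)
  have cd: "continuous_map (prod_topology ?P ?I) (ktop av)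
      (\<lambda>z. G (Node (fst z) (fst z) (\<psi> (snd z))) + (-1) * G (Node p0 p0 (\<psi> (snd z))))"
    by (intro tmod_continuous_add[OF tmod_field] tmod_continuous_scale[OF tmod_field] cG cG0) simp
  define W where "W = {z \<in> topspace (prod_topology ?P ?I).
      G (Node (fst z) (fst z) (\<psi> (snd z))) + (-1) * G (Node p0 p0 (\<psi> (snd z))) \<in> {y. av (y - 0) < e / 2}}"
  have W: "openin (prod_topology ?P ?I) W"
    unfolding W_def by (rule openin_continuous_map_preimage[OF cd openin_ball])
  have sub: "{p0} \<times> {0..1} \<subseteq> W" using p0 e by (auto simp: W_def)
  have cp: "compactin ?P {p0}" using p0 by simp
  have ci: "compactin ?I {0..1}" by (simp add: compactin_subtopology)
  obtain N V where N: "openin ?P N" "openin ?I V" "{p0} \<subseteq> N" "{0..1} \<subseteq> V" "N \<times> V \<subseteq> W"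
    by (rule Wallace_theorem_prod_topology[OF cp ci W sub]) blast
  have "av (unit_integral G p - unit_integral G p0) < e" if p: "p \<in> N" for p
  proof -
    have pl: "p \<in> lvl UNIV m" using openin_subset[OF N(1)] p by auto
    have i1: "(\<lambda>s. \<phi> (G (Node p p (\<psi> s)))) integrable_on {0..1}"
      and i0: "(\<lambda>s. \<phi> (G (Node p0 p0 (\<psi> s)))) integrable_on {0..1}"
      using unit_integral_integrand_continuous[OF G] pl p0 by (auto intro!: integrable_continuous_real)
    have "\<phi> (unit_integral G p - unit_integral G p0) = integral {0..1} (\<lambda>s. \<phi> (G (Node p p (\<psi> s))) - \<phi> (G (Node p0 p0 (\<psi> s))))"
      using i1 i0 by (simp add: phi_diff unit_integral_def integral_diff)
    also have "norm \<dots> \<le> integral {0..1} (\<lambda>s::real. e / 2)"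
    proof (rule integral_norm_bound_integral)
      show "(\<lambda>s. \<phi> (G (Node p p (\<psi> s))) - \<phi> (G (Node p0 p0 (\<psi> s)))) integrable_on {0..1}"
        using i1 i0 by (rule integrable_diff)
      fix s :: real assume "s \<in> {0..1}"
      then have "(p, s) \<in> W" using N p by blast
      then have "av (G (Node p p (\<psi> s)) - G (Node p0 p0 (\<psi> s))) < e / 2" by (simp add: W_def)
      then show "norm (\<phi> (G (Node p p (\<psi> s))) - \<phi> (G (Node p0 p0 (\<psi> s)))) \<le> e / 2"
        by (simp add: av_phi phi_diff)
    qed (rule integrable_const_ivl)
    finally show ?thesis using e by (simp add: av_phi)
  qed
  then show "\<exists>W. openin ?P W \<and> p0 \<in> W \<and> (\<forall>y\<in>W. av (unit_integral G y - unit_integral G p0) < e)"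
    using N by blast
qed

lemma ext_field: "ext (*) UNIV m (lvl (UNIV :: 'k set) m) = lvl UNIV (Suc m)"
  using ext_lvl[OF tmod_field, of m] by simp

lemma lin_zero: "lin (*) (ktop av) (*) (ktop av) m (\<lambda>_. 0)"
  by (simp add: lin_def)

text \<open>Linearity of the integral lets difference quotients pass under it: the parameter
  \<open>s\<close> stays fixed, so the increment of the argument of \<open>G\<close> has third entry
  \<open>0\<close>.\<close>

lemma unit_integral_ck:
  assumes "ck_field (Suc m) k (lvl UNIV (Suc m)) G"
  shows "ck_field m k (lvl UNIV m) (unit_integral G)"
  using assms
proof (induction k arbitrary: m G)
  case 0
  then show ?case using unit_integral_continuous[of m G] by (simp add: lvl_whole)
next
  case (Suc k)
  have cG: "continuous_map (ptop av (ktop av) (Suc m)) (ktop av) G"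
    using ck_continuous[OF Suc.prems] by (simp add: lvl_whole)
  obtain G1 where G1: "ck_field (Suc (Suc m)) k (lvl UNIV (Suc (Suc m))) G1"
    "\<And>x v t. Node x v t \<in> lvl UNIV (Suc (Suc m)) \<Longrightarrow> G (x + ptscale (*) t v) = G x + t * G1 (Node x v t)"
    by (rule ck_SucE[OF Suc.prems, unfolded topspace_ktop ext_field]) blast
  \<comment> \<open>\<open>L\<close> sends \<open>Node (Node p q t) _ s\<close> to
    \<open>Node (Node p p s) (Node q q 0) t\<close>. The parameter \<open>s\<close> thus sits in the
    outermost third entry of the argument, where \<open>unit_integral\<close> integrates over
    it.\<close>
  define L :: "('k, 'k) pt \<Rightarrow> ('k, 'k) pt" where
    "L = (\<lambda>P. Node (Node (pfst (pfst P)) (pfst (pfst P)) (ptrd P)) (Node (psnd (pfst P)) (psnd (pfst P)) 0) (ptrd (pfst P)))"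
  have L: "lin (*) (ktop av) (ptscale (*)) (ptop av (ktop av) (Suc (Suc m))) (Suc (Suc m)) L"
    unfolding L_def by (intro lin_Node lin_zero lin_ptrd lin_comp[OF lin_pfst lin_pfst] lin_comp[OF lin_pfst lin_psnd] lin_comp[OF lin_pfst lin_ptrd])
  have Ll: "L ` lvl UNIV (Suc (Suc m)) \<subseteq> lvl UNIV (Suc (Suc m))"
    using lin_value[OF L] by auto
  have G1L: "ck_field (Suc (Suc m)) k (lvl UNIV (Suc (Suc m))) (\<lambda>P. G1 (L P))"
    by (rule ck_comp_lin[OF G1(1) L _ Ll]) simp
  then have cG1: "continuous_map (ptop av (ktop av) (Suc (Suc m))) (ktop av) (\<lambda>P. G1 (L P))"
    using ck_continuous[OF G1L] by (simp add: lvl_whole)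
  have 0: "ck_field m 0 (lvl UNIV m) (unit_integral G)" using unit_integral_continuous[OF cG] by (simp add: lvl_whole)
  have 1: "ck_field (Suc m) k (ext (*) (topspace (ktop av)) m (lvl UNIV m)) (unit_integral (\<lambda>P. G1 (L P)))"
    unfolding topspace_ktop ext_field by (rule Suc.IH[OF G1L])
  show ?case
  proof (rule ck_SucI[OF 0 1])
    fix p q t assume "Node p q t \<in> ext (*) (topspace (ktop av)) m (lvl UNIV m)"
    then have pq: "p \<in> lvl UNIV m" "q \<in> lvl UNIV m" by (auto simp: ext_iff)
    then have pqs: "p + ptscale (*) t q \<in> lvl UNIV m" by (simp add: lvl_field_add)
    have eq: "\<phi> (G (Node (p + ptscale (*) t q) (p + ptscale (*) t q) (\<psi> s))) =
        \<phi> (G (Node p p (\<psi> s))) + \<phi> t * \<phi> (G1 (L (Node (Node p q t) (Node p q t) (\<psi> s))))" for s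
      using G1(2)[of "Node p p (\<psi> s)" "Node q q 0" t] pq by (simp add: L_def phi_add phi_mult)
    have i1: "(\<lambda>s. \<phi> (G (Node p p (\<psi> s)))) integrable_on {0..1}"
      using unit_integral_integrand_continuous[OF cG] pq by (auto intro!: integrable_continuous_real)
    have i2: "(\<lambda>s. \<phi> (G1 (L (Node (Node p q t) (Node p q t) (\<psi> s))))) integrable_on {0..1}"
      using unit_integral_integrand_continuous[OF cG1] pq by (auto intro!: integrable_continuous_real)
    show "unit_integral G (p + ptscale (*) t q) = unit_integral G p + t * unit_integral (\<lambda>P. G1 (L P)) (Node p q t)"
      unfolding unit_integral_def eq
      by (subst integral_add[OF i1 integrable_on_mult_right[OF i2]]) (simp add: psi_add psi_mult)
  qed
qed

text \<open>All derivatives are treated at once, because the difference quotient of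
  \<open>F n\<close> is \<open>v\<close> times an average of \<open>F (Suc n)\<close> over a
  segment: class \<open>k + 1\<close> of one rests on class \<open>k\<close> of the next.\<close>

lemma derivatives_ck:
  fixes F :: "nat \<Rightarrow> real \<Rightarrow> real"
  assumes F: "\<And>n x. (F n has_real_derivative F (Suc n) x) (at x)"
  shows "ck_field 0 k (lvl UNIV 0) (\<lambda>p. \<psi> (F n (\<phi> (unBase p))))"
proof (induction k arbitrary: n)
  case 0
  have "continuous_on UNIV (F n)" using F by (meson DERIV_isCont continuous_at_imp_continuous_on)
  then have "continuous_map euclideanreal euclideanreal (F n)" by simp
  then have "continuous_map (ptop av (ktop av) 0) (ktop av) (\<lambda>p. \<psi> (F n (\<phi> (unBase p))))"
    using continuous_map_compose[OF continuous_map_compose[OF continuous_map_compose[OF continuous_unBase continuous_phi]] continuous_psi]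
    by (simp add: o_def)
  then show ?case by (simp add: lvl_whole)
next
  case (Suc k)
  \<comment> \<open>At \<open>Node (Node x v t) _ s\<close> this is \<open>F (Suc n)\<close> at
    \<open>x + (s * t) v\<close>, transported to the field.\<close>
  define H where "H = (\<lambda>P. (\<lambda>p. \<psi> (F (Suc n) (\<phi> (unBase p))))
     (pfst (pfst P) + ptscale (*) (ptrd P * ptrd (pfst P)) (psnd (pfst P))))"
  have l: "ck_map (*) (ktop av) (ptscale (*)) (ptop av (ktop av) 0) (Suc (Suc 0)) k (lvl UNIV (Suc (Suc 0)))
      (\<lambda>P. pfst (pfst P) + ptscale (*) (ptrd P * ptrd (pfst P)) (psnd (pfst P)))"
    by (intro ck_add ck_scale ck_mult tmod_pt tmod_field ck_lin[OF lin_ptrd] ck_lin[OF lin_comp[OF lin_pfst lin_pfst]]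
        ck_lin[OF lin_comp[OF lin_pfst lin_psnd]] ck_lin[OF lin_comp[OF lin_pfst lin_ptrd]]) simp_all
  have H: "ck_field (Suc (Suc 0)) k (lvl UNIV (Suc (Suc 0))) H"
    unfolding H_def
  proof (rule ck_chain[OF Suc.IH l], rule image_subsetI)
    fix P :: "('k, 'k) pt" assume "P \<in> lvl UNIV (Suc (Suc 0))"
    then show "pfst (pfst P) + ptscale (*) (ptrd P * ptrd (pfst P)) (psnd (pfst P)) \<in> lvl UNIV 0"
      using ck_value[OF l] by simp
  qed
  have unit_integral: "ck_field (Suc 0) k (lvl UNIV (Suc 0)) (\<lambda>p. unBase (psnd p) * unit_integral H p)"
    by (intro ck_mult unit_integral_ck H ck_lin[OF lin_comp[OF lin_psnd lin_unBase]]) simp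
  have cH: "continuous_map (ptop av (ktop av) (Suc (Suc 0))) (ktop av) H"
    using ck_continuous[OF H] by (simp add: lvl_whole)
  have 0: "ck_field 0 0 (lvl UNIV 0) (\<lambda>p. \<psi> (F n (\<phi> (unBase p))))" using Suc.IH ck_0 by blast
  have 1: "ck_field (Suc 0) k (ext (*) (topspace (ktop av)) 0 (lvl UNIV 0)) (\<lambda>p. unBase (psnd p) * unit_integral H p)"
    using unit_integral by (simp add: ext_field)
  show ?case
  proof (rule ck_SucI[OF 0 1])
    fix x v :: "('k, 'k) pt" and t assume "Node x v t \<in> ext (*) (topspace (ktop av)) 0 (lvl UNIV 0)"
    then obtain x' v' where xv: "x = Base x'" "v = Base v'" by (auto simp: ext_iff lvl_0_iff)
    define X V where "X = \<phi> x'" and "V = \<phi> t * \<phi> v'"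
    have "((\<lambda>s. V * F (Suc n) (X + s * V)) has_integral (F n (X + 1 * V) - F n (X + 0 * V))) {0..1}"
    proof (rule fundamental_theorem_of_calculus)
      fix s :: real assume "s \<in> {0..1}"
      have "((\<lambda>s. F n (X + s * V)) has_real_derivative F (Suc n) (X + s * V) * V) (at s)"
        by (rule DERIV_chain2[OF F]) (auto intro!: derivative_eq_intros)
      then show "((\<lambda>s. F n (X + s * V)) has_vector_derivative V * F (Suc n) (X + s * V)) (at s within {0..1})"
        by (simp add: has_real_derivative_iff_has_vector_derivative mult.commute has_vector_derivative_at_within)
    qed simp
    from integral_unique[OF this]
    have FTC: "F n (X + V) = F n X + V * integral {0..1} (\<lambda>s. F (Suc n) (X + s * V))" by simp
    have "unit_integral H (Node x v t) = \<psi> (integral {0..1} (\<lambda>s. F (Suc n) (X + s * V)))"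
      by (simp add: unit_integral_def H_def xv X_def V_def phi_add phi_mult mult_ac)
    then show "\<psi> (F n (\<phi> (unBase (x + ptscale (*) t v)))) =
        \<psi> (F n (\<phi> (unBase x))) + t * (unBase (psnd (Node x v t)) * unit_integral H (Node x v t))"
      using FTC by (simp add: xv phi_add phi_mult X_def[symmetric] V_def[symmetric] psi_add psi_mult)
        (simp add: V_def psi_mult mult_ac)
  qed
qed

lemma bump_exists:
  assumes e: "e > 0"
  shows "\<exists>h. bump a e h"
proof -
  define E :: "('k, 'k) pt \<Rightarrow> 'k" where "E = (\<lambda>p. \<psi> (flat 0 (\<phi> (unBase p))))"
  have E: "ck_field 0 k (lvl UNIV 0) E" for k unfolding E_def by (rule derivatives_ck[where F = flat, OF flat_deriv])
  define c where "c = inverse (\<psi> e * \<psi> e)"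
  \<comment> \<open>The squared distance is used because the absolute value is not smooth at
    \<open>0\<close>. The image of \<open>u\<close> under \<open>\<phi>\<close> is at most
    \<open>0\<close> from distance \<open>e\<close> on, and at least \<open>1\<close> up to distance
    \<open>e / 2\<close>.\<close>
  define u :: "('k, 'k) pt \<Rightarrow> 'k" where
    "u = (\<lambda>p. \<psi> 2 + (- \<psi> 2 * c) * ((unBase p + (- a)) * (unBase p + (- a))))"
  have u: "ck_field 0 k (lvl UNIV 0) u" for k
    unfolding u_def by (intro ck_add ck_mult ck_const tmod_field ck_lin[OF lin_unBase]) simp_all
  have w: "ck_field 0 k (lvl UNIV 0) (\<lambda>p. 1 + (-1) * u p)" for k
    by (rule ck_add[OF tmod_field ck_const[OF tmod_field] ck_mult[OF ck_const[OF tmod_field] u]]) simp_all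
  define A B where "A = (\<lambda>p. E (Base (u p)))" and "B = (\<lambda>p. E (Base (1 + (-1) * u p)))"
  have A: "ck_field 0 k (lvl UNIV 0) A" and B: "ck_field 0 k (lvl UNIV 0) B" for k
    unfolding A_def B_def by ((rule ck_chain[OF E ck_Base[OF u]], force), (rule ck_chain[OF E ck_Base[OF w]], force))
  have phiA: "\<phi> (A p) = (if \<phi> (u p) > 0 then exp (- (1 / \<phi> (u p))) else 0)"
    and phiB: "\<phi> (B p) = (if \<phi> (u p) < 1 then exp (- (1 / (1 - \<phi> (u p)))) else 0)" for p
    by (simp_all add: A_def B_def E_def flat_def phi_diff phi_1)
  have pos: "\<phi> (A p) + \<phi> (B p) > 0" for p by (auto simp: phiA phiB add_pos_pos)
  then have nz: "A p + B p \<noteq> 0" for p by (metis phi_0 phi_add less_irrefl)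
  \<comment> \<open>The usual smooth step: \<open>A\<close> vanishes where \<open>u \<le> 0\<close>
    and \<open>B\<close> where \<open>u \<ge> 1\<close> (as real numbers). They never vanish
    together.\<close>
  define h where "h = (\<lambda>p. A p * inverse (A p + B p))"
  have h: "ck_field 0 k (lvl UNIV 0) h" for k
    unfolding h_def by (intro ck_mult ck_inverse ck_add tmod_field A B nz)
  have phi_h: "\<phi> (h p) = \<phi> (A p) / (\<phi> (A p) + \<phi> (B p))" for p
    by (simp add: h_def phi_mult phi_inverse phi_add divide_inverse)
  have phi_u: "\<phi> (u (Base t)) = 2 - 2 * (av (t - a))\<^sup>2 / e\<^sup>2" for t
    by (simp add: u_def c_def phi_add phi_mult phi_minus phi_inverse av_phi phi_diff power2_eq_square divide_inverse)
  have "h (Base t) = 0" if "e \<le> av (t - a)" for t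
  proof -
    have "e\<^sup>2 \<le> (av (t - a))\<^sup>2" using that e by (intro power_mono) auto
    then have "\<phi> (u (Base t)) \<le> 0" using e by (simp add: phi_u field_simps)
    then have "\<phi> (A (Base t)) = 0" by (simp add: phiA)
    then show ?thesis by (metis h_def mult_zero_left phi_0 phi_eq)
  qed
  moreover have "h (Base t) = 1" if "av (t - a) < e / 2" for t
  proof -
    have "(av (t - a))\<^sup>2 \<le> (e / 2)\<^sup>2" using that by (intro power_mono) auto
    then have "2 * (av (t - a))\<^sup>2 / e\<^sup>2 \<le> 2 * (e / 2)\<^sup>2 / e\<^sup>2"
      by (intro divide_right_mono mult_left_mono) auto
    also have "\<dots> \<le> 1" using e by (simp add: power2_eq_square)
    finally have "1 \<le> \<phi> (u (Base t))" by (simp add: phi_u)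
    then have "\<phi> (B (Base t)) = 0" by (simp add: phiB)
    then have "B (Base t) = 0" by (metis phi_0 phi_eq)
    then show ?thesis using nz[of "Base t"] by (simp add: h_def)
  qed
  moreover have "av (h (Base t)) \<le> 1" for t
    using pos[of "Base t"] by (simp add: av_phi phi_h) (simp add: phiA phiB field_simps)
  moreover have "\<exists>M. \<forall>p\<in>lvl UNIV j. pt_norm p \<le> R \<longrightarrow> av ((dquot_field ^^ j) h p) \<le> M" for j R
    using ck_dquot_iter[OF tvs_field tmod_field, of h j 0] h by (intro bounded_on_ball[where k = 0]) simp
  moreover have "e / 2 > 0" using e by simp
  ultimately show ?thesis unfolding bump_def using h by blast
qed

end

section \<open>Curves through fast sequences\<close>

lemma prod_topology_nhd:
  assumes "openin (prod_topology X Y) W" "(a, b) \<in> W"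
  obtains A B where "openin X A" "openin Y B" "a \<in> A" "b \<in> B" "A \<times> B \<subseteq> W"
  using assms(1)[unfolded openin_prod_topology_alt, rule_format, OF assms(2)] by (elim exE conjE)

context valued
begin

text \<open>Continuity of addition allows halving a neighbourhood; intersecting at each step with
  the next member of a countable base at \<open>0\<close> makes the sequence itself a base. It takes
  the place of a norm in the estimates.\<close>

lemma tvs_zero_nbhds:
  assumes T: "tvs av sc UNIV T" and "first_countable T"
  shows "\<exists>V :: nat \<Rightarrow> 'c::ab_group_add set. (\<forall>i. openin T (V i) \<and> 0 \<in> V i \<and> (\<forall>a\<in>V (Suc i). \<forall>b\<in>V (Suc i). a + b \<in> V i))
     \<and> (\<forall>W. openin T W \<and> 0 \<in> W \<longrightarrow> (\<exists>i. V i \<subseteq> W))"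
proof -
  have top: "topspace T = UNIV" using T by (rule tvs_topspace)
  obtain \<B> where \<B>: "countable \<B>" "\<forall>V\<in>\<B>. openin T V" "\<forall>W. openin T W \<and> 0 \<in> W \<longrightarrow> (\<exists>V\<in>\<B>. 0 \<in> V \<and> V \<subseteq> W)"
    using assms(2) top unfolding first_countable_def by (metis UNIV_I)
  define \<C> where "\<C> = {V \<in> \<B>. 0 \<in> V}"
  have "\<C> \<noteq> {}"
  proof -
    have "openin T UNIV" using openin_topspace[of T] top by simp
    then show ?thesis using \<B>(3) by (auto simp: \<C>_def)
  qed
  moreover have "countable \<C>" using \<B>(1) by (simp add: \<C>_def)
  ultimately obtain B :: "nat \<Rightarrow> 'c set" where B: "range B = \<C>" by (metis range_from_nat_into)
  have Bo: "openin T (B n)" "0 \<in> B n" for n using B \<B>(2) by (auto simp: \<C>_def)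
  have half: "\<exists>Y. openin T Y \<and> 0 \<in> Y \<and> (\<forall>a\<in>Y. \<forall>b\<in>Y. a + b \<in> X)" if X: "openin T X" "0 \<in> X" for X
  proof -
    have c: "continuous_map (prod_topology T T) T (\<lambda>(x, y). x + y)" using T by (simp add: tvs_def)
    obtain W where W: "openin (prod_topology T T) W" "(0, 0) \<in> W" "\<And>z. z \<in> W \<Longrightarrow> (case z of (x, y) \<Rightarrow> x + y) \<in> X"
      by (rule continuous_map_nhd[OF c _ X(1), of "(0, 0)"]) (use X top in auto)
    obtain P Q where "openin T P" "openin T Q" "0 \<in> P" "0 \<in> Q" "P \<times> Q \<subseteq> W"
      by (rule prod_topology_nhd[OF W(1,2)])
    then show ?thesis using W(3) by (intro exI[of _ "P \<inter> Q"]) (auto simp: openin_Int)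
  qed
  obtain V where V: "V 0 = B 0 \<and> openin T (V 0) \<and> 0 \<in> V 0"
    "\<And>n. (openin T (V (Suc n)) \<and> 0 \<in> V (Suc n)) \<and> (\<forall>a\<in>V (Suc n). \<forall>b\<in>V (Suc n). a + b \<in> V n \<inter> B (Suc n))"
  proof -
    define step where "step n X = (SOME Y. openin T Y \<and> 0 \<in> Y \<and> (\<forall>a\<in>Y. \<forall>b\<in>Y. a + b \<in> X \<inter> B (Suc n)))" for n X
    have step: "openin T (step n X) \<and> 0 \<in> step n X \<and> (\<forall>a\<in>step n X. \<forall>b\<in>step n X. a + b \<in> X \<inter> B (Suc n))"
      if "openin T X" "0 \<in> X" for n X
      unfolding step_def by (rule someI_ex, rule half) (use that Bo in \<open>auto simp: openin_Int\<close>)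
    define V where "V = rec_nat (B 0) step"
    have V0: "V 0 = B 0" and VS: "V (Suc n) = step n (V n)" for n by (simp_all add: V_def)
    have Vo: "openin T (V n) \<and> 0 \<in> V n" for n
      by (induction n) (use V0 VS Bo step in auto)
    show ?thesis
    proof (rule that[of V])
      show "V 0 = B 0 \<and> openin T (V 0) \<and> 0 \<in> V 0" using V0 Vo by blast
      show "(openin T (V (Suc n)) \<and> 0 \<in> V (Suc n)) \<and> (\<forall>a\<in>V (Suc n). \<forall>b\<in>V (Suc n). a + b \<in> V n \<inter> B (Suc n))" for n
        unfolding VS[of n] using step[of "V n" n] Vo[of n] by blast
    qed
  qed
  have VB: "V n \<subseteq> B n" for n
  proof (cases n)
    case (Suc k)
    have "a \<in> B n" if "a \<in> V n" for a using V(2)[of k] that Suc by (metis IntD2 add_0_right)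
    then show ?thesis by blast
  qed (use V in auto)
  have Vo: "openin T (V i)" "0 \<in> V i" for i using V by (cases i; simp)+
  show ?thesis
  proof (intro exI[of _ V] conjI allI impI)
    fix W assume "openin T W \<and> 0 \<in> W"
    then obtain Y where "Y \<in> \<C>" "Y \<subseteq> W" using \<B>(3) by (auto simp: \<C>_def)
    then show "\<exists>i. V i \<subseteq> W" using B VB by (metis imageE order_trans)
  qed (use Vo V in auto)
qed

text \<open>The first term and, by induction, the rest both lie in \<open>V (Suc n)\<close>, so the
  sum lies in \<open>V n\<close> however many terms it has.\<close>

lemma tail_sum:
  fixes z :: "nat \<Rightarrow> 'c::ab_group_add"
  assumes V: "\<And>i. 0 \<in> V i" "\<And>i a b. a \<in> V (Suc i) \<Longrightarrow> b \<in> V (Suc i) \<Longrightarrow> a + b \<in> V i"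
    and z: "\<And>i. n < i \<Longrightarrow> z i \<in> V i"
  shows "(\<Sum>i\<in>{n<..n + m}. z i) \<in> V n"
  using z
proof (induction m arbitrary: n)
  case (Suc m)
  have "{n<..n + Suc m} = insert (Suc n) {Suc n<..Suc n + m}" by auto
  then have "(\<Sum>i\<in>{n<..n + Suc m}. z i) = z (Suc n) + (\<Sum>i\<in>{Suc n<..Suc n + m}. z i)" by simp
  moreover have "(\<Sum>i\<in>{Suc n<..Suc n + m}. z i) \<in> V (Suc n)" using Suc.IH[of "Suc n"] Suc.prems by simp
  ultimately show ?case using V(2) Suc.prems by simp
qed (simp add: V)

lemma tvs_scale_sum:
  assumes "tvs av sc UNIV T"
  shows "sc t (\<Sum>i\<in>A. z i) = (\<Sum>i\<in>A. sc t (z i))"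
proof (induction A rule: infinite_finite_induct)
  have 0: "sc t 0 = 0"
    using tmodD(6)[OF tmod_tvs[OF assms], of 0 0 t] tvs_topspace[OF assms] by simp
  {
    case (infinite A)
    then show ?case using 0 by simp
  next
    case empty
    then show ?case using 0 by simp
  }
qed (use tmodD(6)[OF tmod_tvs[OF assms]] tvs_topspace[OF assms] in simp)

lemma openin_pfst_preimage: "openin (ptop av T m) A \<Longrightarrow> openin (ptop av T (Suc m)) {p \<in> lvl (topspace T) (Suc m). pfst p \<in> A}"
  using openin_continuous_map_preimage[OF continuous_pfst] by fastforce

lemma openin_psnd_preimage: "openin (ptop av T m) A \<Longrightarrow> openin (ptop av T (Suc m)) {p \<in> lvl (topspace T) (Suc m). psnd p \<in> A}"
  using openin_continuous_map_preimage[OF continuous_psnd] by fastforce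

lemma openin_ptrd_preimage: "openin (ktop av) A \<Longrightarrow> openin (ptop av T (Suc m)) {p \<in> lvl (topspace T) (Suc m). ptrd p \<in> A}"
  using openin_continuous_map_preimage[OF continuous_ptrd] by fastforce

lemma openin_Base_image:
  fixes T :: "'a topology"
  assumes "openin T W"
  shows "openin (ptop av T 0) (Base ` W)"
proof -
  have "(Base ` W :: ('a, 'k) pt set) = {p \<in> lvl (topspace T) 0. unBase p \<in> W}"
    using openin_subset[OF assms] by (auto simp: lvl_0_iff)
  then show ?thesis using openin_continuous_map_preimage[OF continuous_unBase assms] by simp
qed

lemma openin_pn_less: "openin (ptop av (ktop av) m) {p \<in> lvl UNIV m. pt_norm p < R}"
proof (induction m)
  case 0
  have "{p \<in> lvl UNIV 0. pt_norm p < R} = {p \<in> lvl UNIV 0. unBase p \<in> {y. av (y - 0) < R}}" by (auto simp: lvl_0_iff)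
  then show ?case using openin_continuous_map_preimage[OF continuous_unBase openin_ball[of 0 R]] by simp
next
  case (Suc m)
  let ?S = "lvl (UNIV :: 'k set) (Suc m)"
  have "{p \<in> ?S. pt_norm p < R} = {p \<in> ?S. pfst p \<in> {p \<in> lvl UNIV m. pt_norm p < R}} \<inter> {p \<in> ?S. psnd p \<in> {p \<in> lvl UNIV m. pt_norm p < R}}
     \<inter> {p \<in> ?S. ptrd p \<in> {y. av (y - 0) < R}}"
    by (auto elim!: lvl_SucE)
  then show ?case
    using openin_pfst_preimage[OF Suc] openin_psnd_preimage[OF Suc] openin_ptrd_preimage[OF openin_ball[of 0 R], of "ktop av" m]
    by (simp only: topspace_ktop openin_Int)
qed

end

text \<open>\<open>H i\<close> is a bump at \<open>\<tau> i\<close> that vanishes on the open set \<open>Q i\<close>; \<open>M i\<close> bounds its first \<open>i\<close>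
  iterated difference quotients on the ball of radius \<open>i\<close>.\<close>
locale bump_family = valued av for av :: "'k::field \<Rightarrow> real" +
  fixes \<tau> :: "nat \<Rightarrow> 'k" and H :: "nat \<Rightarrow> ('k, 'k) pt \<Rightarrow> 'k" and Q :: "nat \<Rightarrow> 'k set" and M :: "nat \<Rightarrow> real"
  assumes tau_lim: "e > 0 \<Longrightarrow> \<exists>n. \<forall>i\<ge>n. av (\<tau> i) < e"
    and H_smooth: "ck_field 0 k (lvl UNIV 0) (H i)"
    and H_tau: "H i (Base (\<tau> i)) = 1"
    and H_zero: "t \<in> Q i \<Longrightarrow> H i (Base t) = 0"
    and Q_open: "openin (ktop av) (Q i)"
    and Q_fin: "finite {i. t \<notin> Q i}"
    and Q_tau: "i \<noteq> j \<Longrightarrow> \<tau> j \<in> Q i"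
    and Q_0: "0 \<in> Q i"
    and M_bound: "j \<le> i \<Longrightarrow> p \<in> lvl UNIV j \<Longrightarrow> pt_norm p \<le> real i \<Longrightarrow> av ((dquot_field ^^ j) (H i) p) \<le> M i"
begin

definition h :: "nat \<Rightarrow> nat \<Rightarrow> ('k, 'k) pt \<Rightarrow> 'k" where
  "h j i = (dquot_field ^^ j) (H i)"

lemma h_continuous: "continuous_map (ptop av (ktop av) j) (ktop av) (h j i)"
proof -
  have "ck_field j 0 (lvl UNIV j) (h j i)"
    using ck_dquot_iter[OF tvs_field tmod_field, of "H i" j 0] H_smooth[of _ i] by (simp add: h_def)
  from ck_continuous[OF this] show ?thesis by (simp only: lvl_whole)
qed

lemma h_quotient:
  assumes "p \<in> lvl UNIV j" "q \<in> lvl UNIV j"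
  shows "h j i (p + ptscale (*) t q) = h j i p + t * h (Suc j) i (Node p q t)"
  using dquot_quotient[OF tvs_field tmod_field, of "lvl UNIV j" j p q t "h j i"] assms
  by (simp add: h_def ext_iff lvl_field_add)

lemma openin_ext_iter:
  "openin (ptop av (ktop av) j) (ext_iter (*) UNIV 0 (Base ` Q i) j)"
proof (induction j)
  case 0
  show ?case using openin_Base_image[OF Q_open[of i]] by simp
next
  case (Suc j)
  show ?case using openin_ext[OF tmod_field Suc] by simp
qed

text \<open>Over an open set where a function vanishes its difference quotients vanish too, also at
  \<open>t = 0\<close>, where they are limits; openness of \<open>Q i\<close> enters through
  \<open>dquot_unique\<close>.\<close>

lemma h_zero: "p \<in> ext_iter (*) UNIV 0 (Base ` Q i) j \<Longrightarrow> h j i p = 0"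
proof (induction j arbitrary: p)
  case 0
  then show ?case using H_zero by (auto simp: h_def)
next
  case (Suc j)
  let ?U = "ext_iter (*) UNIV 0 (Base ` Q i) j"
  have sub: "ext (*) UNIV j ?U \<subseteq> lvl UNIV (Suc j)"
    using openin_subset[OF openin_ext_iter[of "Suc j" i]] by simp
  have "dquot_field (h j i) p = (\<lambda>_. 0) p"
  proof (rule dquot_unique[OF tvs_field tmod_field openin_ext_iter])
    show "ck_field (Suc j) 0 (ext (*) (topspace (ktop av)) j ?U) (\<lambda>_. 0)" using sub by simp
    fix x v t assume "Node x v t \<in> ext (*) (topspace (ktop av)) j ?U"
    then show "h j i (x + ptscale (*) t v) = h j i x + t * 0" using Suc.IH by (simp add: ext_iff)
  qed (use Suc.prems in simp)
  then show ?case by (simp add: h_def)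
qed

text \<open>A tree outside the extended set has an end point outside the set one level lower, so its
  exceptional indices are among those of two lower trees.\<close>

lemma finite_outside_ext_iter: "p \<in> lvl UNIV j \<Longrightarrow> finite {i. p \<notin> ext_iter (*) UNIV 0 (Base ` Q i) j}"
proof (induction j arbitrary: p)
  case 0
  then show ?case using Q_fin by (auto simp: lvl_0_iff inj_image_mem_iff[OF inj_Base])
next
  case (Suc j)
  then obtain x v t where p: "p = Node x v t" "x \<in> lvl UNIV j" "v \<in> lvl UNIV j" by (elim lvl_SucE)
  have "{i. p \<notin> ext_iter (*) UNIV 0 (Base ` Q i) (Suc j)} \<subseteq>
      {i. x \<notin> ext_iter (*) UNIV 0 (Base ` Q i) j} \<union> {i. x + ptscale (*) t v \<notin> ext_iter (*) UNIV 0 (Base ` Q i) j}"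
    using p by (auto simp: ext_iff)
  then show ?case using Suc.IH p lvl_field_add by (meson finite_UnI finite_subset)
qed

lemma finite_support: "p \<in> lvl UNIV j \<Longrightarrow> finite {i. h j i p \<noteq> 0}"
  using h_zero by (intro finite_subset[OF _ finite_outside_ext_iter[of p j]]) auto

definition series :: "('k \<Rightarrow> 'c \<Rightarrow> 'c) \<Rightarrow> (nat \<Rightarrow> 'c) \<Rightarrow> nat \<Rightarrow> ('k, 'k) pt \<Rightarrow> 'c::ab_group_add" where
  "series sc y j p = (\<Sum>i | h j i p \<noteq> 0. sc (h j i p) (y i))"

lemma series_eq:
  assumes "tvs av sc UNIV T" "finite A" "{i. h j i p \<noteq> 0} \<subseteq> A"
  shows "series sc y j p = (\<Sum>i\<in>A. sc (h j i p) (y i))"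
  unfolding series_def using assms(2,3)
  by (intro sum.mono_neutral_left) (auto simp: tvs_scale_zero[OF assms(1)])

lemma series_quotient:
  assumes T: "tvs av sc UNIV T" and pq: "p \<in> lvl UNIV j" "q \<in> lvl UNIV j"
  shows "series sc y j (p + ptscale (*) t q) = series sc y j p + sc t (series sc y (Suc j) (Node p q t))"
proof -
  note TD = tmodD[OF tmod_tvs[OF T], unfolded tvs_topspace[OF T], simplified]
  define A where "A = {i. h j i p \<noteq> 0} \<union> {i. h j i (p + ptscale (*) t q) \<noteq> 0} \<union> {i. h (Suc j) i (Node p q t) \<noteq> 0}"
  have A: "finite A" unfolding A_def
    using pq by (intro finite_UnI finite_support) (simp_all add: lvl_field_add)
  have "series sc y j (p + ptscale (*) t q) = (\<Sum>i\<in>A. sc (h j i (p + ptscale (*) t q)) (y i))"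
    by (rule series_eq[OF T A]) (auto simp: A_def)
  also have "\<dots> = (\<Sum>i\<in>A. sc (h j i p) (y i) + sc t (sc (h (Suc j) i (Node p q t)) (y i)))"
    by (simp add: h_quotient[OF pq] TD)
  also have "\<dots> = (\<Sum>i\<in>A. sc (h j i p) (y i)) + sc t (\<Sum>i\<in>A. sc (h (Suc j) i (Node p q t)) (y i))"
    by (simp add: sum.distrib tvs_scale_sum[OF T])
  also have "(\<Sum>i\<in>A. sc (h j i p) (y i)) = series sc y j p"
    by (rule series_eq[OF T A, symmetric]) (auto simp: A_def)
  also have "(\<Sum>i\<in>A. sc (h (Suc j) i (Node p q t)) (y i)) = series sc y (Suc j) (Node p q t)"
    by (rule series_eq[OF T A, symmetric]) (auto simp: A_def)
  finally show ?thesis .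
qed

lemma continuous_finite_sum:
  assumes T: "tvs av sc UNIV T" and "finite A"
  shows "continuous_map (ptop av (ktop av) j) T (\<lambda>p. \<Sum>i\<in>A. sc (h j i p) (y i))"
  using assms(2)
proof induction
  case (insert i A)
  then show ?case using tvs_topspace[OF T]
    by (simp add: tmod_continuous_add[OF tmod_tvs[OF T]] tmod_continuous_scale[OF tmod_tvs[OF T] h_continuous])
qed (use tvs_topspace[OF T] in simp)

text \<open>Infinitely many bumps meet every neighbourhood of \<open>0\<close>, so the sum is not
  locally finite there. Continuity comes from a finite partial sum plus a tail that is small for all
  trees near \<open>p0\<close> simultaneously.\<close>

lemma series_continuous:
  assumes T: "tvs av sc UNIV T"
    and V: "\<And>i. openin T (V i)" "\<And>i. 0 \<in> V i" "\<And>i a b. a \<in> V (Suc i) \<Longrightarrow> b \<in> V (Suc i) \<Longrightarrow> a + b \<in> V i"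
      "\<And>W. openin T W \<Longrightarrow> 0 \<in> W \<Longrightarrow> \<exists>i. V i \<subseteq> W"
    and y: "\<And>i a. av a \<le> M i \<Longrightarrow> sc a (y i) \<in> V i"
  shows "continuous_map (ptop av (ktop av) j) T (series sc y j)"
  unfolding continuous_map_at_iff
proof (intro ballI conjI allI impI)
  have top: "topspace T = UNIV" using T by (rule tvs_topspace)
  fix p0 assume "p0 \<in> topspace (ptop av (ktop av) j)"
  then have p0: "p0 \<in> lvl UNIV j" by simp
  show "series sc y j p0 \<in> topspace T" using top by simp
  fix W assume W: "openin T W \<and> series sc y j p0 \<in> W"
  have c: "continuous_map (prod_topology T T) T (\<lambda>(x, y). x + y)" using T by (simp add: tvs_def)
  obtain N where N: "openin (prod_topology T T) N" "(series sc y j p0, 0) \<in> N"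
    "\<And>z. z \<in> N \<Longrightarrow> (case z of (x, y) \<Rightarrow> x + y) \<in> W"
    by (rule continuous_map_nhd[OF c _ conjunct1[OF W], of "(series sc y j p0, 0)"]) (use W top in auto)
  obtain A B where AB: "openin T A" "openin T B" "series sc y j p0 \<in> A" "0 \<in> B" "A \<times> B \<subseteq> N"
    by (rule prod_topology_nhd[OF N(1,2)])
  obtain n0 where n0: "V n0 \<subseteq> B" using V(4) AB by blast
  have Vdec: "V (Suc i) \<subseteq> V i" for i using V(3)[OF _ V(2)[of "Suc i"]] by auto
  obtain n1 where n1: "{i. h j i p0 \<noteq> 0} \<subseteq> {..n1}"
    using finite_support[OF p0] by (meson finite_nat_iff_bounded_le)
  obtain n2 where n2: "pt_norm p0 < real n2" using reals_Archimedean2 by blast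
  \<comment> \<open>Four demands: \<open>V n\<close> lies in \<open>B\<close>, the terms beyond
    \<open>n\<close> vanish at \<open>p0\<close>, the ball of radius \<open>n\<close> contains
    \<open>p0\<close>, and \<open>j \<le> n\<close>, so that \<open>M_bound\<close> covers every
    \<open>i > n\<close>.\<close>
  define n where "n = max (max n0 n1) (max n2 j)"
  have "V n \<subseteq> V n0" by (rule lift_Suc_antimono_le[of V, OF Vdec]) (simp add: n_def)
  then have Vn: "V n \<subseteq> B" using n0 by blast
  let ?F = "\<lambda>p. \<Sum>i\<in>{..n}. sc (h j i p) (y i)"
  have F0: "?F p0 = series sc y j p0"
    using n1 by (intro series_eq[OF T, symmetric]) (auto simp: n_def)
  define Y where "Y = {p \<in> lvl UNIV j. ?F p \<in> A} \<inter> {p \<in> lvl UNIV j. pt_norm p < real n}"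
  have "openin (ptop av (ktop av) j) Y"
    unfolding Y_def
    using openin_continuous_map_preimage[OF continuous_finite_sum[OF T, of "{..n}" j y] AB(1)] openin_pn_less
    by (simp add: openin_Int)
  moreover have "p0 \<in> Y" using p0 F0 AB n2 by (auto simp: Y_def n_def)
  moreover have "series sc y j p \<in> W" if p: "p \<in> Y" for p
  proof -
    have pl: "p \<in> lvl UNIV j" using p by (simp add: Y_def)
    obtain k where k: "{i. h j i p \<noteq> 0} \<subseteq> {..k}"
      using finite_support[OF pl] by (meson finite_nat_iff_bounded_le)
    have "{..n + k} = {..n} \<union> {n<..n + k}" by auto
    then have "series sc y j p = ?F p + (\<Sum>i\<in>{n<..n + k}. sc (h j i p) (y i))"
      using k by (subst series_eq[OF T, where A = "{..n + k}"]) (auto intro!: sum.union_disjoint)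
    moreover have "(\<Sum>i\<in>{n<..n + k}. sc (h j i p) (y i)) \<in> V n"
    proof (rule tail_sum[where V = V, OF V(2,3)])
      fix i assume "n < i"
      then have "av (h j i p) \<le> M i"
        unfolding h_def using p by (intro M_bound) (auto simp: Y_def n_def)
      then show "sc (h j i p) (y i) \<in> V i" by (rule y)
    qed
    ultimately show ?thesis using N(3)[of "(?F p, \<Sum>i\<in>{n<..n + k}. sc (h j i p) (y i))"] AB(5) Vn p by (auto simp: Y_def)
  qed
  ultimately show "\<exists>N. openin (ptop av (ktop av) j) N \<and> p0 \<in> N \<and> (\<forall>p\<in>N. series sc y j p \<in> W)" by blast
qed

text \<open>The scalars with \<open>av a \<le> R\<close> need not form a compact set, so they are
  scaled into a fixed small ball: \<open>a\<close> is \<open>a / l\<close> times \<open>l\<close>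
  with \<open>av l > R / d\<close>.\<close>

lemma scaled_nbhd:
  assumes T: "tvs av sc UNIV T" and V: "openin T V" "0 \<in> V"
  shows "\<exists>N. openin T N \<and> x \<in> N \<and> (\<forall>z\<in>N. \<forall>a. av a \<le> R \<longrightarrow> sc a (z - x) \<in> V)"
proof -
  have top: "topspace T = UNIV" using T by (rule tvs_topspace)
  note TD = tmodD[OF tmod_tvs[OF T], unfolded top, simplified]
  have c: "continuous_map (prod_topology (ktop av) T) T (\<lambda>(a, x). sc a x)" using T by (simp add: tvs_def)
  obtain W where W: "openin (prod_topology (ktop av) T) W" "(0, 0) \<in> W" "\<And>z. z \<in> W \<Longrightarrow> (case z of (a, x) \<Rightarrow> sc a x) \<in> V"
    by (rule continuous_map_nhd[OF c _ V(1), of "(0, 0)"]) (use V top tvs_scale_zero[OF T] in auto)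
  obtain A B where AB: "openin (ktop av) A" "openin T B" "0 \<in> A" "0 \<in> B" "A \<times> B \<subseteq> W"
    by (rule prod_topology_nhd[OF W(1,2)])
  obtain d where d: "d > 0" "\<And>a. av (a - 0) < d \<Longrightarrow> a \<in> A" using AB(1,3) unfolding openin_ktop by blast
  obtain l where l: "l \<noteq> 0" "R / d < av l" using ex_large by blast
  have "continuous_map T T (\<lambda>z. sc l (z + sc (-1) x))"
    by (intro tmod_continuous_scale[OF tmod_tvs[OF T]] tmod_continuous_add[OF tmod_tvs[OF T]]) (simp_all add: top)
  from openin_continuous_map_preimage[OF this AB(2)]
  have o: "openin T {z. sc l (z - x) \<in> B}" by (simp add: top tvs_diff[OF T])
  have "sc a (z - x) \<in> V" if z: "sc l (z - x) \<in> B" and a: "av a \<le> R" for z a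
  proof -
    have "av (a / l) < d" using a l d by (auto simp: av_divide divide_less_eq mult.commute)
    then have "(a / l, sc l (z - x)) \<in> W" using d z AB(5) by auto
    moreover have "sc (a / l) (sc l (z - x)) = sc a (z - x)" using TD(8) l by simp
    ultimately show ?thesis using W(3) by fastforce
  qed
  moreover have "sc l (x - x) \<in> B"
    using AB(4) tvs_scale_sum[OF T, of l "\<lambda>_. 0" "{}"] by simp
  ultimately show ?thesis using o by (intro exI[of _ "{z. sc l (z - x) \<in> B}"]) auto
qed

text \<open>If the \<open>q i\<close> tend to \<open>x\<close> fast enough, the curve is \<open>x + (\<Sum>i. H i * (q i - x))\<close>. At every tree only finitely many
  terms of an iterated difference quotient of this series are nonzero, so that no completeness
  is needed, and the tails are uniformly small on bounded sets.\<close>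
lemma curve_vector:
  assumes T: "tvs av sc UNIV T" and fc: "first_countable T"
  shows "\<exists>N. (\<forall>i. openin T (N i) \<and> x \<in> N i) \<and>
     (\<forall>q. (\<forall>i. q i \<in> N i) \<longrightarrow> (\<exists>c. (\<forall>k. ck_map (*) (ktop av) sc T 0 k (lvl UNIV 0) c)
        \<and> c (Base 0) = x \<and> (\<forall>i. c (Base (\<tau> i)) = q i)))"
proof -
  have top: "topspace T = UNIV" using T by (rule tvs_topspace)
  obtain V where V: "\<And>i. openin T (V i)" "\<And>i. 0 \<in> V i" "\<And>i a b. a \<in> V (Suc i) \<Longrightarrow> b \<in> V (Suc i) \<Longrightarrow> a + b \<in> V i"
      "\<And>W. openin T W \<Longrightarrow> 0 \<in> W \<Longrightarrow> \<exists>i. V i \<subseteq> W"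
    using tvs_zero_nbhds[OF T fc] by metis
  have "\<forall>i. \<exists>N. openin T N \<and> x \<in> N \<and> (\<forall>z\<in>N. \<forall>a. av a \<le> M i \<longrightarrow> sc a (z - x) \<in> V i)"
    using scaled_nbhd[OF T V(1,2)] by blast
  then obtain N where N: "\<forall>i. openin T (N i) \<and> x \<in> N i \<and> (\<forall>z\<in>N i. \<forall>a. av a \<le> M i \<longrightarrow> sc a (z - x) \<in> V i)"
    using choice by metis
  have "\<exists>c. (\<forall>k. ck_map (*) (ktop av) sc T 0 k (lvl UNIV 0) c) \<and> c (Base 0) = x \<and> (\<forall>i. c (Base (\<tau> i)) = q i)"
    if q: "\<forall>i. q i \<in> N i" for q
  proof -
    define y where "y = (\<lambda>i. q i - x)"
    have y: "sc a (y i) \<in> V i" if "av a \<le> M i" for i a using N q that by (auto simp: y_def)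
    have s: "ck_map (*) (ktop av) sc T 0 k (lvl UNIV 0) (series sc y 0)" for k
    proof (rule ck_of_seq[where g = "series sc y"])
      fix j
      show "continuous_map (subtopology (ptop av (ktop av) (0 + j)) (ext_iter (*) (topspace (ktop av)) 0 (lvl UNIV 0) j)) T (series sc y j)"
        using series_continuous[OF T V y, where j = j] by (simp add: continuous_map_from_subtopology)
    next
      fix j x v t assume "Node x v t \<in> ext_iter (*) (topspace (ktop av)) 0 (lvl UNIV 0) (Suc j)"
      then have "x \<in> lvl UNIV j" "v \<in> lvl UNIV j"
        using ext_iter_lvl[OF tmod_field, of 0 "Suc j"] by simp_all
      then show "series sc y j (x + ptscale (*) t v) = series sc y j x + sc t (series sc y (Suc j) (Node x v t))"
        by (rule series_quotient[OF T])
    qed simp_all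
    define c where "c = (\<lambda>p. x + series sc y 0 p)"
    have "ck_map (*) (ktop av) sc T 0 k (lvl UNIV 0) c" for k
      unfolding c_def by (intro ck_add[OF tmod_tvs[OF T]] ck_const[OF tmod_tvs[OF T]] s) (simp_all add: top)
    moreover have "c (Base 0) = x"
      using H_zero[OF Q_0] by (simp add: c_def series_def h_def)
    moreover have "c (Base (\<tau> i)) = q i" for i
    proof -
      have "{k. h 0 k (Base (\<tau> i)) \<noteq> 0} = {i}"
        using H_zero[OF Q_tau] H_tau[of i] by (auto simp: h_def)
      then have "series sc y 0 (Base (\<tau> i)) = sc 1 (y i)" using H_tau[of i] by (simp add: series_def h_def)
      then show ?thesis using tmodD(9)[OF tmod_tvs[OF T]] top by (simp add: c_def y_def)
    qed
    ultimately show ?thesis by blast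
  qed
  then show ?thesis using N by (intro exI[of _ N]) auto
qed

text \<open>The curve is built entry by entry, with curves in the field for the third entries. All
  entries share the parameters \<open>\<tau> i\<close>, so they assemble to one curve through trees,
  as needed to test iterated difference quotients for continuity.\<close>

lemma curve_tree:
  assumes T: "tvs av sc UNIV T" and fc: "first_countable T" and x: "x \<in> lvl UNIV m"
  shows "\<exists>N. (\<forall>i. openin (ptop av T m) (N i) \<and> x \<in> N i) \<and>
     (\<forall>q. (\<forall>i. q i \<in> N i) \<longrightarrow> (\<exists>c. (\<forall>k. ck_map (*) (ktop av) (ptscale sc) (ptop av T m) 0 k (lvl UNIV 0) c)
        \<and> c (Base 0) = x \<and> (\<forall>i. c (Base (\<tau> i)) = q i)))"
  using x
proof (induction m arbitrary: x)
  case 0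
  then obtain x' where x': "x = Base x'" by (auto simp: lvl_0_iff)
  obtain N where N: "\<And>i. openin T (N i)" "\<And>i. x' \<in> N i"
    "\<And>q. (\<forall>i. q i \<in> N i) \<Longrightarrow> (\<exists>c. (\<forall>k. ck_map (*) (ktop av) sc T 0 k (lvl UNIV 0) c)
        \<and> c (Base 0) = x' \<and> (\<forall>i. c (Base (\<tau> i)) = q i))"
    using curve_vector[OF T fc, of x'] by metis
  show ?case
  proof (intro exI[of _ "\<lambda>i. Base ` N i"] conjI allI impI)
    fix q :: "nat \<Rightarrow> ('a, 'k) pt" assume q: "\<forall>i. q i \<in> Base ` N i"
    then have "\<forall>i. unBase (q i) \<in> N i" by (metis imageE unBase.simps)
    from N(3)[OF this] obtain c where c: "\<forall>k. ck_map (*) (ktop av) sc T 0 k (lvl UNIV 0) c" "c (Base 0) = x'"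
      "\<And>i. c (Base (\<tau> i)) = unBase (q i)" by blast
    have "Base (unBase (q i)) = q i" for i using q by (metis imageE unBase.simps)
    then show "\<exists>c. (\<forall>k. ck_map (*) (ktop av) (ptscale sc) (ptop av T 0) 0 k (lvl UNIV 0) c)
        \<and> c (Base 0) = x \<and> (\<forall>i. c (Base (\<tau> i)) = q i)"
      using c x' by (intro exI[of _ "\<lambda>p. Base (c p)"]) (auto intro: ck_Base)
  qed (use N x' in \<open>auto intro: openin_Base_image\<close>)
next
  case (Suc m)
  then obtain a b s where x: "x = Node a b s" "a \<in> lvl UNIV m" "b \<in> lvl UNIV m" by (elim lvl_SucE)
  obtain Na where Na: "\<And>i. openin (ptop av T m) (Na i)" "\<And>i. a \<in> Na i"
    "\<And>q. (\<forall>i. q i \<in> Na i) \<Longrightarrow> (\<exists>c. (\<forall>k. ck_map (*) (ktop av) (ptscale sc) (ptop av T m) 0 k (lvl UNIV 0) c)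
        \<and> c (Base 0) = a \<and> (\<forall>i. c (Base (\<tau> i)) = q i))"
    using Suc.IH[OF x(2)] by metis
  obtain Nb where Nb: "\<And>i. openin (ptop av T m) (Nb i)" "\<And>i. b \<in> Nb i"
    "\<And>q. (\<forall>i. q i \<in> Nb i) \<Longrightarrow> (\<exists>c. (\<forall>k. ck_map (*) (ktop av) (ptscale sc) (ptop av T m) 0 k (lvl UNIV 0) c)
        \<and> c (Base 0) = b \<and> (\<forall>i. c (Base (\<tau> i)) = q i))"
    using Suc.IH[OF x(3)] by metis
  obtain Ns where Ns: "\<And>i. openin (ktop av) (Ns i)" "\<And>i. s \<in> Ns i"
    "\<And>q. (\<forall>i. q i \<in> Ns i) \<Longrightarrow> (\<exists>c. (\<forall>k. ck_map (*) (ktop av) (*) (ktop av) 0 k (lvl UNIV 0) c)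
        \<and> c (Base 0) = s \<and> (\<forall>i. c (Base (\<tau> i)) = q i))"
    using curve_vector[OF tvs_field first_countable_ktop, of s] by metis
  let ?S = "lvl (topspace T) (Suc m)"
  define N where "N = (\<lambda>i. {p \<in> ?S. pfst p \<in> Na i} \<inter> {p \<in> ?S. psnd p \<in> Nb i} \<inter> {p \<in> ?S. ptrd p \<in> Ns i})"
  show ?case
  proof (intro exI[of _ N] conjI allI impI)
    fix i
    show "openin (ptop av T (Suc m)) (N i)"
      unfolding N_def
      by (intro openin_Int openin_pfst_preimage openin_psnd_preimage openin_ptrd_preimage Na Nb Ns)
    show "x \<in> N i" using x Na(2) Nb(2) Ns(2) by (simp add: N_def tvs_topspace[OF T])
  next
    fix q :: "nat \<Rightarrow> ('a, 'k) pt" assume "\<forall>i. q i \<in> N i"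
    then have q: "\<forall>i. pfst (q i) \<in> Na i" "\<forall>i. psnd (q i) \<in> Nb i" "\<forall>i. ptrd (q i) \<in> Ns i"
      "\<And>i. Node (pfst (q i)) (psnd (q i)) (ptrd (q i)) = q i"
      by (auto simp: N_def intro: Node_sel)
    obtain ca where ca: "\<And>k. ck_map (*) (ktop av) (ptscale sc) (ptop av T m) 0 k (lvl UNIV 0) ca" "ca (Base 0) = a"
      "\<And>i. ca (Base (\<tau> i)) = pfst (q i)" using Na(3)[OF q(1)] by blast
    obtain cb where cb: "\<And>k. ck_map (*) (ktop av) (ptscale sc) (ptop av T m) 0 k (lvl UNIV 0) cb" "cb (Base 0) = b"
      "\<And>i. cb (Base (\<tau> i)) = psnd (q i)" using Nb(3)[OF q(2)] by blast
    obtain cs where cs: "\<And>k. ck_map (*) (ktop av) (*) (ktop av) 0 k (lvl UNIV 0) cs" "cs (Base 0) = s"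
      "\<And>i. cs (Base (\<tau> i)) = ptrd (q i)" using Ns(3)[OF q(3)] by blast
    show "\<exists>c. (\<forall>k. ck_map (*) (ktop av) (ptscale sc) (ptop av T (Suc m)) 0 k (lvl UNIV 0) c)
        \<and> c (Base 0) = x \<and> (\<forall>i. c (Base (\<tau> i)) = q i)"
      by (intro exI[of _ "\<lambda>p. Node (ca p) (cb p) (cs p)"] conjI allI ck_Node ca cb cs)
         (simp_all add: ca cb cs x q(4))
  qed
qed

end

context valued
begin

lemma bump_family_exists:
  assumes bumps: "\<And>a e. e > 0 \<Longrightarrow> \<exists>h. bump a e h"
  shows "\<exists>\<tau> H Q M. bump_family av \<tau> H Q M"
proof -
  obtain p where p: "0 < av p" "av p < 1" using ex_uniformizer by blast
  define \<rho> where "\<rho> = av p"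
  \<comment> \<open>\<open>\<rho> ^ i * (1 - \<rho>)\<close> bounds the distance from
    \<open>\<tau> i\<close> to all later points from below; a quarter of it as radius keeps any two
    of the closed balls disjoint and \<open>0\<close> outside them all.\<close>
  define e where "e = (\<lambda>i::nat. \<rho> ^ i * (1 - \<rho>) / 4)"
  define \<tau> where "\<tau> = (\<lambda>i::nat. p ^ i)"
  have av_tau: "av (\<tau> i) = \<rho> ^ i" for i by (simp add: \<tau>_def \<rho>_def av_power)
  have e: "e i > 0" for i using p by (simp add: e_def \<rho>_def)
  then have "\<forall>i. \<exists>h. bump (\<tau> i) (e i) h" using bumps by blast
  then obtain H where H: "\<And>i. bump (\<tau> i) (e i) (H i)" by metis
  \<comment> \<open>The bump vanishes already at distance \<open>e i\<close>; the strict inequality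
    makes this set open.\<close>
  define Q where "Q = (\<lambda>i. {t. av (t - \<tau> i) > e i})"
  define B where "B i j = (SOME M. \<forall>p\<in>lvl UNIV j. pt_norm p \<le> real i \<longrightarrow> av ((dquot_field ^^ j) (H i) p) \<le> M)" for i j
  have B': "\<forall>p\<in>lvl UNIV j. pt_norm p \<le> real i \<longrightarrow> av ((dquot_field ^^ j) (H i) p) \<le> B i j" for i j
    unfolding B_def by (rule someI_ex) (use H[of i] in \<open>simp add: bump_def\<close>)
  have B: "av ((dquot_field ^^ j) (H i) p) \<le> B i j" if "p \<in> lvl UNIV j" "pt_norm p \<le> real i" for i j p
    using B'[rule_format, OF that] .
  \<comment> \<open>One number for all orders up to \<open>i\<close> on the ball of radius
    \<open>i\<close>: every fixed order and ball is covered from some index on.\<close>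
  define M where "M = (\<lambda>i. \<Sum>j\<le>i. \<bar>B i j\<bar>)"
  have disj: "t \<in> Q i \<or> t \<in> Q j" if "i < j" for t i j
  proof (rule ccontr)
    assume "\<not> ?thesis"
    then have "av (t - \<tau> i) \<le> e i" "av (t - \<tau> j) \<le> e j" by (auto simp: Q_def)
    then have "av (\<tau> i - \<tau> j) \<le> e i + e j"
      using av_triangle_sub[of "\<tau> i" "\<tau> j" t] by (simp add: av_minus_commute)
    moreover have "\<rho> ^ i - \<rho> ^ j \<le> av (\<tau> i - \<tau> j)"
      using av_triangle[of "\<tau> i - \<tau> j" "\<tau> j"] by (simp add: av_tau)
    moreover have le: "\<rho> ^ j \<le> \<rho> ^ i * \<rho>"
      using power_decreasing[of "Suc i" j \<rho>] that p by (simp add: \<rho>_def mult.commute)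
    moreover have "e j \<le> e i"
      unfolding e_def using power_decreasing[of i j \<rho>] that p by (intro divide_right_mono mult_right_mono) (auto simp: \<rho>_def)
    ultimately have "\<rho> ^ i * (1 - \<rho>) \<le> 2 * e i" by (simp add: algebra_simps)
    moreover have "\<rho> ^ i * (1 - \<rho>) = 4 * e i" by (simp add: e_def)
    ultimately show False using e[of i] by simp
  qed
  have disj': "t \<in> Q i \<or> t \<in> Q j" if "i \<noteq> j" for t i j
    using disj[of i j t] disj[of j i t] that by linarith
  have "bump_family av \<tau> H Q M"
  proof
    fix r :: real assume "r > 0"
    then obtain n where n: "\<rho> ^ n < r" using real_arch_pow_inv p by (metis \<rho>_def)
    have "av (\<tau> i) < r" if "i \<ge> n" for i
      using le_less_trans[OF power_decreasing[OF that, of \<rho>] n] p by (simp add: av_tau \<rho>_def less_imp_le)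
    then show "\<exists>n. \<forall>i\<ge>n. av (\<tau> i) < r" by blast
  next
    fix k i show "ck_field 0 k (lvl UNIV 0) (H i)" using H[of i] by (simp add: bump_def)
    show "H i (Base (\<tau> i)) = 1" using H[of i] unfolding bump_def by (metis av_0 diff_self)
    show "openin (ktop av) (Q i)" unfolding Q_def by (rule openin_outside_cball)
    have "\<rho> ^ i > 0" using p by (simp add: \<rho>_def)
    then have "\<rho> ^ i * ((1 - \<rho>) / 4) < \<rho> ^ i * 1" using p av_nonneg[of p] by (intro mult_strict_left_mono) (auto simp: \<rho>_def simp del: av_nonneg)
    then show "0 \<in> Q i" by (simp add: Q_def e_def av_tau)
  next
    fix t i assume "t \<in> Q i"
    then show "H i (Base t) = 0" using H[of i] by (simp add: bump_def Q_def)
  next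
    fix t
    show "finite {i. t \<notin> Q i}"
    proof (cases "\<exists>i. t \<notin> Q i")
      case True
      then obtain i where "t \<notin> Q i" by blast
      then have "{i. t \<notin> Q i} \<subseteq> {i}" using disj' by blast
      then show ?thesis by (rule finite_subset) simp
    qed simp
  next
    fix i j :: nat assume "i \<noteq> j"
    moreover have "\<tau> j \<notin> Q j" using e[of j] by (simp add: Q_def)
    ultimately show "\<tau> j \<in> Q i" using disj' by blast
  next
    fix j i and q :: "('k, 'k) pt" assume j: "j \<le> i" and q: "q \<in> lvl UNIV j" "pt_norm q \<le> real i"
    have "av ((dquot_field ^^ j) (H i) q) \<le> \<bar>B i j\<bar>" using B[OF q] by linarith
    also have "\<dots> \<le> M i" unfolding M_def using j by (intro member_le_sum) auto
    finally show "av ((dquot_field ^^ j) (H i) q) \<le> M i" .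
  qed
  then show ?thesis by blast
qed

end

section \<open>Testing along curves\<close>

context valued
begin

section \<open>The coordinate spaces \<open>Kn n\<close>\<close>

lemma topspace_Ktop [simp]: "topspace (Ktop av n) = Kn n"
  by (simp add: Ktop_def)

lemma continuous_into_Ktop:
  "continuous_map X (Ktop av n) f \<longleftrightarrow>
     (\<forall>i. continuous_map X (ktop av) (\<lambda>x. f x i)) \<and> (\<forall>x\<in>topspace X. f x \<in> Kn n)"
  by (auto simp: Ktop_def continuous_map_in_subtopology continuous_map_componentwise_UNIV)

lemma continuous_coordinate: "continuous_map (Ktop av n) (ktop av) (\<lambda>x. x i)"
  unfolding Ktop_def by (intro continuous_map_from_subtopology continuous_map_product_projection) simp

lemma Kn_add: "x \<in> Kn n \<Longrightarrow> y \<in> Kn n \<Longrightarrow> x + y \<in> Kn n"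
  and Kn_scale: "x \<in> Kn n \<Longrightarrow> Kscale a x \<in> Kn n"
  by (auto simp: Kn_def Kscale_def)

lemma tmod_Kn: "tmod Kscale (Ktop av n)"
  unfolding tmod_def topspace_Ktop
proof (intro conjI ballI allI)
  note fst = continuous_map_compose[OF continuous_map_fst, unfolded o_def]
  note snd = continuous_map_compose[OF continuous_map_snd, unfolded o_def]
  have "continuous_map (prod_topology (Ktop av n) (Ktop av n)) (ktop av) (\<lambda>z. fst z i + snd z i)" for i
    by (intro tmod_continuous_add[OF tmod_field] fst snd continuous_coordinate)
  then show "continuous_map (prod_topology (Ktop av n) (Ktop av n)) (Ktop av n) (\<lambda>(x, y). x + y)"
    by (simp add: continuous_into_Ktop split_beta' Kn_add)
  have "continuous_map (prod_topology (ktop av) (Ktop av n)) (ktop av) (\<lambda>z. fst z * snd z i)" for i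
    by (intro tmod_continuous_scale[OF tmod_field] continuous_map_fst snd continuous_coordinate)
  then show "continuous_map (prod_topology (ktop av) (Ktop av n)) (Ktop av n) (\<lambda>(a, x). Kscale a x)"
    by (simp add: continuous_into_Ktop split_beta' Kn_scale) (simp add: Kscale_def)
qed (auto simp: Kn_add Kn_scale, auto simp: Kscale_def fun_eq_iff algebra_simps)

lemma lin_coordinate: "lin Kscale (Ktop av n) (*) (ktop av) 0 (\<lambda>p. unBase p i)"
  unfolding lin_def continuous_from_ptop_0
  by (auto simp: continuous_coordinate Kscale_def lvl_0_iff)

lemma ck_into_Kn:
  assumes "\<And>i. ck_map sc T (*) (ktop av) m k U (\<lambda>p. f p i)" "\<And>p. p \<in> U \<Longrightarrow> f p \<in> Kn n"
  shows "ck_map sc T Kscale (Ktop av n) m k U f"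
  using assms
proof (induction k arbitrary: m U f)
  case 0
  then show ?case by (auto simp: continuous_into_Ktop)
next
  case (Suc k)
  have sub: "U \<subseteq> lvl (topspace T) m" by (rule ck_subset[OF Suc.prems(1)])
  have 0: "ck_map sc T Kscale (Ktop av n) m 0 U f"
    using ck_continuous[OF Suc.prems(1)] Suc.prems(2) sub by (auto simp: continuous_into_Ktop)
  let ?V = "ext sc (topspace T) m U"
  have "\<exists>g. ck_map sc T (*) (ktop av) (Suc m) k ?V g \<and>
    (\<forall>x v t. Node x v t \<in> ?V \<longrightarrow> f (x + ptscale sc t v) i = f x i + t * g (Node x v t))" for i
    by (rule ck_SucE[OF Suc.prems(1)[of i]]) blast
  then obtain g where g: "\<And>i. ck_map sc T (*) (ktop av) (Suc m) k ?V (g i)"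
    "\<And>i x v t. Node x v t \<in> ?V \<Longrightarrow> f (x + ptscale sc t v) i = f x i + t * g i (Node x v t)" by metis
  \<comment> \<open>For \<open>i \<ge> n\<close> the coordinate of \<open>f\<close> is
    \<open>0\<close>, but the equation does not determine the chosen \<open>g i\<close> at
    \<open>t = 0\<close>; truncation returns the values to \<open>Kn n\<close>.\<close>
  define G where "G p i = (if i < n then g i p else 0)" for p i
  have "ck_map sc T (*) (ktop av) (Suc m) k ?V (\<lambda>p. G p i)" for i
    using g(1)[of i] ck_const[OF tmod_field, of 0 ?V T "Suc m"] ext_subset_lvl[OF sub]
    by (cases "i < n") (simp_all add: G_def)
  then have G: "ck_map sc T Kscale (Ktop av n) (Suc m) k ?V G"
    by (rule Suc.IH) (simp add: G_def Kn_def)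
  show ?case
  proof (rule ck_SucI[OF 0 G])
    fix x v t assume *: "Node x v t \<in> ?V"
    then have "f x \<in> Kn n" "f (x + ptscale sc t v) \<in> Kn n" using Suc.prems(2) by (auto simp: ext_iff)
    then show "f (x + ptscale sc t v) = f x + Kscale t (G (Node x v t))"
      using g(2)[OF *] by (auto simp: fun_eq_iff Kscale_def G_def Kn_def not_less)
  qed
qed

lemma Kn_box:
  assumes W: "openin (ptop av (Ktop av n) 0) W" and x0: "Base x0 \<in> W"
  shows "\<exists>e>0. \<forall>x\<in>Kn n. (\<forall>i<n. av (x i - x0 i) < e) \<longrightarrow> Base x \<in> W"
proof -
  have "continuous_map (Ktop av n) (ptop av (Ktop av n) 0) Base"
    using continuous_Base[of "Ktop av n" "Ktop av n" "\<lambda>x. x"] by simp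
  from openin_continuous_map_preimage[OF this W]
  obtain S where S: "openin (product_topology (\<lambda>_. ktop av) UNIV) S" "{x \<in> Kn n. Base x \<in> W} = S \<inter> Kn n"
    by (auto simp: Ktop_def openin_subtopology)
  have x0n: "x0 \<in> Kn n" using x0 openin_subset[OF W] by auto
  then have "x0 \<in> S" using S(2) x0 by blast
  then obtain B where B: "\<forall>i. openin (ktop av) (B i)" "x0 \<in> Pi\<^sub>E UNIV B" "Pi\<^sub>E UNIV B \<subseteq> S"
    using S(1)[unfolded openin_product_topology_alt] by auto
  have "\<exists>d>0. \<forall>y. av (y - x0 i) < d \<longrightarrow> y \<in> B i" for i
    using B(1)[rule_format, of i] B(2) unfolding openin_ktop by (auto simp: PiE_iff)
  then obtain d where d: "\<And>i. d i > 0" "\<And>i y. av (y - x0 i) < d i \<Longrightarrow> y \<in> B i" by metis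
  \<comment> \<open>The entry \<open>1\<close> keeps the set nonempty when
    \<open>n = 0\<close>.\<close>
  define e where "e = Min (insert 1 (d ` {..<n}))"
  have "e > 0" unfolding e_def using d(1) by (subst Min_gr_iff) auto
  moreover have "Base x \<in> W" if x: "x \<in> Kn n" "\<forall>i<n. av (x i - x0 i) < e" for x
  proof -
    have "x i \<in> B i" for i
    proof (cases "i < n")
      case True
      then have "e \<le> d i" by (simp add: e_def)
      then show ?thesis using d(2) x(2) True by force
    next
      case False
      then have "x i = x0 i" using x(1) x0n by (simp add: Kn_def)
      then show ?thesis using d by simp
    qed
    then have "x \<in> S" using B(3) by (auto simp: PiE_iff)
    then show ?thesis using S(2) x(1) by blast
  qed
  ultimately show ?thesis by blast
qed

abbreviation "ck_Kn n sc T m k \<equiv> ck_map Kscale (Ktop av n) sc T m k"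

lemma lvl_Kn_whole: "subtopology (ptop av (Ktop av n) 0) (lvl (Kn n) 0) = ptop av (Ktop av n) 0"
  using subtopology_topspace[of "ptop av (Ktop av n) 0"] by simp

end

locale bump_valued = valued av for av :: "'k::field \<Rightarrow> real" +
  assumes bumps: "e > 0 \<Longrightarrow> \<exists>h. bump a e h"
begin

text \<open>Each coordinate's displacement from the centre is multiplied by a bump in that
  coordinate. The factor is \<open>0\<close> once the displacement reaches \<open>e\<close> and at
  most \<open>1\<close> in absolute value before, so all values stay in a box inside
  \<open>W\<close>; near the centre the factor is \<open>1\<close>.\<close>

lemma localizer:
  assumes W: "openin (ptop av (Ktop av n) 0) W" and P: "P \<in> W"
  shows "\<exists>\<theta> Y. (\<forall>k. ck_Kn n (ptscale Kscale) (ptop av (Ktop av n) 0) 0 k (lvl (Kn n) 0) \<theta>)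
     \<and> \<theta> ` lvl (Kn n) 0 \<subseteq> W \<and> openin (ptop av (Ktop av n) 0) Y \<and> P \<in> Y \<and> (\<forall>q\<in>Y. \<theta> q = q)"
proof -
  have "P \<in> lvl (Kn n) 0" using P openin_subset[OF W] by auto
  then obtain x0 where x0: "P = Base x0" "x0 \<in> Kn n" by (auto simp: lvl_0_iff)
  obtain e where e: "e > 0" "\<And>x. x \<in> Kn n \<Longrightarrow> (\<And>i. i < n \<Longrightarrow> av (x i - x0 i) < e) \<Longrightarrow> Base x \<in> W"
    using Kn_box[OF W P[unfolded x0(1)]] by blast
  have "\<forall>i. \<exists>h. bump (x0 i) e h" using bumps[OF e(1)] by blast
  then obtain h where h: "\<And>i. bump (x0 i) e (h i)" by metis
  have "\<forall>i. \<exists>d>0. \<forall>t. av (t - x0 i) < d \<longrightarrow> h i (Base t) = 1" using h unfolding bump_def by blast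
  then obtain d where d: "\<And>i. d i > 0" "\<And>i t. av (t - x0 i) < d i \<Longrightarrow> h i (Base t) = 1" by metis
  define th :: "(nat \<Rightarrow> 'k, 'k) pt \<Rightarrow> nat \<Rightarrow> 'k" where
    "th p i = (if i < n then x0 i + (unBase p i + (- x0 i)) * h i (Base (unBase p i)) else 0)" for p i
  have thK: "th p \<in> Kn n" for p by (simp add: th_def Kn_def)
  have c: "ck_Kn n (*) (ktop av) 0 k (lvl (Kn n) 0) (\<lambda>p. th p i)" for k i
  proof (cases "i < n")
    case True
    have 1: "ck_Kn n (*) (ktop av) 0 k (lvl (Kn n) 0) (\<lambda>p. unBase p i)"
      by (rule ck_lin[OF lin_coordinate]) simp
    have "ck_field 0 k (lvl UNIV 0) (h i)" using h[of i] unfolding bump_def by blast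
    then have "ck_Kn n (*) (ktop av) 0 k (lvl (Kn n) 0) (\<lambda>p. h i (Base (unBase p i)))"
      by (rule ck_chain[OF _ ck_Base[OF 1]]) auto
    then have "ck_Kn n (*) (ktop av) 0 k (lvl (Kn n) 0)
        (\<lambda>p. x0 i + (unBase p i + (- x0 i)) * h i (Base (unBase p i)))"
      by (intro ck_add[OF tmod_field] ck_mult ck_const[OF tmod_field] 1) simp_all
    then show ?thesis using True by (simp add: th_def)
  qed (simp add: th_def ck_const[OF tmod_field])
  have "ck_Kn n (ptscale Kscale) (ptop av (Ktop av n) 0) 0 k (lvl (Kn n) 0) (\<lambda>p. Base (th p))" for k
    by (intro ck_Base ck_into_Kn c thK)
  moreover have "(\<lambda>p. Base (th p)) ` lvl (Kn n) 0 \<subseteq> W"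
  proof (rule image_subsetI)
    fix p :: "(nat \<Rightarrow> 'k, 'k) pt"
    show "Base (th p) \<in> W"
    proof (rule e(2)[OF thK])
      fix i assume i: "i < n"
      have "av (th p i - x0 i) = av (unBase p i - x0 i) * av (h i (Base (unBase p i)))"
        using i by (simp add: th_def av_mult)
      also have "\<dots> < e"
      proof (cases "e \<le> av (unBase p i - x0 i)")
        case True
        then have "h i (Base (unBase p i)) = 0" using h[of i] unfolding bump_def by blast
        then show ?thesis using e(1) by simp
      next
        case False
        have "av (h i (Base (unBase p i))) \<le> 1" using h[of i] unfolding bump_def by blast
        then have "av (unBase p i - x0 i) * av (h i (Base (unBase p i))) \<le> av (unBase p i - x0 i) * 1"
          by (intro mult_left_mono) auto
        then show ?thesis using False by simp
      qed
      finally show "av (th p i - x0 i) < e" .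
    qed
  qed
  moreover define Y :: "(nat \<Rightarrow> 'k, 'k) pt set" where "Y = (\<Inter>i\<in>{..<n}. {p \<in> lvl (Kn n) 0. unBase p i \<in> {t. av (t - x0 i) < d i}}) \<inter> lvl (Kn n) 0"
  have "openin (ptop av (Ktop av n) 0) Y"
  proof -
    have "openin (ptop av (Ktop av n) 0) {p \<in> lvl (Kn n) 0. unBase p i \<in> {t. av (t - x0 i) < d i}}" for i
      using openin_continuous_map_preimage[OF _ openin_ball, of "ptop av (Ktop av n) 0" "\<lambda>p. unBase p i"]
        lin_coordinate[of n i] by (simp add: lin_def)
    then have "openin (ptop av (Ktop av n) 0) ((\<Inter>i\<in>{..<n}. {p \<in> lvl (Kn n) 0. unBase p i \<in> {t. av (t - x0 i) < d i}})
        \<inter> topspace (ptop av (Ktop av n) 0))"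
      by (intro openin_INT) auto
    then show ?thesis by (simp add: Y_def)
  qed
  moreover have "P \<in> Y" using x0 d by (simp add: Y_def)
  moreover have "Base (th q) = q" if q: "q \<in> Y" for q
  proof -
    obtain x where x: "q = Base x" "x \<in> Kn n" "\<And>i. i < n \<Longrightarrow> av (x i - x0 i) < d i"
      using q by (auto simp: Y_def lvl_0_iff)
    then have "th q i = x i" for i using d(2) by (simp add: th_def Kn_def)
    then show ?thesis using x by auto
  qed
  ultimately show ?thesis by blast
qed

end

section \<open>The test along smooth maps, for all tree levels\<close>

locale test_problem = bump_valued av for av :: "'k::field \<Rightarrow> real" +
  fixes scE :: "'k \<Rightarrow> 'e::ab_group_add \<Rightarrow> 'e" and TE :: "'e topology"
    and scF :: "'k \<Rightarrow> 'f::ab_group_add \<Rightarrow> 'f" and TF :: "'f topology"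
  assumes E: "tvs av scE UNIV TE" and F: "tvs av scF UNIV TF" and E_first_countable: "first_countable TE"
begin

lemmas tmE = tmod_tvs[OF E] and tmF = tmod_tvs[OF F]

lemma topE [simp]: "topspace TE = UNIV" and topF [simp]: "topspace TF = UNIV"
  using E F by (simp_all add: tvs_def)

definition smooth_curve :: "nat \<Rightarrow> nat \<Rightarrow> ((nat \<Rightarrow> 'k, 'k) pt \<Rightarrow> ('e, 'k) pt) \<Rightarrow> bool" where
  "smooth_curve n m c \<longleftrightarrow> (\<forall>k. ck_Kn n (ptscale scE) (ptop av TE m) 0 k (lvl (Kn n) 0) c)"

definition curves_test :: "nat \<Rightarrow> nat \<Rightarrow> nat \<Rightarrow> ('e, 'k) pt set \<Rightarrow> (('e, 'k) pt \<Rightarrow> 'f) \<Rightarrow> bool" where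
  "curves_test n m k U f \<longleftrightarrow> (\<forall>c. smooth_curve n m c \<longrightarrow> c ` lvl (Kn n) 0 \<subseteq> U \<longrightarrow>
     ck_Kn n scF TF 0 k (lvl (Kn n) 0) (\<lambda>p. f (c p)))"

lemma smooth_curve_value: "smooth_curve n m c \<Longrightarrow> p \<in> lvl (Kn n) 0 \<Longrightarrow> c p \<in> lvl UNIV m"
  using ck_value[of Kscale "Ktop av n" "ptscale scE" "ptop av TE m" 0 0 "lvl (Kn n) 0" c p]
  unfolding smooth_curve_def by (metis topE topspace_ptop)

lemma openin_curve_preimage:
  assumes "smooth_curve n m c" "openin (ptop av TE m) U"
  shows "openin (ptop av (Ktop av n) 0) {p \<in> lvl (Kn n) 0. c p \<in> U}"
proof -
  have "continuous_map (ptop av (Ktop av n) 0) (ptop av TE m) c"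
    using ck_continuous[OF assms(1)[unfolded smooth_curve_def, rule_format, of 0]] by (simp only: lvl_Kn_whole)
  from openin_continuous_map_preimage[OF this assms(2)] show ?thesis by simp
qed

text \<open>Frees the test from the condition on the image: near each point of the preimage,
  \<open>g\<close> agrees with its composition with a localizing map, and the latter stays in
  \<open>U\<close>.\<close>

lemma ck_curve_preimage:
  assumes U: "openin (ptop av TE m) U" and f: "curves_test n m k U f" and g: "smooth_curve n m g"
  shows "ck_Kn n scF TF 0 k {p \<in> lvl (Kn n) 0. g p \<in> U} (\<lambda>p. f (g p))"
proof (rule ck_local[OF F tmod_Kn openin_curve_preimage[OF g U]])
  let ?W = "{p \<in> lvl (Kn n) 0. g p \<in> U}"
  fix p assume p: "p \<in> ?W"
  obtain \<theta> Y where th: "\<And>k. ck_Kn n (ptscale Kscale) (ptop av (Ktop av n) 0) 0 k (lvl (Kn n) 0) \<theta>"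
    "\<theta> ` lvl (Kn n) 0 \<subseteq> ?W" "openin (ptop av (Ktop av n) 0) Y" "p \<in> Y" "\<forall>q\<in>Y. \<theta> q = q"
    using localizer[OF openin_curve_preimage[OF g U] p] by blast
  have "smooth_curve n m (\<lambda>q. g (\<theta> q))"
    unfolding smooth_curve_def
  proof
    fix k
    show "ck_Kn n (ptscale scE) (ptop av TE m) 0 k (lvl (Kn n) 0) (\<lambda>q. g (\<theta> q))"
      by (rule ck_chain[OF g[unfolded smooth_curve_def, rule_format] th(1)]) (use th(2) in blast)
  qed
  moreover have "(\<lambda>q. g (\<theta> q)) ` lvl (Kn n) 0 \<subseteq> U" using th(2) by blast
  ultimately have "ck_Kn n scF TF 0 k (lvl (Kn n) 0) (\<lambda>q. f (g (\<theta> q)))"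
    using f unfolding curves_test_def by blast
  then have "ck_Kn n scF TF 0 k (?W \<inter> Y) (\<lambda>q. f (g (\<theta> q)))" by (rule ck_restrict) blast
  then have "ck_Kn n scF TF 0 k (?W \<inter> Y) (\<lambda>q. f (g q))" by (rule ck_cong) (use th(5) in auto)
  then show "\<exists>V. openin (ptop av (Ktop av n) 0) V \<and> p \<in> V \<and> V \<subseteq> ?W \<and> ck_Kn n scF TF 0 k V (\<lambda>p. f (g p))"
    using openin_Int[OF openin_curve_preimage[OF g U] th(3)] p th(4) by (intro exI[of _ "?W \<inter> Y"]) auto
qed

text \<open>If continuity failed at \<open>x\<close>, every \<open>N i\<close> would contain a bad
  point \<open>q i\<close>, and \<open>f\<close> would be discontinuous at \<open>0\<close> along
  the curve through all of them. The curve may leave \<open>U\<close> between these points, so the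
  preimage version of the test is used.\<close>

lemma continuous_if_curves_test:
  assumes U: "openin (ptop av TE m) U" and f: "curves_test 1 m 0 U f"
  shows "ck_map scE TE scF TF m 0 U f"
proof -
  obtain \<tau> H Q M where "bump_family av \<tau> H Q M" using bump_family_exists[OF bumps] by blast
  then interpret bump_family av \<tau> H Q M .
  have Ul: "U \<subseteq> lvl UNIV m" using openin_subset[OF U] by simp
  have "continuous_map (subtopology (ptop av TE m) U) TF f"
    unfolding continuous_map_at_iff
  proof (intro ballI conjI allI impI)
    fix x O' assume "x \<in> topspace (subtopology (ptop av TE m) U)" and O': "openin TF O' \<and> f x \<in> O'"
    then have x: "x \<in> U" by simp
    show "\<exists>W. openin (subtopology (ptop av TE m) U) W \<and> x \<in> W \<and> (\<forall>y\<in>W. f y \<in> O')"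
    proof (rule ccontr)
      assume neg: "\<not> ?thesis"
      obtain N where N: "\<And>i. openin (ptop av TE m) (N i)" "\<And>i. x \<in> N i"
        "\<And>q. (\<forall>i. q i \<in> N i) \<Longrightarrow> \<exists>c. (\<forall>k. ck_map (*) (ktop av) (ptscale scE) (ptop av TE m) 0 k (lvl UNIV 0) c)
           \<and> c (Base 0) = x \<and> (\<forall>i. c (Base (\<tau> i)) = q i)"
        using curve_tree[OF E E_first_countable, of x m] x Ul by blast
      have "\<exists>y. y \<in> N i \<inter> U \<and> f y \<notin> O'" for i
      proof -
        have "openin (subtopology (ptop av TE m) U) (N i \<inter> U)" using N(1) by (auto simp: openin_subtopology)
        then show ?thesis using neg N(2) x by blast
      qed
      then obtain q where q: "\<And>i. q i \<in> N i" "\<And>i. q i \<in> U" "\<And>i. f (q i) \<notin> O'" by (metis IntD1 IntD2)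
      obtain c where c: "\<And>k. ck_map (*) (ktop av) (ptscale scE) (ptop av TE m) 0 k (lvl UNIV 0) c"
        "c (Base 0) = x" "\<And>i. c (Base (\<tau> i)) = q i" using N(3)[of q] q(1) by blast
      define c' :: "(nat \<Rightarrow> 'k, 'k) pt \<Rightarrow> ('e, 'k) pt" where "c' = (\<lambda>p. c (Base (unBase p 0)))"
      have c': "smooth_curve 1 m c'"
        unfolding smooth_curve_def c'_def
      proof
        fix k
        have "ck_Kn 1 (*) (ktop av) 0 k (lvl (Kn 1) 0) (\<lambda>p. unBase p 0)"
          by (rule ck_lin[OF lin_coordinate]) simp
        then show "ck_Kn 1 (ptscale scE) (ptop av TE m) 0 k (lvl (Kn 1) 0) (\<lambda>p. c (Base (unBase p 0)))"
          by (intro ck_chain[OF c(1) ck_Base]) auto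
      qed
      let ?W = "{p \<in> lvl (Kn 1) 0. c' p \<in> U}"
      have cont: "ck_Kn 1 scF TF 0 0 ?W (\<lambda>p. f (c' p))" by (rule ck_curve_preimage[OF U f c'])
      define j :: "'k \<Rightarrow> (nat \<Rightarrow> 'k, 'k) pt" where "j t = Base (\<lambda>i. if i = 0 then t else 0)" for t
      have cj: "continuous_map (ktop av) (ptop av (Ktop av 1) 0) j"
      proof -
        have "continuous_map (ktop av) (ktop av) (\<lambda>t. if i = (0::nat) then t else 0)" for i
          by (cases "i = 0") auto
        then show ?thesis unfolding j_def continuous_Base continuous_into_Ktop by (auto simp: Kn_def)
      qed
      have c'j: "c' (j t) = c (Base t)" for t by (simp add: c'_def j_def)
      have j0: "j 0 \<in> ?W" using c(2) x c'j[of 0] by (auto simp: j_def Kn_def lvl_0_iff)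
      have "openin (subtopology (ptop av (Ktop av 1) 0) ?W) {p \<in> ?W. f (c' p) \<in> O'}"
      proof -
        have "topspace (subtopology (ptop av (Ktop av 1) 0) ?W) = ?W" by auto
        then show ?thesis
          using openin_continuous_map_preimage[OF ck_continuous[OF cont] conjunct1[OF O']] by (simp only:)
      qed
      then have "openin (ptop av (Ktop av 1) 0) {p \<in> ?W. f (c' p) \<in> O'}"
        using openin_curve_preimage[OF c' U] openin_trans_full by blast
      from openin_continuous_map_preimage[OF cj this]
      have "openin (ktop av) {t. j t \<in> {p \<in> ?W. f (c' p) \<in> O'}}" by simp
      moreover have "0 \<in> {t. j t \<in> {p \<in> ?W. f (c' p) \<in> O'}}" using j0 c'j[of 0] c(2) O' by simp
      ultimately obtain e where e: "e > 0" "\<And>t. av (t - 0) < e \<Longrightarrow> t \<in> {t. j t \<in> {p \<in> ?W. f (c' p) \<in> O'}}"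
        unfolding openin_ktop by blast
      obtain n where "av (\<tau> n) < e" using tau_lim[OF e(1)] by blast
      then have "f (c' (j (\<tau> n))) \<in> O'" using e(2)[of "\<tau> n"] by simp
      then show False using c'j c(3) q(3) by simp
    qed
  qed simp
  then show ?thesis using Ul by simp
qed

text \<open>For \<open>c = (x, v, t)\<close> with values in \<open>U\<^bsup>[1]\<^esup>\<close> put \<open>g (s, r) = x s + r v s\<close>, a map of one more variable.
  Then \<open>f\<^bsup>[1]\<^esup> (c s) = (f \<circ> g)\<^bsup>[1]\<^esup> ((s, 0), (0, 1), t s)\<close>.\<close>
lemma ck_if_curves_test:
  assumes "openin (ptop av TE m) U" "curves_test (Suc k) m k U f"
  shows "ck_map scE TE scF TF m k U f"
  using assms
proof (induction k arbitrary: m U f)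
  case 0
  then show ?case using continuous_if_curves_test by simp
next
  case (Suc k)
  let ?n = "Suc k" and ?N = "Suc (Suc k)"
  have Ul: "U \<subseteq> lvl UNIV m" using openin_subset[OF Suc.prems(1)] by simp
  let ?V = "ext scE (topspace TE) m U"
  have "curves_test ?n (Suc m) k ?V (dquot scE scF TF f)"
    unfolding curves_test_def
  proof (intro allI impI)
    fix c assume c: "smooth_curve ?n (Suc m) c" and im: "c ` lvl (Kn ?n) 0 \<subseteq> ?V"
    have cC: "ck_Kn ?n (ptscale scE) (ptop av TE (Suc m)) 0 j (lvl (Kn ?n) 0) c" for j
      using c by (simp add: smooth_curve_def)
    \<comment> \<open>Forgets the last of the \<open>k + 2\<close> coordinates, the one with index
      \<open>?n\<close>, which carries the parameter \<open>r\<close> of the line.\<close>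
    define tr :: "(nat \<Rightarrow> 'k, 'k) pt \<Rightarrow> (nat \<Rightarrow> 'k, 'k) pt" where
      "tr p = Base (\<lambda>i. if i < ?n then unBase p i else 0)" for p
    have trl: "tr p \<in> lvl (Kn ?n) 0" for p by (simp add: tr_def Kn_def)
    have tr: "ck_Kn ?N (ptscale Kscale) (ptop av (Ktop av ?n) 0) 0 j (lvl (Kn ?N) 0) tr" for j
    proof -
      have "ck_Kn ?N (*) (ktop av) 0 j (lvl (Kn ?N) 0) (\<lambda>p. if i < ?n then unBase p i else 0)" for i
        by (cases "i < ?n") (simp_all add: ck_lin[OF lin_coordinate] ck_const[OF tmod_field])
      then show ?thesis unfolding tr_def by (intro ck_Base ck_into_Kn) (auto simp: Kn_def)
    qed
    have ct: "ck_Kn ?N (ptscale scE) (ptop av TE (Suc m)) 0 j (lvl (Kn ?N) 0) (\<lambda>p. c (tr p))" for j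
      by (rule ck_chain[OF cC tr]) (use trl in blast)
    have cl: "c s \<in> lvl UNIV (Suc m)" if "s \<in> lvl (Kn ?n) 0" for s
      using smooth_curve_value[OF c that] .
    define g where "g p = pfst (c (tr p)) + ptscale scE (unBase p ?n) (psnd (c (tr p)))" for p
    have g: "smooth_curve ?N m g"
      unfolding smooth_curve_def g_def
    proof
      fix j
      have "ck_Kn ?N (ptscale scE) (ptop av TE m) 0 j (lvl (Kn ?N) 0) (\<lambda>p. pfst (c (tr p)))"
        "ck_Kn ?N (ptscale scE) (ptop av TE m) 0 j (lvl (Kn ?N) 0) (\<lambda>p. psnd (c (tr p)))"
        by (rule ck_chain[OF ck_lin[OF lin_pfst, of "lvl UNIV (Suc m)"] ct] ck_chain[OF ck_lin[OF lin_psnd, of "lvl UNIV (Suc m)"] ct];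
            use cl trl in auto)+
      moreover have "ck_Kn ?N (*) (ktop av) 0 j (lvl (Kn ?N) 0) (\<lambda>p. unBase p ?n)"
        by (rule ck_lin[OF lin_coordinate]) simp
      ultimately show "ck_Kn ?N (ptscale scE) (ptop av TE m) 0 j (lvl (Kn ?N) 0)
          (\<lambda>p. pfst (c (tr p)) + ptscale scE (unBase p ?n) (psnd (c (tr p))))"
        by (intro ck_add ck_scale tmod_pt tmE)
    qed
    \<comment> \<open>The line \<open>x + r v\<close> may leave \<open>U\<close> for some
      \<open>r\<close>, though \<open>x\<close> and \<open>x + t v\<close> lie in it.\<close>
    let ?W = "{p \<in> lvl (Kn ?N) 0. g p \<in> U}"
    have fg: "ck_Kn ?N scF TF 0 ?n ?W (\<lambda>p. f (g p))"
      by (rule ck_curve_preimage[OF Suc.prems g])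
    have Dfg: "ck_Kn ?N scF TF (Suc 0) k (ext Kscale (Kn ?N) 0 ?W) (dquot Kscale scF TF (\<lambda>p. f (g p)))"
      using ck_dquot[OF F tmod_Kn openin_curve_preimage[OF g Suc.prems(1)] fg] by simp
    define u :: "(nat \<Rightarrow> 'k, 'k) pt" where "u = Base (\<lambda>i. if i = ?n then 1 else 0)"
    have u: "u \<in> lvl (Kn ?N) 0" by (simp add: u_def Kn_def)
    have g_line: "g (s + ptscale Kscale r u) = pfst (c s) + ptscale scE r (psnd (c s))"
      and line_lvl: "s + ptscale Kscale r u \<in> lvl (Kn ?N) 0" if "s \<in> lvl (Kn ?n) 0" for s r
    proof -
      obtain x where x: "s = Base x" "x \<in> Kn ?n" using \<open>s \<in> lvl (Kn ?n) 0\<close> by (auto simp: lvl_0_iff)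
      have "(\<lambda>i. if i < ?n then (x + Kscale r (\<lambda>i. if i = ?n then 1 else 0)) i else 0) = x"
        using x(2) by (auto simp: Kn_def Kscale_def fun_eq_iff)
      then have "tr (s + ptscale Kscale r u) = s" by (simp add: tr_def u_def x(1) cong: if_cong)
      moreover have "unBase (s + ptscale Kscale r u) ?n = r" using x by (simp add: u_def Kscale_def Kn_def)
      ultimately show "g (s + ptscale Kscale r u) = pfst (c s) + ptscale scE r (psnd (c s))"
        by (simp add: g_def)
      show "s + ptscale Kscale r u \<in> lvl (Kn ?N) 0" using x by (auto simp: u_def Kscale_def Kn_def)
    qed
    \<comment> \<open>\<open>Kn ?n\<close> is the part of \<open>Kn ?N\<close> with last coordinate
      \<open>0\<close>, so \<open>s\<close> serves as base point without an embedding.\<close>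
    define l where "l s = Node s u (ptrd (c s))" for s
    have l: "ck_Kn ?n (ptscale Kscale) (ptop av (Ktop av ?N) (Suc 0)) 0 k (lvl (Kn ?n) 0) l"
      unfolding l_def
    proof (rule ck_Node)
      have "ck_Kn ?n (ptscale Kscale) (ptop av (Ktop av ?N) 0) 0 k (lvl (Kn ?n) 0) (\<lambda>s. Base (unBase s))"
        by (intro ck_Base ck_into_Kn ck_lin[OF lin_coordinate]) (auto simp: lvl_0_iff Kn_def)
      then show "ck_Kn ?n (ptscale Kscale) (ptop av (Ktop av ?N) 0) 0 k (lvl (Kn ?n) 0) (\<lambda>s. s)"
        by (rule ck_cong) (simp add: Base_unBase)
      show "ck_Kn ?n (ptscale Kscale) (ptop av (Ktop av ?N) 0) 0 k (lvl (Kn ?n) 0) (\<lambda>s. u)"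
        by (rule ck_const[OF tmod_pt[OF tmod_Kn]]) (use u in simp_all)
      show "ck_Kn ?n (*) (ktop av) 0 k (lvl (Kn ?n) 0) (\<lambda>s. ptrd (c s))"
        by (rule ck_chain[OF ck_lin[OF lin_ptrd, of "lvl UNIV (Suc m)"] cC]) (use cl in auto)
    qed
    have l_im: "l ` lvl (Kn ?n) 0 \<subseteq> ext Kscale (Kn ?N) 0 ?W"
    proof (rule image_subsetI)
      fix s :: "(nat \<Rightarrow> 'k, 'k) pt" assume s: "s \<in> lvl (Kn ?n) 0"
      have "c s \<in> ?V" using im s by blast
      then obtain x v t where xvt: "c s = Node x v t" "x \<in> U" "v \<in> lvl UNIV m" "x + ptscale scE t v \<in> U"
        by (auto elim!: extE)
      have s': "s \<in> lvl (Kn ?N) 0" using s by (auto simp: lvl_0_iff Kn_def)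
      have "s + ptscale Kscale 0 u = s" using pt_add_zero[OF tmod_Kn, of s ?N 0 u] s' u by simp
      then have "g s = x + ptscale scE 0 v" using g_line[OF s, of 0] xvt by simp
      then have "g s = x" using pt_add_zero[OF tmE, of x m v] xvt Ul by auto
      then show "l s \<in> ext Kscale (Kn ?N) 0 ?W"
        using xvt s' u g_line[OF s] line_lvl[OF s] by (simp add: l_def ext_iff)
    qed
    have "ck_Kn ?n scF TF 0 k (lvl (Kn ?n) 0) (\<lambda>s. dquot Kscale scF TF (\<lambda>p. f (g p)) (l s))"
      by (rule ck_chain[OF Dfg l l_im])
    then show "ck_Kn ?n scF TF 0 k (lvl (Kn ?n) 0) (\<lambda>s. dquot scE scF TF f (c s))"
    proof (rule ck_cong)
      fix s :: "(nat \<Rightarrow> 'k, 'k) pt" assume s: "s \<in> lvl (Kn ?n) 0"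
      obtain x v t where xvt: "c s = Node x v t" using cl[OF s] by (rule lvl_SucE)
      \<comment> \<open>Both quotients are formed from the same function of \<open>r\<close>, so
        they agree also at \<open>t = 0\<close>, where both are the same limit expression.\<close>
      show "dquot Kscale scF TF (\<lambda>p. f (g p)) (l s) = dquot scE scF TF f (c s)"
        using g_line[OF s] by (simp add: l_def xvt)
    qed
  qed
  \<comment> \<open>The number of test variables has dropped to \<open>Suc k\<close>, exactly what
    the induction hypothesis demands for class \<open>k\<close> at level
    \<open>Suc m\<close>.\<close>
  then have "ck_map scE TE scF TF (Suc m) k ?V (dquot scE scF TF f)"
    by (rule Suc.IH[OF openin_ext[OF tmE Suc.prems(1)]])
  then show ?case using Ul by (intro ck_Suc_of_dquot[OF F tmE]) simp_all
qed

section \<open>From trees back to the given vector spaces\<close>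

lemma smooth_iff_ck_map:
  "smooth av Kscale (Kn n) (Ktop av n) scE TE (Kn n) c \<longleftrightarrow>
     (\<forall>k. ck_Kn n scE TE 0 k (Base ` Kn n) (\<lambda>p. c (unBase p)))"
proof -
  have "Ck av Kscale (Kn n) (Ktop av n) scE TE (Kn n) c k \<longleftrightarrow> ck_Kn n scE TE 0 k (Base ` Kn n) (\<lambda>p. c (unBase p))" for k
    using Ck_iff_ck_map[of "Kn n" "Ktop av n" Kscale scE TE c k] by simp
  then show ?thesis unfolding smooth_def by blast
qed

lemma Ck_comp_curve:
  assumes f: "Ck av scE UNIV TE scF TF U f k" and c: "smooth av Kscale (Kn n) (Ktop av n) scE TE (Kn n) c"
    and im: "c ` Kn n \<subseteq> U"
  shows "Ck av Kscale (Kn n) (Ktop av n) scF TF (Kn n) (f \<circ> c) k"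
proof -
  have 1: "ck_map scE TE scF TF 0 k (Base ` U) (\<lambda>p. f (unBase p))"
    using f Ck_iff_ck_map[of U TE scE scF TF f k] by simp
  have 2: "ck_Kn n (ptscale scE) (ptop av TE 0) 0 k (Base ` Kn n) (\<lambda>p. Base (c (unBase p)))"
    using c by (intro ck_Base) (simp add: smooth_iff_ck_map)
  have "(\<lambda>p. Base (c (unBase p)) :: ('e, 'k) pt) ` Base ` Kn n \<subseteq> Base ` U" using im by auto
  from ck_chain[OF 1 2 this] have "ck_Kn n scF TF 0 k (Base ` Kn n) (\<lambda>p. f (c (unBase p)))" by simp
  then show ?thesis using Ck_iff_ck_map[of "Kn n" "Ktop av n" Kscale scF TF "f \<circ> c" k] by simp
qed

lemma Ck_if_curves:
  assumes U: "openin TE U"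
    and test: "\<And>c. smooth av Kscale (Kn (Suc k)) (Ktop av (Suc k)) scE TE (Kn (Suc k)) c \<Longrightarrow> c ` Kn (Suc k) \<subseteq> U \<Longrightarrow>
      Ck av Kscale (Kn (Suc k)) (Ktop av (Suc k)) scF TF (Kn (Suc k)) (f \<circ> c) k"
  shows "Ck av scE UNIV TE scF TF U f k"
proof -
  let ?n = "Suc k"
  have "curves_test ?n 0 k (Base ` U) (\<lambda>p. f (unBase p))"
    unfolding curves_test_def
  proof (intro allI impI)
    fix C assume C: "smooth_curve ?n 0 C" and im: "C ` lvl (Kn ?n) 0 \<subseteq> Base ` U"
    define c where "c x = unBase (C (Base x))" for x
    have "smooth av Kscale (Kn ?n) (Ktop av ?n) scE TE (Kn ?n) c"
      unfolding smooth_iff_ck_map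
    proof
      fix j
      have "ck_Kn ?n scE TE 0 j (lvl (Kn ?n) 0) (\<lambda>p. unBase (C p))"
        by (rule ck_chain[OF ck_lin[OF lin_unBase, of "lvl UNIV 0"] C[unfolded smooth_curve_def, rule_format]])
           (use smooth_curve_value[OF C] in auto)
      then show "ck_Kn ?n scE TE 0 j (Base ` Kn ?n) (\<lambda>p. c (unBase p))"
        unfolding lvl.simps by (rule ck_cong) (auto simp: c_def)
    qed
    moreover have "c ` Kn ?n \<subseteq> U"
    proof (rule image_subsetI)
      fix x :: "nat \<Rightarrow> 'k" assume "x \<in> Kn ?n"
      then have "C (Base x) \<in> Base ` U" using im by auto
      then show "c x \<in> U" by (auto simp: c_def)
    qed
    ultimately have "Ck av Kscale (Kn ?n) (Ktop av ?n) scF TF (Kn ?n) (f \<circ> c) k" by (rule test)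
    then have "ck_Kn ?n scF TF 0 k (Base ` Kn ?n) (\<lambda>p. (f \<circ> c) (unBase p))"
      using Ck_iff_ck_map[of "Kn ?n" "Ktop av ?n" Kscale scF TF "f \<circ> c" k] by simp
    then show "ck_Kn ?n scF TF 0 k (lvl (Kn ?n) 0) (\<lambda>p. f (unBase (C p)))"
      unfolding lvl.simps by (rule ck_cong) (auto simp: c_def)
  qed
  then have "ck_map scE TE scF TF 0 k (Base ` U) (\<lambda>p. f (unBase p))"
    by (rule ck_if_curves_test[OF openin_Base_image[OF U]])
  then show ?thesis using Ck_iff_ck_map[of U TE scE scF TF f k] by simp
qed

end

theorem theorem12p4:
  fixes av :: "'k::field \<Rightarrow> real"
    and scE :: "'k \<Rightarrow> 'e::ab_group_add \<Rightarrow> 'e" and TE :: "'e topology"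
    and scF :: "'k \<Rightarrow> 'f::ab_group_add \<Rightarrow> 'f" and TF :: "'f topology"
    and U :: "'e set" and f :: "'e \<Rightarrow> 'f"
  assumes "real_field av \<or> ultrametric_field av"
    and "tvs av scE UNIV TE" and "tvs av scF UNIV TF"
    and "openin TE U" and "U \<noteq> {}"
    and "metrizable_space TE"
  shows "(\<forall>k. Ck av scE UNIV TE scF TF U f k \<longleftrightarrow>
            (\<forall>c :: (nat \<Rightarrow> 'k) \<Rightarrow> 'e.
               smooth av Kscale (Kn (Suc k)) (Ktop av (Suc k)) scE TE (Kn (Suc k)) c
               \<and> c ` Kn (Suc k) \<subseteq> U
               \<longrightarrow> Ck av Kscale (Kn (Suc k)) (Ktop av (Suc k)) scF TF (Kn (Suc k)) (f \<circ> c) k))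
       \<and> (smooth av scE UNIV TE scF TF U f \<longleftrightarrow>
            (\<forall>k\<ge>1. \<forall>c :: (nat \<Rightarrow> 'k) \<Rightarrow> 'e.
               smooth av Kscale (Kn k) (Ktop av k) scE TE (Kn k) c \<and> c ` Kn k \<subseteq> U
               \<longrightarrow> smooth av Kscale (Kn k) (Ktop av k) scF TF (Kn k) (f \<circ> c)))"
proof -
  have "bump_valued av"
    using assms(1)
  proof
    assume "ultrametric_field av"
    then interpret ultrametric av
      by unfold_locales (auto simp: ultrametric_field_def)
    show ?thesis by unfold_locales (rule bump_exists)
  next
    assume "real_field av"
    then obtain \<phi> :: "'k \<Rightarrow> real" where phi: "bij \<phi>" "\<And>x y. \<phi> (x + y) = \<phi> x + \<phi> y"
      "\<And>x y. \<phi> (x * y) = \<phi> x * \<phi> y" "\<phi> 1 = 1" "\<And>x. av x = \<bar>\<phi> x\<bar>"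
      unfolding real_field_def by blast
    have phi0: "\<phi> 0 = 0" using phi(2)[of 0 0] by simp
    have "\<phi> x = 0 \<longleftrightarrow> x = 0" for x using phi(1) phi0 by (metis bij_is_inj injD)
    then have "abs_val av"
      unfolding abs_val_def phi(5) by (simp only: phi(2,3) abs_mult abs_triangle_ineq abs_ge_zero abs_eq_0 simp_thms)
    \<comment> \<open>In the real case nontriviality is witnessed by the scalar
      \<open>1 + 1\<close>.\<close>
    moreover have "av (1 + 1) = 2" by (simp only: phi(2,4,5))
    then have "av (1 + 1) \<noteq> 0 \<and> av (1 + 1) \<noteq> 1" by linarith
    ultimately interpret real_valued av \<phi>
      by unfold_locales (use phi in blast)+
    show ?thesis by unfold_locales (rule bump_exists)
  qed
  then interpret test_problem av scE TE scF TF
    using assms(2,3) metrizable_imp_first_countable[OF assms(6)]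
    by (simp add: test_problem_def test_problem_axioms_def)
  have ab: "Ck av scE UNIV TE scF TF U f k \<longleftrightarrow>
      (\<forall>c. smooth av Kscale (Kn (Suc k)) (Ktop av (Suc k)) scE TE (Kn (Suc k)) c \<and> c ` Kn (Suc k) \<subseteq> U
        \<longrightarrow> Ck av Kscale (Kn (Suc k)) (Ktop av (Suc k)) scF TF (Kn (Suc k)) (f \<circ> c) k)" for k
    using Ck_comp_curve[of U f k "Suc k"] Ck_if_curves[OF assms(4), of k f] by blast
  moreover have "smooth av scE UNIV TE scF TF U f" if "\<forall>k\<ge>1. \<forall>c. smooth av Kscale (Kn k) (Ktop av k) scE TE (Kn k) c
      \<and> c ` Kn k \<subseteq> U \<longrightarrow> smooth av Kscale (Kn k) (Ktop av k) scF TF (Kn k) (f \<circ> c)"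
    unfolding smooth_def[of av scE UNIV TE]
  proof
    fix k
    show "Ck av scE UNIV TE scF TF U f k"
      by (rule Ck_if_curves[OF assms(4)]) (use that smooth_def in force)
  qed
  moreover have "smooth av Kscale (Kn k) (Ktop av k) scF TF (Kn k) (f \<circ> c)"
    if "smooth av scE UNIV TE scF TF U f" "smooth av Kscale (Kn k) (Ktop av k) scE TE (Kn k) c" "c ` Kn k \<subseteq> U" for k c
    unfolding smooth_def
  proof
    fix j
    have "Ck av scE UNIV TE scF TF U f j" using that(1) unfolding smooth_def by blast
    then show "Ck av Kscale (Kn k) (Ktop av k) scF TF (Kn k) (f \<circ> c) j"
      by (rule Ck_comp_curve[OF _ that(2,3)])
  qed
  ultimately show ?thesis by blast
qed

end
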